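(* Let $\mathcal{C}$ and $\mathcal{M}$ be rigid semisimple tensor categories, and let $\Phi:\mathcal{C}\to\mathcal{M}$ be a tensor functor with right adjoint $\mathrm{Tr}_{\mathcal C}:\mathcal M\to\mathcal C$. If $A\in\mathcal{M}$ is a semisimple algebra, then $\mathrm{Tr}_{\mathcal C}(A)$ is a semisimple algebra as well. In particular, if $A$ is semisimple and connected, and thus Frobenius, then so is $\mathrm{Tr}_{\mathcal C}(A)$.
   Context: Categories and functors are linear over a field $k$, with finite-dimensional morphism spaces. A tensor category is rigid if every object $a$ has a dual $a^*$ with maps $1\to a\otimes a^*$ and $a^*\otimes a\to 1$ satisfying the zig-zag equations, and every object is isomorphic to the dual of some object. Tensor functors are strong monoidal; coherence isomorphisms are suppressed. An algebra object is an associative unital triple $(A,m_A,i_A)$. It is semisimple if its category of modules is semisimple, and connected if $\mathrm{Hom}(1,A)$ is one-dimensional. A Frobenius algebra is $(A,m,\Delta,i,\epsilon)$ with $(A,m,i)$ an algebra, $(A,\Delta,\epsilon)$ a coalgebra, and $(m\otimes\mathrm{id}_A)\circ(\mathrm{id}_A\otimes\Delta)=\Delta\circ m=(\mathrm{id}_A\otimes m)\circ(\Delta\otimes\mathrm{id}_A)$; an algebra is called Frobenius here if its algebra structure extends to a Frobenius algebra structure. Let $\varepsilon_x:\Phi(\mathrm{Tr}_{\mathcal C}(x))\to x$ and $\eta_c:c\to\mathrm{Tr}_{\mathcal C}(\Phi(c))$ be the counit and unit of $\Phi\dashv\mathrm{Tr}_{\mathcal C}$. For $x,y\in\mathcal M$,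 $\mu_{x,y}:\mathrm{Tr}_{\mathcal C}(x)\otimes\mathrm{Tr}_{\mathcal C}(y)\to\mathrm{Tr}_{\mathcal C}(x\otimes y)$ is the unique morphism with $\varepsilon_{x\otimes y}\circ\Phi(\mu_{x,y})=\varepsilon_x\otimes\varepsilon_y$. For an algebra $A$ in $\mathcal M$, the object $\mathrm{Tr}_{\mathcal C}(A)$ is an algebra in $\mathcal C$ with multiplication $\mathrm{Tr}_{\mathcal C}(m_A)\circ\mu_{A,A}$ and unit $\mathrm{Tr}_{\mathcal C}(i_A)\circ\eta_{1}$. *)

theory Defs
  imports "Jordan_Normal_Form.Missing_VectorSpace"
begin

section \<open>Linear categories\<close>

text \<open>
  A category enriched in vector spaces over a field \<open>K\<close>: the morphisms from \<open>a\<close> to \<open>b\<close> form the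
  carrier of the vector space \<open>Hom C a b\<close> (the ring multiplication and unit which a
  \<^typ>\<open>('k, 'm) module\<close> record also carries are not used).  Different hom-spaces are allowed to
  overlap as sets, so that the morphisms of a category of modules can be represented by their
  underlying morphisms; every axiom is guarded by hom-space membership.  Every small linear
  category can be presented with disjoint hom-spaces, so nothing is lost by letting composition
  (and, below, tensor product and functors) act on bare morphisms.
\<close>

record ('o, 'm, 'k) linear_cat =
  Obj :: "'o set"
  Hom :: "'o \<Rightarrow> 'o \<Rightarrow> ('k, 'm) module"
  Id :: "'o \<Rightarrow> 'm"
  Comp :: "'m \<Rightarrow> 'm \<Rightarrow> 'm"  (infixl \<open>\<cdot>\<index>\<close> 65)

abbreviation mor :: "('o, 'm, 'k, 'y) linear_cat_scheme \<Rightarrow> 'o \<Rightarrow> 'o \<Rightarrow> 'm set"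
  where "mor C a b \<equiv> carrier (Hom C a b)"

locale linear_category =
  fixes K :: "('k, 'z) ring_scheme" and C :: "('o, 'm, 'k, 'y) linear_cat_scheme" (structure)
  assumes field: "field K"
    and hom_vectorspace: "a \<in> Obj C \<Longrightarrow> b \<in> Obj C \<Longrightarrow> vectorspace K (Hom C a b)"
    and hom_fin_dim: "a \<in> Obj C \<Longrightarrow> b \<in> Obj C \<Longrightarrow> vectorspace.fin_dim K (Hom C a b)"
    and id_mor: "a \<in> Obj C \<Longrightarrow> Id C a \<in> mor C a a"
    and comp_mor: "\<lbrakk>a \<in> Obj C; b \<in> Obj C; c \<in> Obj C; f \<in> mor C a b; g \<in> mor C b c\<rbrakk>
      \<Longrightarrow> g \<cdot> f \<in> mor C a c"
    and comp_id_right: "\<lbrakk>a \<in> Obj C; b \<in> Obj C; f \<in> mor C a b\<rbrakk> \<Longrightarrow> f \<cdot> Id C a = f"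
    and comp_id_left: "\<lbrakk>a \<in> Obj C; b \<in> Obj C; f \<in> mor C a b\<rbrakk> \<Longrightarrow> Id C b \<cdot> f = f"
    and comp_assoc: "\<lbrakk>a \<in> Obj C; b \<in> Obj C; c \<in> Obj C; d \<in> Obj C;
        f \<in> mor C a b; g \<in> mor C b c; h \<in> mor C c d\<rbrakk> \<Longrightarrow> (h \<cdot> g) \<cdot> f = h \<cdot> (g \<cdot> f)"
    and comp_linear_left: "\<lbrakk>a \<in> Obj C; b \<in> Obj C; c \<in> Obj C; f \<in> mor C a b\<rbrakk>
      \<Longrightarrow> (\<lambda>g. g \<cdot> f) \<in> module_hom K (Hom C b c) (Hom C a c)"
    and comp_linear_right: "\<lbrakk>a \<in> Obj C; b \<in> Obj C; c \<in> Obj C; g \<in> mor C b c\<rbrakk>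
      \<Longrightarrow> (\<lambda>f. g \<cdot> f) \<in> module_hom K (Hom C a b) (Hom C a c)"

text \<open>The domain and codomain are arguments of the following notions, because hom-spaces may overlap.\<close>

definition inverse_mor :: "('o, 'm, 'k, 'y) linear_cat_scheme \<Rightarrow> 'o \<Rightarrow> 'o \<Rightarrow> 'm \<Rightarrow> 'm \<Rightarrow> bool"
  where "inverse_mor C a b f g \<longleftrightarrow>
    f \<in> mor C a b \<and> g \<in> mor C b a \<and> g \<cdot>\<^bsub>C\<^esub> f = Id C a \<and> f \<cdot>\<^bsub>C\<^esub> g = Id C b"

definition iso_mor :: "('o, 'm, 'k, 'y) linear_cat_scheme \<Rightarrow> 'o \<Rightarrow> 'o \<Rightarrow> 'm \<Rightarrow> bool"
  where "iso_mor C a b f \<longleftrightarrow> (\<exists>g. inverse_mor C a b f g)"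

definition inv_mor :: "('o, 'm, 'k, 'y) linear_cat_scheme \<Rightarrow> 'o \<Rightarrow> 'o \<Rightarrow> 'm \<Rightarrow> 'm"
  where "inv_mor C a b f = (THE g. inverse_mor C a b f g)"

definition isomorphic_obj :: "('o, 'm, 'k, 'y) linear_cat_scheme \<Rightarrow> 'o \<Rightarrow> 'o \<Rightarrow> bool"
  where "isomorphic_obj C a b \<longleftrightarrow> (\<exists>f. iso_mor C a b f)"

definition monic :: "('o, 'm, 'k, 'y) linear_cat_scheme \<Rightarrow> 'o \<Rightarrow> 'o \<Rightarrow> 'm \<Rightarrow> bool"
  where "monic C a b f \<longleftrightarrow> f \<in> mor C a b \<and>
    (\<forall>x\<in>Obj C. \<forall>g\<in>mor C x a. \<forall>h\<in>mor C x a. f \<cdot>\<^bsub>C\<^esub> g = f \<cdot>\<^bsub>C\<^esub> h \<longrightarrow> g = h)"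

definition epic :: "('o, 'm, 'k, 'y) linear_cat_scheme \<Rightarrow> 'o \<Rightarrow> 'o \<Rightarrow> 'm \<Rightarrow> bool"
  where "epic C a b f \<longleftrightarrow> f \<in> mor C a b \<and>
    (\<forall>x\<in>Obj C. \<forall>g\<in>mor C b x. \<forall>h\<in>mor C b x. g \<cdot>\<^bsub>C\<^esub> f = h \<cdot>\<^bsub>C\<^esub> f \<longrightarrow> g = h)"

definition is_kernel :: "('o, 'm, 'k, 'y) linear_cat_scheme \<Rightarrow> 'o \<Rightarrow> 'o \<Rightarrow> 'm \<Rightarrow> 'o \<Rightarrow> 'm \<Rightarrow> bool"
  where "is_kernel C a b f k i \<longleftrightarrow>
    k \<in> Obj C \<and> i \<in> mor C k a \<and> f \<cdot>\<^bsub>C\<^esub> i = \<zero>\<^bsub>Hom C k b\<^esub> \<and>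
    (\<forall>x\<in>Obj C. \<forall>g\<in>mor C x a. f \<cdot>\<^bsub>C\<^esub> g = \<zero>\<^bsub>Hom C x b\<^esub> \<longrightarrow>
      (\<exists>!h. h \<in> mor C x k \<and> i \<cdot>\<^bsub>C\<^esub> h = g))"

definition is_cokernel :: "('o, 'm, 'k, 'y) linear_cat_scheme \<Rightarrow> 'o \<Rightarrow> 'o \<Rightarrow> 'm \<Rightarrow> 'o \<Rightarrow> 'm \<Rightarrow> bool"
  where "is_cokernel C a b f q p \<longleftrightarrow>
    q \<in> Obj C \<and> p \<in> mor C b q \<and> p \<cdot>\<^bsub>C\<^esub> f = \<zero>\<^bsub>Hom C a q\<^esub> \<and>
    (\<forall>x\<in>Obj C. \<forall>g\<in>mor C b x. g \<cdot>\<^bsub>C\<^esub> f = \<zero>\<^bsub>Hom C a x\<^esub> \<longrightarrow>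
      (\<exists>!h. h \<in> mor C q x \<and> h \<cdot>\<^bsub>C\<^esub> p = g))"

definition zero_object :: "('o, 'm, 'k, 'y) linear_cat_scheme \<Rightarrow> 'o \<Rightarrow> bool"
  where "zero_object C z \<longleftrightarrow> z \<in> Obj C \<and>
    (\<forall>a\<in>Obj C. mor C a z = {\<zero>\<^bsub>Hom C a z\<^esub>} \<and> mor C z a = {\<zero>\<^bsub>Hom C z a\<^esub>})"

definition is_biproduct ::
  "('o, 'm, 'k, 'y) linear_cat_scheme \<Rightarrow> 'o \<Rightarrow> nat \<Rightarrow> (nat \<Rightarrow> 'o) \<Rightarrow> (nat \<Rightarrow> 'm) \<Rightarrow> (nat \<Rightarrow> 'm) \<Rightarrow> bool"
  where "is_biproduct C x n s \<iota> \<pi> \<longleftrightarrow>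
    x \<in> Obj C \<and> (\<forall>j<n. s j \<in> Obj C \<and> \<iota> j \<in> mor C (s j) x \<and> \<pi> j \<in> mor C x (s j)) \<and>
    (\<forall>j<n. \<forall>l<n. \<pi> j \<cdot>\<^bsub>C\<^esub> \<iota> l = (if j = l then Id C (s j) else \<zero>\<^bsub>Hom C (s l) (s j)\<^esub>)) \<and>
    finsum (Hom C x x) (\<lambda>j. \<iota> j \<cdot>\<^bsub>C\<^esub> \<pi> j) {..<n} = Id C x"

definition abelian_category :: "('o, 'm, 'k, 'y) linear_cat_scheme \<Rightarrow> bool"
  where "abelian_category C \<longleftrightarrow>
    (\<exists>z. zero_object C z) \<and>
    (\<forall>a\<in>Obj C. \<forall>b\<in>Obj C. \<exists>x \<iota> \<pi>. is_biproduct C x 2 (\<lambda>j. if j = 0 then a else b) \<iota> \<pi>) \<and>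
    (\<forall>a\<in>Obj C. \<forall>b\<in>Obj C. \<forall>f\<in>mor C a b.
      (\<exists>k i. is_kernel C a b f k i) \<and> (\<exists>q p. is_cokernel C a b f q p)) \<and>
    (\<forall>a\<in>Obj C. \<forall>b\<in>Obj C. \<forall>f. monic C a b f \<longrightarrow>
      (\<exists>c\<in>Obj C. \<exists>g\<in>mor C b c. is_kernel C b c g a f)) \<and>
    (\<forall>a\<in>Obj C. \<forall>b\<in>Obj C. \<forall>f. epic C a b f \<longrightarrow>
      (\<exists>c\<in>Obj C. \<exists>g\<in>mor C c a. is_cokernel C c a g b f))"

definition simple_object :: "('o, 'm, 'k, 'y) linear_cat_scheme \<Rightarrow> 'o \<Rightarrow> bool"
  where "simple_object C s \<longleftrightarrow> s \<in> Obj C \<and> \<not> zero_object C s \<and>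
    (\<forall>a\<in>Obj C. \<forall>f. monic C a s f \<longrightarrow> zero_object C a \<or> iso_mor C a s f)"

text \<open>Since hom-spaces are finite-dimensional, only finite direct sums can occur.\<close>

definition semisimple_category :: "('o, 'm, 'k, 'y) linear_cat_scheme \<Rightarrow> bool"
  where "semisimple_category C \<longleftrightarrow> abelian_category C \<and>
    (\<forall>x\<in>Obj C. \<exists>n s \<iota> \<pi>. is_biproduct C x n s \<iota> \<pi> \<and> (\<forall>j<n. simple_object C (s j)))"


section \<open>Tensor categories\<close>

record ('o, 'm, 'k) tensor_cat = "('o, 'm, 'k) linear_cat" +
  tobj :: "'o \<Rightarrow> 'o \<Rightarrow> 'o"  (infixl \<open>\<otimes>\<^sub>o\<index>\<close> 70)
  tmor :: "'m \<Rightarrow> 'm \<Rightarrow> 'm"  (infixl \<open>\<otimes>\<^sub>m\<index>\<close> 70)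
  unit_obj :: 'o  (\<open>\<I>\<index>\<close>)
  associator :: "'o \<Rightarrow> 'o \<Rightarrow> 'o \<Rightarrow> 'm"
  lunitor :: "'o \<Rightarrow> 'm"
  runitor :: "'o \<Rightarrow> 'm"

locale tensor_category = linear_category K C
  for K :: "('k, 'z) ring_scheme" and C :: "('o, 'm, 'k, 'y) tensor_cat_scheme" (structure) +
  assumes tobj_closed: "a \<in> Obj C \<Longrightarrow> b \<in> Obj C \<Longrightarrow> a \<otimes>\<^sub>o b \<in> Obj C"
    and unit_closed: "\<I> \<in> Obj C"
    and tmor_mor: "\<lbrakk>a \<in> Obj C; b \<in> Obj C; c \<in> Obj C; d \<in> Obj C; f \<in> mor C a b; g \<in> mor C c d\<rbrakk>
      \<Longrightarrow> f \<otimes>\<^sub>m g \<in> mor C (a \<otimes>\<^sub>o c) (b \<otimes>\<^sub>o d)"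
    and tmor_id: "\<lbrakk>a \<in> Obj C; b \<in> Obj C\<rbrakk> \<Longrightarrow> Id C a \<otimes>\<^sub>m Id C b = Id C (a \<otimes>\<^sub>o b)"
    and tmor_comp: "\<lbrakk>a \<in> Obj C; b \<in> Obj C; c \<in> Obj C; a' \<in> Obj C; b' \<in> Obj C; c' \<in> Obj C;
        f \<in> mor C a b; g \<in> mor C b c; f' \<in> mor C a' b'; g' \<in> mor C b' c'\<rbrakk>
      \<Longrightarrow> (g \<cdot> f) \<otimes>\<^sub>m (g' \<cdot> f') = (g \<otimes>\<^sub>m g') \<cdot> (f \<otimes>\<^sub>m f')"
    and tmor_linear_left: "\<lbrakk>a \<in> Obj C; b \<in> Obj C; c \<in> Obj C; d \<in> Obj C; g \<in> mor C c d\<rbrakk>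
      \<Longrightarrow> (\<lambda>f. f \<otimes>\<^sub>m g) \<in> module_hom K (Hom C a b) (Hom C (a \<otimes>\<^sub>o c) (b \<otimes>\<^sub>o d))"
    and tmor_linear_right: "\<lbrakk>a \<in> Obj C; b \<in> Obj C; c \<in> Obj C; d \<in> Obj C; f \<in> mor C a b\<rbrakk>
      \<Longrightarrow> (\<lambda>g. f \<otimes>\<^sub>m g) \<in> module_hom K (Hom C c d) (Hom C (a \<otimes>\<^sub>o c) (b \<otimes>\<^sub>o d))"
    and associator_iso: "\<lbrakk>a \<in> Obj C; b \<in> Obj C; c \<in> Obj C\<rbrakk>
      \<Longrightarrow> iso_mor C ((a \<otimes>\<^sub>o b) \<otimes>\<^sub>o c) (a \<otimes>\<^sub>o (b \<otimes>\<^sub>o c)) (associator C a b c)"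
    and lunitor_iso: "a \<in> Obj C \<Longrightarrow> iso_mor C (\<I> \<otimes>\<^sub>o a) a (lunitor C a)"
    and runitor_iso: "a \<in> Obj C \<Longrightarrow> iso_mor C (a \<otimes>\<^sub>o \<I>) a (runitor C a)"
    and associator_natural: "\<lbrakk>a \<in> Obj C; b \<in> Obj C; c \<in> Obj C; a' \<in> Obj C; b' \<in> Obj C; c' \<in> Obj C;
        f \<in> mor C a a'; g \<in> mor C b b'; h \<in> mor C c c'\<rbrakk>
      \<Longrightarrow> associator C a' b' c' \<cdot> ((f \<otimes>\<^sub>m g) \<otimes>\<^sub>m h) = (f \<otimes>\<^sub>m (g \<otimes>\<^sub>m h)) \<cdot> associator C a b c"
    and lunitor_natural: "\<lbrakk>a \<in> Obj C; b \<in> Obj C; f \<in> mor C a b\<rbrakk>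
      \<Longrightarrow> lunitor C b \<cdot> (Id C \<I> \<otimes>\<^sub>m f) = f \<cdot> lunitor C a"
    and runitor_natural: "\<lbrakk>a \<in> Obj C; b \<in> Obj C; f \<in> mor C a b\<rbrakk>
      \<Longrightarrow> runitor C b \<cdot> (f \<otimes>\<^sub>m Id C \<I>) = f \<cdot> runitor C a"
    and pentagon: "\<lbrakk>a \<in> Obj C; b \<in> Obj C; c \<in> Obj C; d \<in> Obj C\<rbrakk>
      \<Longrightarrow> (Id C a \<otimes>\<^sub>m associator C b c d) \<cdot> associator C a (b \<otimes>\<^sub>o c) d
            \<cdot> (associator C a b c \<otimes>\<^sub>m Id C d)
          = associator C a b (c \<otimes>\<^sub>o d) \<cdot> associator C (a \<otimes>\<^sub>o b) c d"
    and triangle: "\<lbrakk>a \<in> Obj C; b \<in> Obj C\<rbrakk>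
      \<Longrightarrow> (Id C a \<otimes>\<^sub>m lunitor C b) \<cdot> associator C a \<I> b = runitor C a \<otimes>\<^sub>m Id C b"

text \<open>Inverse of the associator: \<open>a \<otimes> (b \<otimes> c) \<rightarrow> (a \<otimes> b) \<otimes> c\<close>.\<close>

definition associator_inv :: "('o, 'm, 'k, 'y) tensor_cat_scheme \<Rightarrow> 'o \<Rightarrow> 'o \<Rightarrow> 'o \<Rightarrow> 'm"
  where "associator_inv C a b c =
    inv_mor C ((a \<otimes>\<^sub>o\<^bsub>C\<^esub> b) \<otimes>\<^sub>o\<^bsub>C\<^esub> c) (a \<otimes>\<^sub>o\<^bsub>C\<^esub> (b \<otimes>\<^sub>o\<^bsub>C\<^esub> c)) (associator C a b c)"

text \<open>
  \<open>is_dual C a d\<close>: \<open>d\<close> is a dual \<open>a\<^sup>*\<close> of \<open>a\<close>, with \<open>coev : 1 \<rightarrow> a \<otimes> a\<^sup>*\<close> and \<open>ev : a\<^sup>* \<otimes> a \<rightarrow> 1\<close>.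
  The zig-zag equations are written as equalities of morphisms \<open>1 \<otimes> a \<rightarrow> a\<close> and
  \<open>a\<^sup>* \<otimes> 1 \<rightarrow> a\<^sup>*\<close>, so the right-hand sides are unitors instead of identities.
\<close>

definition is_dual :: "('o, 'm, 'k, 'y) tensor_cat_scheme \<Rightarrow> 'o \<Rightarrow> 'o \<Rightarrow> bool"
  where "is_dual C a d \<longleftrightarrow> d \<in> Obj C \<and>
    (\<exists>coev \<in> mor C \<I>\<^bsub>C\<^esub> (a \<otimes>\<^sub>o\<^bsub>C\<^esub> d). \<exists>ev \<in> mor C (d \<otimes>\<^sub>o\<^bsub>C\<^esub> a) \<I>\<^bsub>C\<^esub>.
      runitor C a \<cdot>\<^bsub>C\<^esub> (Id C a \<otimes>\<^sub>m\<^bsub>C\<^esub> ev) \<cdot>\<^bsub>C\<^esub> associator C a d a \<cdot>\<^bsub>C\<^esub> (coev \<otimes>\<^sub>m\<^bsub>C\<^esub> Id C a) = lunitor C a \<and>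
      lunitor C d \<cdot>\<^bsub>C\<^esub> (ev \<otimes>\<^sub>m\<^bsub>C\<^esub> Id C d) \<cdot>\<^bsub>C\<^esub> associator_inv C d a d \<cdot>\<^bsub>C\<^esub> (Id C d \<otimes>\<^sub>m\<^bsub>C\<^esub> coev) = runitor C d)"

locale rigid_semisimple_tensor_category = tensor_category K C
  for K :: "('k, 'z) ring_scheme" and C :: "('o, 'm, 'k, 'y) tensor_cat_scheme" (structure) +
  assumes has_dual: "a \<in> Obj C \<Longrightarrow> \<exists>d. is_dual C a d"
    and iso_to_dual: "a \<in> Obj C \<Longrightarrow> \<exists>b\<in>Obj C. \<exists>d. is_dual C b d \<and> isomorphic_obj C a d"
    and semisimple: "semisimple_category C"


section \<open>Functors and adjunctions\<close>

record ('o, 'm, 'p, 'n) functor_data =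
  on_obj :: "'o \<Rightarrow> 'p"
  on_mor :: "'m \<Rightarrow> 'n"

locale linear_functor = src: linear_category K C + tgt: linear_category K D
  for K :: "('k, 'z) ring_scheme" and C :: "('o, 'm, 'k, 'y) linear_cat_scheme"
    and D :: "('p, 'n, 'k, 'x) linear_cat_scheme" and F :: "('o, 'm, 'p, 'n, 'w) functor_data_scheme" +
  assumes on_obj_closed: "a \<in> Obj C \<Longrightarrow> on_obj F a \<in> Obj D"
    and on_mor_linear: "\<lbrakk>a \<in> Obj C; b \<in> Obj C\<rbrakk>
      \<Longrightarrow> on_mor F \<in> module_hom K (Hom C a b) (Hom D (on_obj F a) (on_obj F b))"
    and on_mor_id: "a \<in> Obj C \<Longrightarrow> on_mor F (Id C a) = Id D (on_obj F a)"
    and on_mor_comp: "\<lbrakk>a \<in> Obj C; b \<in> Obj C; c \<in> Obj C; f \<in> mor C a b; g \<in> mor C b c\<rbrakk>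
      \<Longrightarrow> on_mor F (g \<cdot>\<^bsub>C\<^esub> f) = on_mor F g \<cdot>\<^bsub>D\<^esub> on_mor F f"

text \<open>
  Strong monoidal structure: isomorphisms \<open>tens_iso F a b : F a \<otimes> F b \<rightarrow> F (a \<otimes> b)\<close> and
  \<open>unit_iso F : 1 \<rightarrow> F 1\<close>.
\<close>

record ('o, 'm, 'p, 'n) tensor_functor_data = "('o, 'm, 'p, 'n) functor_data" +
  tens_iso :: "'o \<Rightarrow> 'o \<Rightarrow> 'n"
  unit_iso :: 'n

locale tensor_functor =
  linear_functor K C D F + src: tensor_category K C + tgt: tensor_category K D
  for K :: "('k, 'z) ring_scheme" and C :: "('o, 'm, 'k, 'y) tensor_cat_scheme"
    and D :: "('p, 'n, 'k, 'x) tensor_cat_scheme"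
    and F :: "('o, 'm, 'p, 'n, 'w) tensor_functor_data_scheme" +
  assumes tens_iso_iso: "\<lbrakk>a \<in> Obj C; b \<in> Obj C\<rbrakk>
      \<Longrightarrow> iso_mor D (on_obj F a \<otimes>\<^sub>o\<^bsub>D\<^esub> on_obj F b) (on_obj F (a \<otimes>\<^sub>o\<^bsub>C\<^esub> b)) (tens_iso F a b)"
    and unit_iso_iso: "iso_mor D \<I>\<^bsub>D\<^esub> (on_obj F \<I>\<^bsub>C\<^esub>) (unit_iso F)"
    and tens_iso_natural: "\<lbrakk>a \<in> Obj C; b \<in> Obj C; a' \<in> Obj C; b' \<in> Obj C;
        f \<in> mor C a a'; g \<in> mor C b b'\<rbrakk>
      \<Longrightarrow> on_mor F (f \<otimes>\<^sub>m\<^bsub>C\<^esub> g) \<cdot>\<^bsub>D\<^esub> tens_iso F a b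
          = tens_iso F a' b' \<cdot>\<^bsub>D\<^esub> (on_mor F f \<otimes>\<^sub>m\<^bsub>D\<^esub> on_mor F g)"
    and tens_iso_assoc: "\<lbrakk>a \<in> Obj C; b \<in> Obj C; c \<in> Obj C\<rbrakk>
      \<Longrightarrow> on_mor F (associator C a b c) \<cdot>\<^bsub>D\<^esub> tens_iso F (a \<otimes>\<^sub>o\<^bsub>C\<^esub> b) c
            \<cdot>\<^bsub>D\<^esub> (tens_iso F a b \<otimes>\<^sub>m\<^bsub>D\<^esub> Id D (on_obj F c))
          = tens_iso F a (b \<otimes>\<^sub>o\<^bsub>C\<^esub> c) \<cdot>\<^bsub>D\<^esub> (Id D (on_obj F a) \<otimes>\<^sub>m\<^bsub>D\<^esub> tens_iso F b c)
            \<cdot>\<^bsub>D\<^esub> associator D (on_obj F a) (on_obj F b) (on_obj F c)"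
    and unit_iso_left: "a \<in> Obj C
      \<Longrightarrow> on_mor F (lunitor C a) \<cdot>\<^bsub>D\<^esub> tens_iso F \<I>\<^bsub>C\<^esub> a \<cdot>\<^bsub>D\<^esub> (unit_iso F \<otimes>\<^sub>m\<^bsub>D\<^esub> Id D (on_obj F a))
          = lunitor D (on_obj F a)"
    and unit_iso_right: "a \<in> Obj C
      \<Longrightarrow> on_mor F (runitor C a) \<cdot>\<^bsub>D\<^esub> tens_iso F a \<I>\<^bsub>C\<^esub> \<cdot>\<^bsub>D\<^esub> (Id D (on_obj F a) \<otimes>\<^sub>m\<^bsub>D\<^esub> unit_iso F)
          = runitor D (on_obj F a)"

locale linear_adjunction = left: linear_functor K C D F + right: linear_functor K D C G
  for K :: "('k, 'z) ring_scheme" and C :: "('o, 'm, 'k, 'y) linear_cat_scheme"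
    and D :: "('p, 'n, 'k, 'x) linear_cat_scheme"
    and F :: "('o, 'm, 'p, 'n, 'w) functor_data_scheme"
    and G :: "('p, 'n, 'o, 'm, 'v) functor_data_scheme" +
  fixes \<eta> :: "'o \<Rightarrow> 'm" and \<epsilon> :: "'p \<Rightarrow> 'n"
  assumes unit_mor: "c \<in> Obj C \<Longrightarrow> \<eta> c \<in> mor C c (on_obj G (on_obj F c))"
    and counit_mor: "x \<in> Obj D \<Longrightarrow> \<epsilon> x \<in> mor D (on_obj F (on_obj G x)) x"
    and unit_natural: "\<lbrakk>c \<in> Obj C; c' \<in> Obj C; f \<in> mor C c c'\<rbrakk>
      \<Longrightarrow> \<eta> c' \<cdot>\<^bsub>C\<^esub> f = on_mor G (on_mor F f) \<cdot>\<^bsub>C\<^esub> \<eta> c"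
    and counit_natural: "\<lbrakk>x \<in> Obj D; x' \<in> Obj D; g \<in> mor D x x'\<rbrakk>
      \<Longrightarrow> \<epsilon> x' \<cdot>\<^bsub>D\<^esub> on_mor F (on_mor G g) = g \<cdot>\<^bsub>D\<^esub> \<epsilon> x"
    and triangle_left: "c \<in> Obj C
      \<Longrightarrow> \<epsilon> (on_obj F c) \<cdot>\<^bsub>D\<^esub> on_mor F (\<eta> c) = Id D (on_obj F c)"
    and triangle_right: "x \<in> Obj D
      \<Longrightarrow> on_mor G (\<epsilon> x) \<cdot>\<^bsub>C\<^esub> \<eta> (on_obj G x) = Id C (on_obj G x)"


section \<open>Algebra objects\<close>

definition algebra_object :: "('o, 'm, 'k, 'y) tensor_cat_scheme \<Rightarrow> 'o \<Rightarrow> 'm \<Rightarrow> 'm \<Rightarrow> bool"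
  where "algebra_object C A m i \<longleftrightarrow> A \<in> Obj C \<and>
    m \<in> mor C (A \<otimes>\<^sub>o\<^bsub>C\<^esub> A) A \<and> i \<in> mor C \<I>\<^bsub>C\<^esub> A \<and>
    m \<cdot>\<^bsub>C\<^esub> (m \<otimes>\<^sub>m\<^bsub>C\<^esub> Id C A) = m \<cdot>\<^bsub>C\<^esub> (Id C A \<otimes>\<^sub>m\<^bsub>C\<^esub> m) \<cdot>\<^bsub>C\<^esub> associator C A A A \<and>
    m \<cdot>\<^bsub>C\<^esub> (i \<otimes>\<^sub>m\<^bsub>C\<^esub> Id C A) = lunitor C A \<and>
    m \<cdot>\<^bsub>C\<^esub> (Id C A \<otimes>\<^sub>m\<^bsub>C\<^esub> i) = runitor C A"

definition coalgebra_object :: "('o, 'm, 'k, 'y) tensor_cat_scheme \<Rightarrow> 'o \<Rightarrow> 'm \<Rightarrow> 'm \<Rightarrow> bool"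
  where "coalgebra_object C A \<Delta> e \<longleftrightarrow> A \<in> Obj C \<and>
    \<Delta> \<in> mor C A (A \<otimes>\<^sub>o\<^bsub>C\<^esub> A) \<and> e \<in> mor C A \<I>\<^bsub>C\<^esub> \<and>
    associator C A A A \<cdot>\<^bsub>C\<^esub> (\<Delta> \<otimes>\<^sub>m\<^bsub>C\<^esub> Id C A) \<cdot>\<^bsub>C\<^esub> \<Delta> = (Id C A \<otimes>\<^sub>m\<^bsub>C\<^esub> \<Delta>) \<cdot>\<^bsub>C\<^esub> \<Delta> \<and>
    lunitor C A \<cdot>\<^bsub>C\<^esub> (e \<otimes>\<^sub>m\<^bsub>C\<^esub> Id C A) \<cdot>\<^bsub>C\<^esub> \<Delta> = Id C A \<and>
    runitor C A \<cdot>\<^bsub>C\<^esub> (Id C A \<otimes>\<^sub>m\<^bsub>C\<^esub> e) \<cdot>\<^bsub>C\<^esub> \<Delta> = Id C A"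

definition frobenius_structure ::
  "('o, 'm, 'k, 'y) tensor_cat_scheme \<Rightarrow> 'o \<Rightarrow> 'm \<Rightarrow> 'm \<Rightarrow> 'm \<Rightarrow> 'm \<Rightarrow> bool"
  where "frobenius_structure C A m \<Delta> i e \<longleftrightarrow>
    algebra_object C A m i \<and> coalgebra_object C A \<Delta> e \<and>
    (m \<otimes>\<^sub>m\<^bsub>C\<^esub> Id C A) \<cdot>\<^bsub>C\<^esub> associator_inv C A A A \<cdot>\<^bsub>C\<^esub> (Id C A \<otimes>\<^sub>m\<^bsub>C\<^esub> \<Delta>) = \<Delta> \<cdot>\<^bsub>C\<^esub> m \<and>
    \<Delta> \<cdot>\<^bsub>C\<^esub> m = (Id C A \<otimes>\<^sub>m\<^bsub>C\<^esub> m) \<cdot>\<^bsub>C\<^esub> associator C A A A \<cdot>\<^bsub>C\<^esub> (\<Delta> \<otimes>\<^sub>m\<^bsub>C\<^esub> Id C A)"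

definition frobenius_algebra :: "('o, 'm, 'k, 'y) tensor_cat_scheme \<Rightarrow> 'o \<Rightarrow> 'm \<Rightarrow> 'm \<Rightarrow> bool"
  where "frobenius_algebra C A m i \<longleftrightarrow> (\<exists>\<Delta> e. frobenius_structure C A m \<Delta> i e)"

text \<open>Modules are right modules: objects \<open>x\<close> with an action \<open>r : x \<otimes> A \<rightarrow> x\<close>.\<close>

definition module_object ::
  "('o, 'm, 'k, 'y) tensor_cat_scheme \<Rightarrow> 'o \<Rightarrow> 'm \<Rightarrow> 'm \<Rightarrow> 'o \<Rightarrow> 'm \<Rightarrow> bool"
  where "module_object C A m i x r \<longleftrightarrow> x \<in> Obj C \<and> r \<in> mor C (x \<otimes>\<^sub>o\<^bsub>C\<^esub> A) x \<and>
    r \<cdot>\<^bsub>C\<^esub> (r \<otimes>\<^sub>m\<^bsub>C\<^esub> Id C A) = r \<cdot>\<^bsub>C\<^esub> (Id C x \<otimes>\<^sub>m\<^bsub>C\<^esub> m) \<cdot>\<^bsub>C\<^esub> associator C x A A \<and>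
    r \<cdot>\<^bsub>C\<^esub> (Id C x \<otimes>\<^sub>m\<^bsub>C\<^esub> i) = runitor C x"

definition module_category ::
  "('o, 'm, 'k, 'y) tensor_cat_scheme \<Rightarrow> 'o \<Rightarrow> 'm \<Rightarrow> 'm \<Rightarrow> ('o \<times> 'm, 'm, 'k) linear_cat"
  where "module_category C A m i =
    \<lparr>Obj = {(x, r). module_object C A m i x r},
     Hom = (\<lambda>(x, r) (y, s). (Hom C x y)
       \<lparr>carrier := {f \<in> mor C x y. f \<cdot>\<^bsub>C\<^esub> r = s \<cdot>\<^bsub>C\<^esub> (f \<otimes>\<^sub>m\<^bsub>C\<^esub> Id C A)}\<rparr>),
     Id = (\<lambda>(x, r). Id C x),
     Comp = Comp C\<rparr>"

definition semisimple_algebra :: "('o, 'm, 'k, 'y) tensor_cat_scheme \<Rightarrow> 'o \<Rightarrow> 'm \<Rightarrow> 'm \<Rightarrow> bool"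
  where "semisimple_algebra C A m i \<longleftrightarrow>
    algebra_object C A m i \<and> semisimple_category (module_category C A m i)"

definition connected_object ::
  "('k, 'z) ring_scheme \<Rightarrow> ('o, 'm, 'k, 'y) tensor_cat_scheme \<Rightarrow> 'o \<Rightarrow> bool"
  where "connected_object K C A \<longleftrightarrow> vectorspace.dim K (Hom C \<I>\<^bsub>C\<^esub> A) = 1"


section \<open>The algebra structure on the image under the right adjoint\<close>

text \<open>
  \<open>adj_mu C D F G \<epsilon> x y : G x \<otimes> G y \<rightarrow> G (x \<otimes> y)\<close>; its defining equation is
  \<open>\<epsilon> \<circ> F \<mu> = \<epsilon> \<otimes> \<epsilon>\<close> with the coherence isomorphism \<open>F (G x) \<otimes> F (G y) \<rightarrow> F (G x \<otimes> G y)\<close> restored.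
\<close>

definition adj_mu ::
  "('o, 'm, 'k, 'y) tensor_cat_scheme \<Rightarrow> ('p, 'n, 'k, 'x) tensor_cat_scheme \<Rightarrow>
   ('o, 'm, 'p, 'n, 'w) tensor_functor_data_scheme \<Rightarrow> ('p, 'n, 'o, 'm, 'v) functor_data_scheme \<Rightarrow>
   ('p \<Rightarrow> 'n) \<Rightarrow> 'p \<Rightarrow> 'p \<Rightarrow> 'm"
  where "adj_mu C D F G \<epsilon> x y =
    (THE \<mu>. \<mu> \<in> mor C (on_obj G x \<otimes>\<^sub>o\<^bsub>C\<^esub> on_obj G y) (on_obj G (x \<otimes>\<^sub>o\<^bsub>D\<^esub> y)) \<and>
      \<epsilon> (x \<otimes>\<^sub>o\<^bsub>D\<^esub> y) \<cdot>\<^bsub>D\<^esub> on_mor F \<mu> \<cdot>\<^bsub>D\<^esub> tens_iso F (on_obj G x) (on_obj G y)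
        = \<epsilon> x \<otimes>\<^sub>m\<^bsub>D\<^esub> \<epsilon> y)"

definition adj_mult ::
  "('o, 'm, 'k, 'y) tensor_cat_scheme \<Rightarrow> ('p, 'n, 'k, 'x) tensor_cat_scheme \<Rightarrow>
   ('o, 'm, 'p, 'n, 'w) tensor_functor_data_scheme \<Rightarrow> ('p, 'n, 'o, 'm, 'v) functor_data_scheme \<Rightarrow>
   ('p \<Rightarrow> 'n) \<Rightarrow> 'p \<Rightarrow> 'n \<Rightarrow> 'm"
  where "adj_mult C D F G \<epsilon> A m = on_mor G m \<cdot>\<^bsub>C\<^esub> adj_mu C D F G \<epsilon> A A"

text \<open>The unit \<open>G i \<circ> \<eta>\<close>, with the coherence isomorphism \<open>F 1 \<rightarrow> 1\<close> restored.\<close>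

definition adj_unit ::
  "('o, 'm, 'k, 'y) tensor_cat_scheme \<Rightarrow> ('p, 'n, 'k, 'x) tensor_cat_scheme \<Rightarrow>
   ('o, 'm, 'p, 'n, 'w) tensor_functor_data_scheme \<Rightarrow> ('p, 'n, 'o, 'm, 'v) functor_data_scheme \<Rightarrow>
   ('o \<Rightarrow> 'm) \<Rightarrow> 'n \<Rightarrow> 'm"
  where "adj_unit C D F G \<eta> i =
    on_mor G (i \<cdot>\<^bsub>D\<^esub> inv_mor D \<I>\<^bsub>D\<^esub> (on_obj F \<I>\<^bsub>C\<^esub>) (unit_iso F)) \<cdot>\<^bsub>C\<^esub> \<eta> \<I>\<^bsub>C\<^esub>"

end

theory Submission
  imports Defs
begin

text \<open>
  A morphism \<open>f\<close> is called regular if \<open>f g f = f\<close> for some \<open>g\<close>.  By Schur's lemma and Gaussian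
  elimination every morphism of a semisimple category is regular; conversely, a linear category with
  finite-dimensional hom-spaces, biproducts and split idempotents in which every morphism is regular
  is semisimple.

  For an algebra \<open>A\<close> in a semisimple tensor category, regularity of all module maps follows from
  regularity of the maps between free modules \<open>x \<otimes> A\<close>, because then every module is a retract of a
  free one.  Module maps \<open>x \<otimes> A \<rightarrow> y \<otimes> A\<close> are the same as morphisms \<open>x \<rightarrow> y \<otimes> A\<close>, and for objects
  \<open>c, d\<close> of \<open>C\<close> the adjunction and the dual of \<open>d\<close> give
  \<open>Hom(c, d \<otimes> Tr A) = Hom(d\<^sup>* \<otimes> c, Tr A) = Hom(\<Phi> d\<^sup>* \<otimes> \<Phi> c, A) = Hom(\<Phi> c, \<Phi> d \<otimes> A)\<close>,
  compatibly with composition.  So the free \<open>Tr A\<close>-modules form a full subcategory of the semisimple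
  category of \<open>A\<close>-modules.

  If \<open>A\<close> is moreover connected, choose \<open>e : A \<rightarrow> 1\<close> with \<open>i e i = i\<close>.  The pairing
  \<open>e m : A \<otimes> A \<rightarrow> 1\<close> yields \<open>f : A \<rightarrow> A\<^sup>*\<close>, whose kernel is a right ideal; as
  \<open>End\<^sub>A(A) = Hom(1, A)\<close> is one-dimensional, it vanishes.  Hence \<open>f\<close> is split mono, and it is
  invertible because \<open>End(A)\<close> and \<open>End(A\<^sup>*)\<close> have the same finite dimension.
\<close>

section \<open>Finite-dimensional vector spaces\<close>

text \<open>Semisimplicity of a module category speaks about all modules and their subobjects, while
  the adjunction controls free modules only. Regularity closes this gap: it concerns one morphism at
  a time and mentions nothing but composition, so it passes to full subcategories and to retracts.
  The field is arbitrary, and a simple object may have a division algebra of endomorphisms;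
  decompositions are therefore found by splitting off retracts, with the dimension of the
  endomorphism space as induction measure. Duals make the transfer bijective: the adjunction handles
  targets of the form \<open>Tr x\<close>, but here the target is \<open>d \<otimes> Tr A\<close>,
  and transposing along \<open>d\<close> moves the extra factor to the source. For the Frobenius
  part, \<open>i e i = i\<close> with \<open>i\<close> nonzero makes \<open>e i\<close> nonzero. A
  module endomorphism of \<open>A\<close> is a scalar, and one with image in the kernel of
  \<open>f\<close> is killed by \<open>e\<close>; so that scalar is zero. A left inverse of
  \<open>f\<close> leaves open whether the dual is larger than \<open>A\<close>, which is why a
  dimension count follows.\<close>

lemma (in vectorspace) subspace_fin_dim:
  assumes "fin_dim" "subspace K W V"
  shows "vectorspace.fin_dim K (vs W)"
proof -
  interpret W: vectorspace K "vs W" using assms(2) by (rule subspace_is_vs)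
  have sub: "submodule K W V" using assms(2) by simp
  then have W: "W \<subseteq> carrier V" by (simp add: submodule_def)
  \<comment> \<open>Independence inside \<open>W\<close> is independence in \<open>V\<close>, so
    \<open>dim\<close> bounds all independent sets and a maximal one exists.\<close>
  have "finite S \<and> card S \<le> dim" if "S \<subseteq> carrier (vs W) \<and> W.lin_indpt S" for S
  proof -
    have "S \<subseteq> W" using that by simp
    then have "lin_indpt S" using span_li_not_depend(2)[OF _ sub, of S] that by simp
    then show ?thesis using li_le_dim[OF assms(1), of S] \<open>S \<subseteq> W\<close> W by auto
  qed
  moreover have "{} \<subseteq> carrier (vs W) \<and> W.lin_indpt {}"
    by (simp add: W.lin_dep_def)
  ultimately obtain B where "finite B" "maximal B (\<lambda>S. S \<subseteq> carrier (vs W) \<and> W.lin_indpt S)"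
    using maximal_exists[of "\<lambda>S. S \<subseteq> carrier (vs W) \<and> W.lin_indpt S" dim "{}"] by blast
  then have "W.basis B" by (intro W.max_li_is_basis)
  then show ?thesis using \<open>finite B\<close> unfolding W.fin_dim_def W.basis_def by blast
qed

text \<open>A basis of \<open>W\<close> with at least \<open>dim\<close> elements would be an
  independent set of full size in \<open>V\<close>, hence would span \<open>V\<close>. The
  strictness is what makes induction on dimension work.\<close>

lemma (in vectorspace) dim_subspace_less:
  assumes "fin_dim" "subspace K W V" "W \<noteq> carrier V"
  shows "vectorspace.dim K (vs W) < dim"
proof (rule ccontr)
  interpret W: vectorspace K "vs W" using assms(2) by (rule subspace_is_vs)
  have sub: "submodule K W V" using assms(2) by simp
  then have W: "W \<subseteq> carrier V" by (simp add: submodule_def)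
  assume le: "\<not> W.dim < dim"
  obtain B where B: "finite B" "W.basis B"
    using W.finite_basis_exists subspace_fin_dim[OF assms(1,2)] by blast
  have BW: "B \<subseteq> W" using B unfolding W.basis_def by simp
  have "lin_indpt B" using span_li_not_depend(2)[OF BW sub] B unfolding W.basis_def by simp
  moreover have "card B \<ge> dim" using W.dim_basis[OF B] le by simp
  ultimately have "basis B" using dim_li_is_basis[OF assms(1) B(1)] BW W by blast
  then have "span B = carrier V" unfolding basis_def by simp
  moreover have "span B = W" using span_li_not_depend(1)[OF BW sub] B unfolding W.basis_def by simp
  ultimately show False using assms(3) by simp
qed

text \<open>Rank-nullity with trivial kernel equates the dimension of the source with that of the
  image, a proper subspace.\<close>

lemma (in linear_map) dim_less_of_inj_not_surj:
  assumes "V.fin_dim" "W.fin_dim" "inj_on T (carrier V)" "T ` carrier V \<noteq> carrier W"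
  shows "V.dim < W.dim"
proof -
  have "vectorspace.dim K (W.vs imT) + vectorspace.dim K (V.vs kerT) = V.dim"
    by (rule rank_nullity[OF assms(1)])
  then have "V.dim = vectorspace.dim K (W.vs imT)"
    using inj_imp_dim_ker0[OF assms(3)] by simp
  also have "\<dots> < W.dim"
    using assms(4) by (intro W.dim_subspace_less[OF assms(2) imT_is_subspace]) (simp add: im_def)
  finally show ?thesis .
qed

text \<open>A nonzero vector is independent, and an independent set of \<open>dim\<close> elements
  is a basis.\<close>

lemma (in vectorspace) dim_1_imp_smult:
  assumes "fin_dim" "dim = 1" "v \<in> carrier V" "v \<noteq> \<zero>\<^bsub>V\<^esub>" "w \<in> carrier V"
  shows "\<exists>c\<in>carrier K. w = c \<odot>\<^bsub>V\<^esub> v"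
proof -
  have "lin_indpt {v}"
    by (metis assms(3,4) empty_iff empty_subsetI finite.emptyI finite_lin_indpt2 insert_iff
        insert_union lin_dep_iff_in_span span_empty)
  then have "basis {v}" using dim_li_is_basis[OF assms(1), of "{v}"] assms(2,3) by simp
  then have "w \<in> span {v}" using assms(5) unfolding basis_def by simp
  then obtain a where "a \<in> {v} \<rightarrow> carrier K" "lincomb a {v} = w"
    using finite_in_span[of "{v}" w] assms(3) by auto
  then show ?thesis using assms(3) unfolding lincomb_def by (intro bexI[of _ "a v"]) auto
qed

lemma (in vectorspace) dim_trivial:
  assumes "carrier V = {\<zero>\<^bsub>V\<^esub>}"
  shows "dim = 0"
  using assms span_zero[of "{\<zero>\<^bsub>V\<^esub>}"] span_closed[of "{\<zero>\<^bsub>V\<^esub>}"] by (intro dim0I) auto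

section \<open>Arrows\<close>

text \<open>
  A morphism together with its source and target.  Undefined composites are \<open>None\<close>, on which
  composition and addition are strict; this makes associativity of composition and distributivity
  hold without typing side conditions.
\<close>

type_synonym ('o, 'm) arrow = "('o \<times> 'm \<times> 'o) option"

definition mk_arr :: "'o \<Rightarrow> 'm \<Rightarrow> 'o \<Rightarrow> ('o, 'm) arrow"
  where "mk_arr a f b = Some (a, f, b)"

definition source :: "('o, 'm) arrow \<Rightarrow> 'o" where "source F = fst (the F)"
definition target :: "('o, 'm) arrow \<Rightarrow> 'o" where "target F = snd (snd (the F))"
definition under :: "('o, 'm) arrow \<Rightarrow> 'm" where "under F = fst (snd (the F))"

lemma mk_sel [simp]: "source (mk_arr a f b) = a" "target (mk_arr a f b) = b" "under (mk_arr a f b) = f"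
  by (auto simp: mk_arr_def source_def target_def under_def)

lemma mk_inject [simp]: "mk_arr a f b = mk_arr a' f' b' \<longleftrightarrow> a = a' \<and> f = f' \<and> b = b'"
  by (auto simp: mk_arr_def)

lemma mk_not_None [simp]: "mk_arr a f b \<noteq> None" by (simp add: mk_arr_def)

definition arr :: "('o, 'm, 'k, 'y) linear_cat_scheme \<Rightarrow> ('o, 'm) arrow \<Rightarrow> bool"
  where "arr C F \<longleftrightarrow> F \<noteq> None \<and>
    source F \<in> Obj C \<and> target F \<in> Obj C \<and> under F \<in> mor C (source F) (target F)"

definition in_hom :: "('o, 'm, 'k, 'y) linear_cat_scheme \<Rightarrow> ('o, 'm) arrow \<Rightarrow> 'o \<Rightarrow> 'o \<Rightarrow> bool"
  where "in_hom C F a b \<longleftrightarrow> arr C F \<and> source F = a \<and> target F = b"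

definition ident :: "('o, 'm, 'k, 'y) linear_cat_scheme \<Rightarrow> 'o \<Rightarrow> ('o, 'm) arrow"
  where "ident C a = mk_arr a (Id C a) a"

definition comp_arr :: "('o, 'm, 'k, 'y) linear_cat_scheme \<Rightarrow> ('o, 'm) arrow \<Rightarrow> ('o, 'm) arrow \<Rightarrow> ('o, 'm)
    arrow"
    (infixr \<open>\<bullet>\<index>\<close> 65)
  where "comp_arr C G F = (if arr C F \<and> arr C G \<and> target F = source G
    then mk_arr (source F) (under G \<cdot>\<^bsub>C\<^esub> under F) (target G) else None)"

definition add_arr :: "('o, 'm, 'k, 'y) linear_cat_scheme \<Rightarrow> ('o, 'm) arrow \<Rightarrow> ('o, 'm) arrow \<Rightarrow> ('o, 'm)
    arrow"
    (infixl \<open>\<boxplus>\<index>\<close> 60)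
  where "add_arr C F G = (if arr C F \<and> arr C G \<and> source F = source G \<and> target F = target G
    then mk_arr (source F) (under F \<oplus>\<^bsub>Hom C (source F) (target F)\<^esub> under G) (target F) else None)"

definition neg_arr :: "('o, 'm, 'k, 'y) linear_cat_scheme \<Rightarrow> ('o, 'm) arrow \<Rightarrow> ('o, 'm) arrow"
  where "neg_arr C F = (if arr C F then mk_arr (source F) (\<ominus>\<^bsub>Hom C (source F) (target F)\<^esub> under F) (target
      F) else None)"

definition zero_arr :: "('o, 'm, 'k, 'y) linear_cat_scheme \<Rightarrow> 'o \<Rightarrow> 'o \<Rightarrow> ('o, 'm) arrow"
  where "zero_arr C a b = mk_arr a \<zero>\<^bsub>Hom C a b\<^esub> b"

text \<open>Unlike addition and negation this is not made strict; the scalar laws are applied only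
  to arrows known to be defined.\<close>

definition smult_arr :: "('o, 'm, 'k, 'y) linear_cat_scheme \<Rightarrow> 'k \<Rightarrow> ('o, 'm) arrow \<Rightarrow> ('o, 'm) arrow"
  where "smult_arr C c F = mk_arr (source F) (c \<odot>\<^bsub>Hom C (source F) (target F)\<^esub> under F) (target F)"

lemma arr_mk [simp]: "arr C (mk_arr a f b) \<longleftrightarrow> a \<in> Obj C \<and> b \<in> Obj C \<and> f \<in> mor C a b"
  by (simp add: arr_def)

lemma not_arr_None [simp]: "\<not> arr C None"
  by (simp add: arr_def)

lemma in_hom_mk [simp]: "in_hom C (mk_arr a f b) a b \<longleftrightarrow> a \<in> Obj C \<and> b \<in> Obj C \<and> f \<in> mor C a b"
  by (simp add: in_hom_def)

lemma mk_und: "in_hom C F a b \<Longrightarrow> mk_arr a (under F) b = F"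
  by (auto simp: in_hom_def arr_def mk_arr_def source_def under_def target_def)

lemma in_homD: assumes "in_hom C F a b" shows "arr C F" "source F = a" "target F = b" "a \<in> Obj C"
    "b \<in> Obj C" "under F \<in> mor C a b"
  using assms by (auto simp: in_hom_def arr_def)

lemma arr_obj [simp]: "arr C F \<Longrightarrow> source F \<in> Obj C" "arr C F \<Longrightarrow> target F \<in> Obj C"
  by (auto simp: arr_def)

lemma arr_und: "arr C F \<Longrightarrow> under F \<in> mor C (source F) (target F)" unfolding arr_def by blast

lemma arr_eqI: "\<lbrakk>arr C F; arr C G; source F = source G; target F = target G; under F = under G\<rbrakk> \<Longrightarrow> F = G"
  by (cases F; cases G) (auto simp: source_def target_def under_def prod_eq_iff)

lemma arr_eq_iff: "\<lbrakk>arr C F; arr C G; source F = source G; target F = target G\<rbrakk> \<Longrightarrow> F = G \<longleftrightarrow> under F = under G"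
  using arr_eqI by blast

context linear_category begin

lemma arr_ident [simp]: "arr C (ident C a) \<longleftrightarrow> a \<in> Obj C"
  by (auto simp: ident_def id_mor)

lemma ident_sel [simp]: "source (ident C a) = a" "target (ident C a) = a" "under (ident C a) = Id C a"
  by (auto simp: ident_def)

lemma arr_cmp [simp]: "arr C (G \<bullet> F) \<longleftrightarrow> arr C F \<and> arr C G \<and> target F = source G"
  using comp_mor[of "source F" "target F" "target G" "under F" "under G"] arr_und[of C F] arr_und[of C G]
  by (auto simp: comp_arr_def)

lemma cmp_sel [simp]:
  "\<lbrakk>arr C F; arr C G; target F = source G\<rbrakk> \<Longrightarrow> source (G \<bullet> F) = source F"
  "\<lbrakk>arr C F; arr C G; target F = source G\<rbrakk> \<Longrightarrow> target (G \<bullet> F) = target G"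
  "\<lbrakk>arr C F; arr C G; target F = source G\<rbrakk> \<Longrightarrow> under (G \<bullet> F) = under G \<cdot> under F"
  by (auto simp: comp_arr_def)

lemma cmp_undef: "\<not> (arr C F \<and> arr C G \<and> target F = source G) \<Longrightarrow> G \<bullet> F = None"
  by (auto simp: comp_arr_def)

lemma cmp_assoc [simp]: "(H \<bullet> G) \<bullet> F = H \<bullet> (G \<bullet> F)"
proof (cases "arr C F \<and> arr C G \<and> arr C H \<and> target F = source G \<and> target G = source H")
  case True
  then show ?thesis
    using comp_assoc[of "source F" "target F" "target G" "target H" "under F" "under G" "under H"]
      arr_und[of C F] arr_und[of C G] arr_und[of C H]
    by (intro arr_eqI[of C]) auto
next
  case False
  then show ?thesis
    by (auto simp: comp_arr_def[of C "comp_arr C H G"] comp_arr_def[of C H "comp_arr C G F"])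
qed

lemma cmp_ident [simp]:
  "\<lbrakk>arr C F; source F = a\<rbrakk> \<Longrightarrow> F \<bullet> ident C a = F"
  "\<lbrakk>arr C F; target F = a\<rbrakk> \<Longrightarrow> ident C a \<bullet> F = F"
  using comp_id_right[of "source F" "target F" "under F"] comp_id_left[of "source F" "target F"
      "under F"] arr_und[of C F]
  by (auto intro!: arr_eqI[of C] simp: ident_def id_mor)

text \<open>The simplifier nests composites to the right, where \<open>G \<bullet> F\<close> is no
  longer a subterm of \<open>G \<bullet> F \<bullet> X\<close>; this form lets an equation for
  \<open>G \<bullet> F\<close> rewrite in the middle of a chain.\<close>

lemma cmp_eq_assoc: "G \<bullet> F = H \<Longrightarrow> G \<bullet> F \<bullet> X = H \<bullet> X"
  by (metis cmp_assoc)

lemma hom_module: "\<lbrakk>a \<in> Obj C; b \<in> Obj C\<rbrakk> \<Longrightarrow> module K (Hom C a b)"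
  using hom_vectorspace by (simp add: vectorspace_def)

lemma hom_group: "\<lbrakk>a \<in> Obj C; b \<in> Obj C\<rbrakk> \<Longrightarrow> abelian_group (Hom C a b)"
  using hom_module by (simp add: module_def)

lemma hom_mod_hom:
  "\<lbrakk>a \<in> Obj C; b \<in> Obj C; c \<in> Obj C; f \<in> mor C a b\<rbrakk> \<Longrightarrow> mod_hom K (Hom C b c) (Hom C a c) (\<lambda>g. g \<cdot> f)"
  "\<lbrakk>a \<in> Obj C; b \<in> Obj C; c \<in> Obj C; g \<in> mor C b c\<rbrakk> \<Longrightarrow> mod_hom K (Hom C a b) (Hom C a c) (\<lambda>f. g \<cdot> f)"
  by (simp_all add: mod_hom_def mod_hom_axioms_def hom_module comp_linear_left comp_linear_right)

lemma arr_zer [simp]: "arr C (zero_arr C a b) \<longleftrightarrow> a \<in> Obj C \<and> b \<in> Obj C"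
proof -
  have "\<zero>\<^bsub>Hom C a b\<^esub> \<in> mor C a b" if "a \<in> Obj C" "b \<in> Obj C"
  proof -
    interpret abelian_group "Hom C a b" using that by (rule hom_group)
    show ?thesis by simp
  qed
  then show ?thesis by (auto simp: zero_arr_def)
qed

lemma zer_sel [simp]: "source (zero_arr C a b) = a" "target (zero_arr C a b) = b" "under (zero_arr C a b)
    = \<zero>\<^bsub>Hom C a b\<^esub>"
  by (auto simp: zero_arr_def)

lemma arr_add [simp]: "arr C (F \<boxplus> G) \<longleftrightarrow> arr C F \<and> arr C G \<and> source F = source G \<and> target F = target G"
proof (cases "arr C F \<and> arr C G \<and> source F = source G \<and> target F = target G")
  case True
  then interpret abelian_group "Hom C (source F) (target F)" by (intro hom_group) auto
  have "under F \<oplus>\<^bsub>Hom C (source F) (target F)\<^esub> under G \<in> mor C (source F) (target F)"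
    using True arr_und[of C F] arr_und[of C G] by (intro a_closed) simp_all
  then show ?thesis using True by (auto simp: add_arr_def)
qed (auto simp: add_arr_def)

lemma add_sel [simp]:
  "\<lbrakk>arr C F; arr C G; source F = source G; target F = target G\<rbrakk> \<Longrightarrow> source (F \<boxplus> G) = source G"
  "\<lbrakk>arr C F; arr C G; source F = source G; target F = target G\<rbrakk> \<Longrightarrow> target (F \<boxplus> G) = target G"
  "\<lbrakk>arr C F; arr C G; source F = source G; target F = target G\<rbrakk> \<Longrightarrow> under (F \<boxplus> G)
      = under F \<oplus>\<^bsub>Hom C (source F) (target F)\<^esub> under G"
  by (auto simp: add_arr_def)

lemma add_undef: "\<not> (arr C F \<and> arr C G \<and> source F = source G \<and> target F = target G) \<Longrightarrow> F \<boxplus> G = None"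
  by (auto simp: add_arr_def)

lemma arr_neg [simp]: "arr C (neg_arr C F) \<longleftrightarrow> arr C F"
proof (cases "arr C F")
  case True
  then interpret abelian_group "Hom C (source F) (target F)" by (intro hom_group) auto
  show ?thesis using True arr_und[of C F] by (auto simp: neg_arr_def)
qed (auto simp: neg_arr_def)

lemma neg_sel [simp]:
  "arr C F \<Longrightarrow> source (neg_arr C F) = source F"
  "arr C F \<Longrightarrow> target (neg_arr C F) = target F"
  "arr C F \<Longrightarrow> under (neg_arr C F) = \<ominus>\<^bsub>Hom C (source F) (target F)\<^esub> under F"
  by (auto simp: neg_arr_def)

lemma add_assoc: "(F \<boxplus> G) \<boxplus> H = F \<boxplus> (G \<boxplus> H)"
proof (cases "arr C F \<and> arr C G \<and> arr C H \<and> source F = source G \<and> source G = source H \<and> target F = target G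
    \<and> target G = target H")
  case True
  then interpret abelian_group "Hom C (source F) (target F)" by (intro hom_group) auto
  show ?thesis using True arr_und[of C F] arr_und[of C G] arr_und[of C H]
      a_assoc[of "under F" "under G" "under H"]
    by (intro arr_eqI[of C]) auto
next
  case False
  then have "(F \<boxplus> G) \<boxplus> H = None" "F \<boxplus> (G \<boxplus> H) = None"
    by (intro add_undef; auto)+
  then show ?thesis by simp
qed

lemma add_commute: "F \<boxplus> G = G \<boxplus> F"
proof (cases "arr C F \<and> arr C G \<and> source F = source G \<and> target F = target G")
  case True
  then interpret abelian_group "Hom C (source F) (target F)" by (intro hom_group) auto
  show ?thesis using True arr_und[of C F] arr_und[of C G] a_comm[of "under F" "under G"]
    by (intro arr_eqI[of C]) auto
next
  case False
  then show ?thesis by (auto simp: add_arr_def)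
qed

lemma add_zer [simp]:
  assumes "arr C F" "source F = a" "target F = b"
  shows "F \<boxplus> zero_arr C a b = F" "zero_arr C a b \<boxplus> F = F"
proof -
  interpret abelian_group "Hom C (source F) (target F)" using assms(1) by (intro hom_group) auto
  show "F \<boxplus> zero_arr C a b = F" using assms(1) arr_und[of C F] unfolding assms(2,3)[symmetric]
    by (intro arr_eqI[of C]) auto
  then show "zero_arr C a b \<boxplus> F = F" by (metis add_commute)
qed

lemma add_neg [simp]:
  "arr C F \<Longrightarrow> F \<boxplus> neg_arr C F = zero_arr C (source F) (target F)"
  "arr C F \<Longrightarrow> neg_arr C F \<boxplus> F = zero_arr C (source F) (target F)"
proof -
  assume *: "arr C F"
  then interpret abelian_group "Hom C (source F) (target F)" by (intro hom_group) auto
  show "F \<boxplus> neg_arr C F = zero_arr C (source F) (target F)" using * arr_und[of C F] r_neg[of "under F"]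
    by (intro arr_eqI[of C]) auto
  then show "neg_arr C F \<boxplus> F = zero_arr C (source F) (target F)" by (metis add_commute)
qed

lemma cmp_add_right: "H \<bullet> (F \<boxplus> G) = H \<bullet> F \<boxplus> H \<bullet> G"
proof (cases "arr C F \<and> arr C G \<and> arr C H \<and> source F = source G \<and> target F = target G \<and> target G
    = source H")
  case True
  then interpret mod_hom K "Hom C (source F) (target F)" "Hom C (source F) (target H)" "\<lambda>f. under H \<cdot> f"
    using arr_und[of C H] by (intro hom_mod_hom) auto
  show ?thesis using True arr_und[of C F] arr_und[of C G] f_add[of "under F" "under G"]
    by (intro arr_eqI[of C]) auto
next
  case False
  then have "H \<bullet> (F \<boxplus> G) = None" "H \<bullet> F \<boxplus> H \<bullet> G = None"
    by (intro cmp_undef add_undef; auto)+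
  then show ?thesis by simp
qed

lemma cmp_add_left: "(F \<boxplus> G) \<bullet> H = F \<bullet> H \<boxplus> G \<bullet> H"
proof (cases "arr C F \<and> arr C G \<and> arr C H \<and> source F = source G \<and> target F = target G \<and> target H
    = source F")
  case True
  then interpret mod_hom K "Hom C (source F) (target F)" "Hom C (source H) (target F)" "\<lambda>f. f \<cdot> under H"
    using arr_und[of C H] by (intro hom_mod_hom) auto
  show ?thesis using True arr_und[of C F] arr_und[of C G] f_add[of "under F" "under G"]
    by (intro arr_eqI[of C]) auto
next
  case False
  then have "(F \<boxplus> G) \<bullet> H = None" "F \<bullet> H \<boxplus> G \<bullet> H = None"
    by (intro cmp_undef add_undef; auto)+
  then show ?thesis by simp
qed

lemma cmp_zer [simp]:
  "\<lbrakk>arr C H; source H = b; a \<in> Obj C\<rbrakk> \<Longrightarrow> H \<bullet> zero_arr C a b = zero_arr C a (target H)"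
  "\<lbrakk>arr C H; target H = a; b \<in> Obj C\<rbrakk> \<Longrightarrow> zero_arr C a b \<bullet> H = zero_arr C (source H) b"
proof -
  assume *: "arr C H" "source H = b" "a \<in> Obj C"
  then interpret mod_hom K "Hom C a (source H)" "Hom C a (target H)" "\<lambda>f. under H \<cdot> f"
    using arr_und[of C H] by (intro hom_mod_hom) auto
  show "H \<bullet> zero_arr C a b = zero_arr C a (target H)" using *(1,3) unfolding *(2)[symmetric]
    by (intro arr_eqI[of C]) auto
next
  assume *: "arr C H" "target H = a" "b \<in> Obj C"
  then interpret mod_hom K "Hom C (target H) b" "Hom C (source H) b" "\<lambda>f. f \<cdot> under H"
    using arr_und[of C H] by (intro hom_mod_hom) auto
  show "zero_arr C a b \<bullet> H = zero_arr C (source H) b" using *(1,3) unfolding *(2)[symmetric]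
    by (intro arr_eqI[of C]) auto
qed

lemma cmp_neg [simp]:
  "H \<bullet> neg_arr C F = neg_arr C (H \<bullet> F)" "neg_arr C F \<bullet> H = neg_arr C (F \<bullet> H)"
proof -
  show "H \<bullet> neg_arr C F = neg_arr C (H \<bullet> F)"
  proof (cases "arr C F \<and> arr C H \<and> target F = source H")
    case True
    then interpret mod_hom K "Hom C (source F) (target F)" "Hom C (source F) (target H)" "\<lambda>f. under H \<cdot> f"
      using arr_und[of C H] by (intro hom_mod_hom) auto
    show ?thesis using True arr_und[of C F] f_neg[of "under F"]
      by (intro arr_eqI[of C]) auto
  qed (auto simp: neg_arr_def[of C "H \<bullet> F"] comp_arr_def[of C H "neg_arr C F"])
  show "neg_arr C F \<bullet> H = neg_arr C (F \<bullet> H)"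
  proof (cases "arr C F \<and> arr C H \<and> target H = source F")
    case True
    then interpret mod_hom K "Hom C (source F) (target F)" "Hom C (source H) (target F)" "\<lambda>f. f \<cdot> under H"
      using arr_und[of C H] by (intro hom_mod_hom) auto
    show ?thesis using True arr_und[of C F] f_neg[of "under F"]
      by (intro arr_eqI[of C]) auto
  qed (auto simp: neg_arr_def[of C "F \<bullet> H"] comp_arr_def[of C "neg_arr C F" H])
qed

lemma neg_zer [simp]: "\<lbrakk>a \<in> Obj C; b \<in> Obj C\<rbrakk> \<Longrightarrow> neg_arr C (zero_arr C a b) = zero_arr C a b"
  using add_zer(2)[of "neg_arr C (zero_arr C a b)" a b] add_neg(1)[of "zero_arr C a b"] by simp

lemma neg_neg [simp]: "arr C F \<Longrightarrow> neg_arr C (neg_arr C F) = F"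
proof -
  assume F: "arr C F"
  then have "neg_arr C (neg_arr C F) = (F \<boxplus> neg_arr C F) \<boxplus> neg_arr C (neg_arr C F)" by simp
  also have "\<dots> = F \<boxplus> (neg_arr C F \<boxplus> neg_arr C (neg_arr C F))" by (rule add_assoc)
  also have "\<dots> = F" using F by simp
  finally show ?thesis .
qed

lemma eq_of_add_neg_eq_zer:
  assumes "F \<boxplus> neg_arr C G = zero_arr C a b" "a \<in> Obj C" "b \<in> Obj C"
  shows "F = G"
proof -
  \<comment> \<open>The sum equals a defined arrow and addition is strict, so both summands are
    defined and parallel.\<close>
  have "arr C (F \<boxplus> neg_arr C G)" using assms by simp
  then have **: "arr C F" "arr C G" "source F = source G" "target F = target G" by auto
  then have "source (F \<boxplus> neg_arr C G) = source G" "target (F \<boxplus> neg_arr C G) = target G" by simp_all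
  then have *: "arr C F" "arr C G" "source F = a" "source G = a" "target F = b" "target G = b"
    using ** assms by simp_all
  have "F = F \<boxplus> (neg_arr C G \<boxplus> G)" using * by simp
  also have "\<dots> = (F \<boxplus> neg_arr C G) \<boxplus> G" by (rule add_assoc[symmetric])
  also have "\<dots> = G" using * assms by simp
  finally show ?thesis .
qed

end

text \<open>The ends are arguments because the empty sum has to be a zero arrow of a known
  hom-space. Recursion makes distributivity over \<open>\<bullet>\<close> a plain induction;
  \<open>psum_finsum\<close> links it to \<open>finsum\<close>.\<close>

primrec psum :: "('o, 'm, 'k, 'y) linear_cat_scheme \<Rightarrow> 'o \<Rightarrow> 'o \<Rightarrow> (nat \<Rightarrow> ('o, 'm) arrow) \<Rightarrow> nat \<Rightarrow> ('o, 'm)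
    arrow"
  where "psum C a b h 0 = zero_arr C a b"
  | "psum C a b h (Suc n) = add_arr C (psum C a b h n) (h n)"

definition biprod :: "('o, 'm, 'k, 'y) linear_cat_scheme \<Rightarrow> 'o \<Rightarrow> nat \<Rightarrow> (nat \<Rightarrow> 'o) \<Rightarrow>
    (nat \<Rightarrow> ('o, 'm) arrow) \<Rightarrow> (nat \<Rightarrow> ('o, 'm) arrow) \<Rightarrow> bool"
  where "biprod C x n s J P \<longleftrightarrow> x \<in> Obj C \<and>
    (\<forall>j<n. in_hom C (J j) (s j) x \<and> in_hom C (P j) x (s j)) \<and>
    (\<forall>j<n. \<forall>l<n. comp_arr C (P j) (J l) = (if j = l then ident C (s j) else zero_arr C (s l) (s j))) \<and>
    psum C x x (\<lambda>j. comp_arr C (J j) (P j)) n = ident C x"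

definition regular_category :: "('o, 'm, 'k, 'y) linear_cat_scheme \<Rightarrow> bool"
  where "regular_category C \<longleftrightarrow>
    (\<forall>F. arr C F \<longrightarrow> (\<exists>G. in_hom C G (target F) (source F) \<and> F \<bullet>\<^bsub>C\<^esub> G \<bullet>\<^bsub>C\<^esub> F = F))"

definition split_idempotents :: "('o, 'm, 'k, 'y) linear_cat_scheme \<Rightarrow> bool"
  where "split_idempotents C \<longleftrightarrow>
    (\<forall>E a. in_hom C E a a \<longrightarrow> E \<bullet>\<^bsub>C\<^esub> E = E \<longrightarrow>
      (\<exists>k P J. in_hom C P a k \<and> in_hom C J k a \<and> J \<bullet>\<^bsub>C\<^esub> P = E \<and> P \<bullet>\<^bsub>C\<^esub> J = ident C k))"

section \<open>Sums, biproducts and universal properties in terms of arrows\<close>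

context linear_category begin

lemma mk_cmp [simp]:
  "\<lbrakk>a \<in> Obj C; b \<in> Obj C; c \<in> Obj C; f \<in> mor C a b; g \<in> mor C b c\<rbrakk> \<Longrightarrow> mk_arr b g c \<bullet> mk_arr a f b
      = mk_arr a (g \<cdot> f) c"
  by (simp add: comp_arr_def)

lemma in_hom_cmp [intro]: "in_hom C F a b \<Longrightarrow> in_hom C G b c \<Longrightarrow> in_hom C (G \<bullet> F) a c"
  by (simp add: in_hom_def)

lemma in_hom_ident [intro]: "a \<in> Obj C \<Longrightarrow> in_hom C (ident C a) a a"
  by (simp add: in_hom_def)

lemma cmp_psum_right:
  "in_hom C F b c \<Longrightarrow> a \<in> Obj C \<Longrightarrow> F \<bullet> psum C a b h n = psum C a c (\<lambda>j. F \<bullet> h j) n"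
  by (induction n) (auto simp: in_hom_def cmp_add_right)

lemma cmp_psum_left:
  "in_hom C F a b \<Longrightarrow> c \<in> Obj C \<Longrightarrow> psum C b c h n \<bullet> F = psum C a c (\<lambda>j. h j \<bullet> F) n"
  by (induction n) (auto simp: in_hom_def cmp_add_left)

lemma psum_cong: "(\<And>j. j < n \<Longrightarrow> h j = h' j) \<Longrightarrow> psum C a b h n = psum C a b h' n"
  by (induction n) auto

lemma psum_zer: "a \<in> Obj C \<Longrightarrow> b \<in> Obj C \<Longrightarrow> (\<And>j. j < n \<Longrightarrow> h j = zero_arr C a b) \<Longrightarrow> psum C a b h n
    = zero_arr C a b"
  by (induction n) auto

lemma psum_finsum:
  assumes "a \<in> Obj C" "b \<in> Obj C" "\<And>j. j < n \<Longrightarrow> h j \<in> mor C a b"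
  shows "psum C a b (\<lambda>j. mk_arr a (h j) b) n = mk_arr a (finsum (Hom C a b) h {..<n}) b"
proof -
  interpret abelian_group "Hom C a b" using assms by (intro hom_group) auto
  show ?thesis using assms(3)
  proof (induction n)
    case 0
    then show ?case by (simp add: zero_arr_def)
  next
    case (Suc n)
    have "finsum (Hom C a b) h {..<Suc n} = h n \<oplus>\<^bsub>Hom C a b\<^esub> finsum (Hom C a b) h {..<n}"
      unfolding lessThan_Suc using Suc.prems by (intro finsum_insert) auto
    moreover have "finsum (Hom C a b) h {..<n} \<in> mor C a b" using Suc.prems by (intro finsum_closed) auto
    ultimately show ?case using Suc assms by (simp add: add_arr_def a_comm)
  qed
qed

lemma is_biproduct_biprod:
  assumes "x \<in> Obj C" "\<And>j. j < n \<Longrightarrow> s j \<in> Obj C"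
  shows "is_biproduct C x n s \<iota> \<pi> \<longleftrightarrow> biprod C x n s (\<lambda>j. mk_arr (s j) (\<iota> j) x) (\<lambda>j. mk_arr x (\<pi> j) (s j))"
proof (cases "\<forall>j<n. \<iota> j \<in> mor C (s j) x \<and> \<pi> j \<in> mor C x (s j)")
  case True
  have "psum C x x (\<lambda>j. mk_arr (s j) (\<iota> j) x \<bullet> mk_arr x (\<pi> j) (s j)) n
      = psum C x x (\<lambda>j. mk_arr x (\<iota> j \<cdot> \<pi> j) x) n"
    using True assms by (intro psum_cong) simp
  also have "\<dots> = mk_arr x (finsum (Hom C x x) (\<lambda>j. \<iota> j \<cdot> \<pi> j) {..<n}) x"
    using True assms by (intro psum_finsum) (auto intro: comp_mor)
  finally show ?thesis using True assms unfolding is_biproduct_def biprod_def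
    by (simp add: ident_def zero_arr_def)
next
  case False
  then show ?thesis using assms by (auto simp: is_biproduct_def biprod_def)
qed

lemma is_biproduct_imp_biprod:
  assumes "is_biproduct C x n s \<iota> \<pi>"
  obtains J P where "biprod C x n s J P"
  using assms is_biproduct_biprod[of x n s \<iota> \<pi>] by (auto simp: is_biproduct_def)

lemma biprod_imp_is_biproduct:
  assumes "biprod C x n s J P"
  shows "is_biproduct C x n s (\<lambda>j. under (J j)) (\<lambda>j. under (P j))"
proof -
  have *: "x \<in> Obj C" "\<And>j. j < n \<Longrightarrow> in_hom C (J j) (s j) x" "\<And>j. j < n \<Longrightarrow> in_hom C (P j) x (s j)"
    using assms by (auto simp: biprod_def)
  have **: "s j \<in> Obj C" "mk_arr (s j) (under (J j)) x = J j" "mk_arr x (under (P j)) (s j) = P j"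
      if "j < n" for j
    using *(2,3)[OF that] by (auto simp: mk_und dest: in_homD)
  have "psum C x x (\<lambda>j. mk_arr (s j) (under (J j)) x \<bullet> mk_arr x (under (P j)) (s j)) n = psum C x x (\<lambda>j. J j
      \<bullet> P j) n"
    using ** by (intro psum_cong) simp
  then have "biprod C x n s (\<lambda>j. mk_arr (s j) (under (J j)) x) (\<lambda>j. mk_arr x (under (P j)) (s j))"
    using assms * ** unfolding biprod_def by simp
  then show ?thesis using is_biproduct_biprod[of x n s] * **(1) by blast
qed

lemma zero_object_iff: "z \<in> Obj C \<Longrightarrow> zero_object C z \<longleftrightarrow> ident C z = zero_arr C z z"
proof
  assume z: "z \<in> Obj C" and "zero_object C z"
  then have "mor C z z = {\<zero>\<^bsub>Hom C z z\<^esub>}" unfolding zero_object_def by blast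
  then show "ident C z = zero_arr C z z" using id_mor[OF z] by (simp add: ident_def zero_arr_def)
next
  assume z: "z \<in> Obj C" and id: "ident C z = zero_arr C z z"
  show "zero_object C z" unfolding zero_object_def
  proof (intro conjI ballI z)
    fix a assume a: "a \<in> Obj C"
    have "f = \<zero>\<^bsub>Hom C a z\<^esub>" if "f \<in> mor C a z" for f
    proof -
      have "mk_arr a f z = ident C z \<bullet> mk_arr a f z" using that a z by simp
      also have "\<dots> = zero_arr C a z" unfolding id using that a z by simp
      finally show ?thesis by (simp add: zero_arr_def)
    qed
    moreover have "\<zero>\<^bsub>Hom C a z\<^esub> \<in> mor C a z" using arr_zer[of a z] a z by (simp add: zero_arr_def)
    ultimately show "mor C a z = {\<zero>\<^bsub>Hom C a z\<^esub>}" by blast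
    have "f = \<zero>\<^bsub>Hom C z a\<^esub>" if "f \<in> mor C z a" for f
    proof -
      have "mk_arr z f a = mk_arr z f a \<bullet> ident C z" using that a z by simp
      also have "\<dots> = zero_arr C z a" unfolding id using that a z by simp
      finally show ?thesis by (simp add: zero_arr_def)
    qed
    moreover have "\<zero>\<^bsub>Hom C z a\<^esub> \<in> mor C z a" using arr_zer[of z a] a z by (simp add: zero_arr_def)
    ultimately show "mor C z a = {\<zero>\<^bsub>Hom C z a\<^esub>}" by blast
  qed
qed

lemma iso_mor_iff:
  assumes "in_hom C F a b"
  shows "iso_mor C a b (under F) \<longleftrightarrow> (\<exists>G. in_hom C G b a \<and> G \<bullet> F = ident C a \<and> F \<bullet> G = ident C b)"
proof -
  have F: "mk_arr a (under F) b = F" using assms by (rule mk_und)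
  have *: "a \<in> Obj C" "b \<in> Obj C" "under F \<in> mor C a b" using in_homD[OF assms] by auto
  have "inverse_mor C a b (under F) g \<longleftrightarrow> in_hom C (mk_arr b g a) b a \<and> mk_arr b g a \<bullet> mk_arr a (under F) b
      = ident C a \<and> mk_arr a (under F) b \<bullet> mk_arr b g a = ident C b" for g
    unfolding inverse_mor_def using * by (auto simp: ident_def)
  then have "inverse_mor C a b (under F) g \<longleftrightarrow> in_hom C (mk_arr b g a) b a \<and> mk_arr b g a \<bullet> F = ident C a \<and> F
      \<bullet> mk_arr b g a = ident C b" for g
    unfolding F .
  then show ?thesis unfolding iso_mor_def by (metis mk_und)
qed

text \<open>Together with \<open>ex1_in_hom\<close> this turns the definitions of monic, epic,
  kernel and cokernel into statements about arrows.\<close>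

lemma all_in_hom:
  "(\<forall>G. in_hom C G a b \<longrightarrow> Q G) \<longleftrightarrow> (a \<in> Obj C \<longrightarrow> b \<in> Obj C \<longrightarrow> (\<forall>g\<in>mor C a b. Q (mk_arr a g b)))"
proof safe
  fix G assume *: "in_hom C G a b" and "\<forall>g\<in>mor C a b. Q (mk_arr a g b)"
  then have "Q (mk_arr a (under G) b)" by (blast dest: in_homD(6))
  then show "Q G" using mk_und[OF *] by simp
qed (auto dest: in_homD)

lemma ex1_in_hom:
  assumes "a \<in> Obj C" "b \<in> Obj C"
  shows "(\<exists>!G. in_hom C G a b \<and> Q G) \<longleftrightarrow> (\<exists>!g. g \<in> mor C a b \<and> Q (mk_arr a g b))"
proof
  assume "\<exists>!G. in_hom C G a b \<and> Q G"
  then obtain G where G: "in_hom C G a b" "Q G" and uniq: "\<And>G'. in_hom C G' a b \<Longrightarrow> Q G' \<Longrightarrow> G' = G"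
    by blast
  show "\<exists>!g. g \<in> mor C a b \<and> Q (mk_arr a g b)"
  proof (rule ex1I[of _ "under G"])
    show "under G \<in> mor C a b \<and> Q (mk_arr a (under G) b)" using G in_homD(6)[OF G(1)] mk_und[OF G(1)]
        by simp
  next
    fix g assume "g \<in> mor C a b \<and> Q (mk_arr a g b)"
    then have "mk_arr a g b = G" using assms by (intro uniq) auto
    then show "g = under G" by auto
  qed
next
  assume "\<exists>!g. g \<in> mor C a b \<and> Q (mk_arr a g b)"
  then obtain g where g: "g \<in> mor C a b" "Q (mk_arr a g b)" and uniq: "\<And>g'. g' \<in> mor C a b
      \<Longrightarrow> Q (mk_arr a g' b) \<Longrightarrow> g' = g"
    by blast
  show "\<exists>!G. in_hom C G a b \<and> Q G"
  proof (rule ex1I[of _ "mk_arr a g b"])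
    show "in_hom C (mk_arr a g b) a b \<and> Q (mk_arr a g b)" using g assms by simp
  next
    fix G assume G: "in_hom C G a b \<and> Q G"
    then have *: "under G \<in> mor C a b" "mk_arr a (under G) b = G" by (auto simp: mk_und dest: in_homD)
    then have "under G = g" using G by (intro uniq) auto
    then show "G = mk_arr a g b" using *(2) by simp
  qed
qed

lemma monic_iff:
  assumes "a \<in> Obj C" "b \<in> Obj C"
  shows "monic C a b f \<longleftrightarrow> in_hom C (mk_arr a f b) a b \<and> (\<forall>x G. in_hom C G x a \<longrightarrow> (\<forall>H. in_hom C H x a \<longrightarrow> mk_arr
      a f b \<bullet> G = mk_arr a f b \<bullet> H \<longrightarrow> G = H))"
  unfolding all_in_hom monic_def using assms by auto

lemma epic_iff:
  assumes "a \<in> Obj C" "b \<in> Obj C"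
  shows "epic C a b f \<longleftrightarrow> in_hom C (mk_arr a f b) a b \<and> (\<forall>x G. in_hom C G b x \<longrightarrow> (\<forall>H. in_hom C H b x \<longrightarrow> G
      \<bullet> mk_arr a f b = H \<bullet> mk_arr a f b \<longrightarrow> G = H))"
  unfolding all_in_hom epic_def using assms by auto

lemma is_kernel_iff:
  assumes "in_hom C (mk_arr a f b) a b" "k \<in> Obj C"
  shows "is_kernel C a b f k i \<longleftrightarrow> in_hom C (mk_arr k i a) k a \<and> mk_arr a f b \<bullet> mk_arr k i a = zero_arr C k b
      \<and>
    (\<forall>x H. in_hom C H x a \<longrightarrow> mk_arr a f b \<bullet> H = zero_arr C x b \<longrightarrow> (\<exists>!L. in_hom C L x k \<and> mk_arr k i a \<bullet> L
        = H))"
  unfolding all_in_hom is_kernel_def using assms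
  by (cases "i \<in> mor C k a") (simp_all add: ex1_in_hom zero_arr_def Ball_def cong: conj_cong imp_cong)

lemma is_cokernel_iff:
  assumes "in_hom C (mk_arr a f b) a b" "q \<in> Obj C"
  shows "is_cokernel C a b f q p \<longleftrightarrow> in_hom C (mk_arr b p q) b q \<and> mk_arr b p q \<bullet> mk_arr a f b
      = zero_arr C a q \<and>
    (\<forall>x H. in_hom C H b x \<longrightarrow> H \<bullet> mk_arr a f b = zero_arr C a x \<longrightarrow> (\<exists>!L. in_hom C L q x \<and> L \<bullet> mk_arr b p q
        = H))"
  unfolding all_in_hom is_cokernel_def using assms
  by (cases "p \<in> mor C b q") (simp_all add: ex1_in_hom zero_arr_def Ball_def cong: conj_cong imp_cong)

lemma scl_sel [simp]: "source (smult_arr C c F) = source F" "target (smult_arr C c F) = target F"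
  "under (smult_arr C c F) = c \<odot>\<^bsub>Hom C (source F) (target F)\<^esub> under F"
  by (simp_all add: smult_arr_def)

lemma arr_scl [simp]:
  assumes "c \<in> carrier K" "arr C F"
  shows "arr C (smult_arr C c F)"
proof -
  interpret module K "Hom C (source F) (target F)" using assms by (intro hom_module) auto
  show ?thesis using assms arr_und[of C F] by (simp add: smult_arr_def)
qed

lemma cmp_scl:
  assumes "c \<in> carrier K" "arr C F" "arr C H"
  shows "target F = source H \<Longrightarrow> H \<bullet> smult_arr C c F = smult_arr C c (H \<bullet> F)" "target H = source F
      \<Longrightarrow> smult_arr C c F \<bullet> H = smult_arr C c (F \<bullet> H)"
proof -
  assume *: "target F = source H"
  interpret mod_hom K "Hom C (source F) (target F)" "Hom C (source F) (target H)" "\<lambda>f. under H \<cdot> f"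
    using assms * arr_und[of C H] by (intro hom_mod_hom) auto
  show "H \<bullet> smult_arr C c F = smult_arr C c (H \<bullet> F)" using assms * arr_und[of C F] f_smult[of c "under F"]
    by (intro arr_eqI[of C]) auto
next
  assume *: "target H = source F"
  interpret mod_hom K "Hom C (source F) (target F)" "Hom C (source H) (target F)" "\<lambda>f. f \<cdot> under H"
    using assms * arr_und[of C H] by (intro hom_mod_hom) auto
  show "smult_arr C c F \<bullet> H = smult_arr C c (F \<bullet> H)" using assms * arr_und[of C F] f_smult[of c "under F"]
    by (intro arr_eqI[of C]) auto
qed

text \<open>A nonzero scalar is invertible, so one that kills a nonzero arrow is zero, and then it
  kills arrows of every other hom-space too.\<close>

lemma scl_eq_zer:
  assumes "c \<in> carrier K" "in_hom C F a b" "smult_arr C c F = zero_arr C a b" "F \<noteq> zero_arr C a b" "arr C G"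
  shows "smult_arr C c G = zero_arr C (source G) (target G)"
proof -
  note F = in_homD[OF assms(2)]
  interpret V: vectorspace K "Hom C a b" using F by (intro hom_vectorspace)
  interpret W: vectorspace K "Hom C (source G) (target G)" using assms(5) by (intro hom_vectorspace) auto
  have "c \<odot>\<^bsub>Hom C a b\<^esub> under F = \<zero>\<^bsub>Hom C a b\<^esub>" using arg_cong[OF assms(3), of under] F by simp
  moreover have "under F \<noteq> \<zero>\<^bsub>Hom C a b\<^esub>" using assms(4) mk_und[OF assms(2)] by (auto simp: zero_arr_def)
  ultimately have "c = \<zero>\<^bsub>K\<^esub>"
    using V.smult_assoc1[of "inv\<^bsub>K\<^esub> c" c "under F"] assms(1) F V.field_Units V.Units_l_inv
        V.Units_inv_closed
    by (metis Diff_iff V.smult_r_null V.smult_one empty_iff insert_iff)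
  then show ?thesis using assms(5) arr_und[OF assms(5)] by (intro arr_eqI[of C]) (simp_all add:
      smult_arr_def)
qed

text \<open>An injective linear endomap that missed an element would give \<open>dim < dim\<close>.
  It serves to upgrade a one-sided inverse to a two-sided one.\<close>

lemma linear_endo_surj:
  assumes ab: "a \<in> Obj C" "b \<in> Obj C"
    and N: "\<And>X. in_hom C X a b \<Longrightarrow> in_hom C (N X) a b"
    and N_add: "\<And>X Y. in_hom C X a b \<Longrightarrow> in_hom C Y a b \<Longrightarrow> N (X \<boxplus> Y) = N X \<boxplus> N Y"
    and N_smult: "\<And>X c. in_hom C X a b \<Longrightarrow> c \<in> carrier K \<Longrightarrow> N (smult_arr C c X) = smult_arr C c (N X)"
    and inj: "\<And>X Y. in_hom C X a b \<Longrightarrow> in_hom C Y a b \<Longrightarrow> N X = N Y \<Longrightarrow> X = Y"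
    and Y: "in_hom C Y a b"
  obtains X where "in_hom C X a b" "N X = Y"
proof -
  let ?T = "\<lambda>f. under (N (mk_arr a f b))"
  interpret V: vectorspace K "Hom C a b" using ab by (rule hom_vectorspace)
  have T: "in_hom C (N (mk_arr a f b)) a b" "mk_arr a (?T f) b = N (mk_arr a f b)" if "f \<in> mor C a b" for f
    using N[of "mk_arr a f b"] that ab by (auto simp: mk_und)
  have "?T \<in> module_hom K (Hom C a b) (Hom C a b)" unfolding module_hom_def
  proof (intro CollectI conjI allI impI)
    show "?T \<in> mor C a b \<rightarrow> mor C a b" using T(1) by (auto dest: in_homD(6))
  next
    fix f g assume *: "f \<in> mor C a b \<and> g \<in> mor C a b"
    then have "N (mk_arr a (f \<oplus>\<^bsub>Hom C a b\<^esub> g) b) = N (mk_arr a f b) \<boxplus> N (mk_arr a g b)"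
      using N_add[of "mk_arr a f b" "mk_arr a g b"] ab by (simp add: add_arr_def)
    then show "?T (f \<oplus>\<^bsub>Hom C a b\<^esub> g) = ?T f \<oplus>\<^bsub>Hom C a b\<^esub> ?T g"
      using in_homD[OF T(1)[of f]] in_homD[OF T(1)[of g]] * by simp
  next
    fix c f assume *: "c \<in> carrier K \<and> f \<in> mor C a b"
    then have "N (mk_arr a (c \<odot>\<^bsub>Hom C a b\<^esub> f) b) = smult_arr C c (N (mk_arr a f b))"
      using N_smult[of "mk_arr a f b" c] ab by (simp add: smult_arr_def)
    then show "?T (c \<odot>\<^bsub>Hom C a b\<^esub> f) = c \<odot>\<^bsub>Hom C a b\<^esub> ?T f"
      using in_homD[OF T(1)[of f]] * by simp
  qed
  then interpret L: linear_map K "Hom C a b" "Hom C a b" ?T by unfold_locales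
  have "inj_on ?T (mor C a b)"
  proof (rule inj_onI)
    fix f g assume fg: "f \<in> mor C a b" "g \<in> mor C a b" "?T f = ?T g"
    have "N (mk_arr a f b) = mk_arr a (?T f) b" by (rule T(2)[OF fg(1), symmetric])
    also have "\<dots> = mk_arr a (?T g) b" by (simp only: fg(3))
    also have "\<dots> = N (mk_arr a g b)" by (rule T(2)[OF fg(2)])
    finally have "N (mk_arr a f b) = N (mk_arr a g b)" .
    then show "f = g" using inj[of "mk_arr a f b" "mk_arr a g b"] fg(1,2) ab by simp
  qed
  then have "?T ` mor C a b = mor C a b"
    using L.dim_less_of_inj_not_surj[OF hom_fin_dim[OF ab] hom_fin_dim[OF ab]] by blast
  then have "under Y \<in> ?T ` mor C a b" using in_homD(6)[OF Y] by simp
  then obtain f where f: "under Y = ?T f" "f \<in> mor C a b" by (rule imageE)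
  have "N (mk_arr a f b) = mk_arr a (?T f) b" by (rule T(2)[OF f(2), symmetric])
  also have "\<dots> = Y" unfolding f(1)[symmetric] by (rule mk_und[OF Y])
  finally have "N (mk_arr a f b) = Y" .
  then show thesis using that[of "mk_arr a f b"] f(2) ab by simp
qed

end

section \<open>Semisimplicity and regular morphisms\<close>

context linear_category begin

section \<open>Regularity of the morphisms of a semisimple category\<close>

lemma regularE:
  assumes "regular_category C" "in_hom C F a b"
  obtains G where "in_hom C G b a" "F \<bullet> G \<bullet> F = F"
  using assms by (auto simp: regular_category_def in_hom_def)

lemma split_idempotentsE:
  assumes "split_idempotents C" "in_hom C E a a" "E \<bullet> E = E"
  obtains k P J where "in_hom C P a k" "in_hom C J k a" "J \<bullet> P = E" "P \<bullet> J = ident C k"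
  using assms unfolding split_idempotents_def by metis

text \<open>The kernel of \<open>F\<close> is a subobject of the simple \<open>s\<close>, hence zero
  or everything; the latter would make \<open>F\<close> zero.\<close>

lemma simple_nonzero_imp_mono:
  assumes ab: "abelian_category C" and s: "simple_object C s" and F: "in_hom C F s t" "F \<noteq> zero_arr C s t"
  shows "monic C s t (under F)"
proof -
  have st: "s \<in> Obj C" "t \<in> Obj C" using F by (auto dest: in_homD)
  have F': "mk_arr s (under F) t = F" using F by (simp add: mk_und)
  obtain k i where "is_kernel C s t (under F) k i"
    using ab st in_homD(6)[OF F(1)] unfolding abelian_category_def by metis
  moreover from this have k: "k \<in> Obj C" unfolding is_kernel_def by blast
  ultimately have i: "in_hom C (mk_arr k i s) k s" "F \<bullet> mk_arr k i s = zero_arr C k t" and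
    ker: "\<And>x H. in_hom C H x s \<Longrightarrow> F \<bullet> H = zero_arr C x t \<Longrightarrow> \<exists>!L. in_hom C L x k \<and> mk_arr k i s \<bullet> L = H"
    using is_kernel_iff[of s "under F" t k i] F F' by auto
  have "monic C k s i" unfolding monic_iff[OF k st(1)]
  proof (intro conjI allI impI)
    fix x G H assume *: "in_hom C G x k" "in_hom C H x k" "mk_arr k i s \<bullet> G = mk_arr k i s \<bullet> H"
    then have "F \<bullet> (mk_arr k i s \<bullet> H) = zero_arr C x t" "in_hom C (mk_arr k i s \<bullet> H) x s"
      using i F st cmp_eq_assoc[OF i(2), of H] by (auto simp: in_hom_def)
    from ker[OF this(2,1)] show "G = H" using * by auto
  qed (rule i)
  then consider "zero_object C k" | "iso_mor C k s i" using s k unfolding simple_object_def by blast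
  then show ?thesis
  proof cases
    case 1
    then have idk: "ident C k = zero_arr C k k" using k by (simp add: zero_object_iff)
    show ?thesis unfolding monic_iff[OF st] F'
    proof (intro conjI allI impI)
      fix x G H assume *: "in_hom C G x s" "in_hom C H x s" "F \<bullet> G = F \<bullet> H"
      \<comment> \<open>With zero kernel, cancellation follows by factoring the difference of
        \<open>G\<close> and \<open>H\<close> through \<open>k\<close>.\<close>
      then have "F \<bullet> (G \<boxplus> neg_arr C H) = zero_arr C x t"
        using F by (simp add: cmp_add_right in_hom_def)
      then obtain L where L: "in_hom C L x k" "mk_arr k i s \<bullet> L = G \<boxplus> neg_arr C H"
        using ker[of "G \<boxplus> neg_arr C H" x] * by (auto simp: in_hom_def)
      have "L = ident C k \<bullet> L" using L by (simp add: in_hom_def)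
      also have "\<dots> = zero_arr C x k" unfolding idk using L k by (simp add: in_hom_def)
      finally have "G \<boxplus> neg_arr C H = zero_arr C x s"
        using L(2) i in_homD[OF i(1)] in_homD[OF L(1)] by simp
      then show "G = H" using * by (intro eq_of_add_neg_eq_zer[of G H x s]) (auto dest: in_homD)
    qed (rule F)
  next
    case 2
    then obtain G where G: "in_hom C G s k" "mk_arr k i s \<bullet> G = ident C s"
      using iso_mor_iff[OF i(1)] by auto
    have "F = F \<bullet> mk_arr k i s \<bullet> G" using G(2) F by (simp add: in_hom_def)
    also have "\<dots> = zero_arr C s t" using cmp_eq_assoc[OF i(2), of G] G(1) F st by (simp add: in_hom_def)
    finally show ?thesis using F(2) by simp
  qed
qed

text \<open>A nonzero \<open>F\<close> is monic, and a monic from a nonzero object into the simple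
  \<open>t\<close> is invertible.\<close>

lemma schur:
  assumes ab: "abelian_category C" and s: "simple_object C s" "simple_object C t"
    and F: "in_hom C F s t" "F \<noteq> zero_arr C s t"
  obtains G where "in_hom C G t s" "G \<bullet> F = ident C s"
proof -
  have "\<not> zero_object C s" "s \<in> Obj C" using s(1) unfolding simple_object_def by auto
  then have "iso_mor C s t (under F)"
    using simple_nonzero_imp_mono[OF ab s(1) F] s(2) unfolding simple_object_def by blast
  then show thesis using iso_mor_iff[OF F(1)] that by auto
qed

text \<open>Either every component \<open>P j \<bullet> F\<close> vanishes and \<open>F\<close> is
  zero, or some component has a left inverse by Schur, and composing it with \<open>P j\<close>
  gives a left inverse of \<open>F\<close>.\<close>

lemma regular_from_simple:
  assumes ab: "abelian_category C" and s: "simple_object C s"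
    and b: "biprod C b n t J P" "\<And>j. j < n \<Longrightarrow> simple_object C (t j)"
    and F: "in_hom C F s b"
  obtains H where "in_hom C H b s" "F \<bullet> H \<bullet> F = F"
proof (cases "\<forall>j<n. P j \<bullet> F = zero_arr C s (t j)")
  case True
  have sb: "s \<in> Obj C" "b \<in> Obj C" using F by (auto dest: in_homD)
  have JP: "in_hom C (J j) (t j) b" "in_hom C (P j) b (t j)" if "j < n" for j
    using b(1) that unfolding biprod_def by auto
  have "F = psum C b b (\<lambda>j. J j \<bullet> P j) n \<bullet> F"
    using b(1) F unfolding biprod_def by (auto simp: in_hom_def)
  also have "\<dots> = psum C s b (\<lambda>j. (J j \<bullet> P j) \<bullet> F) n"
    by (rule cmp_psum_left[OF F sb(2)])
  also have "\<dots> = zero_arr C s b"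
  proof (rule psum_zer[OF sb])
    fix j assume j: "j < n"
    then have "P j \<bullet> F = zero_arr C s (t j)" using True by simp
    then show "(J j \<bullet> P j) \<bullet> F = zero_arr C s b" using JP(1)[OF j] sb by (simp add: in_hom_def)
  qed
  finally have F0: "F = zero_arr C s b" .
  show ?thesis by (rule that[of "zero_arr C b s"]) (use F0 sb in \<open>auto simp: in_hom_def\<close>)
next
  case False
  then obtain j where j: "j < n" "P j \<bullet> F \<noteq> zero_arr C s (t j)" by blast
  have P: "in_hom C (P j) b (t j)" using b(1) j(1) unfolding biprod_def by auto
  have "in_hom C (P j \<bullet> F) s (t j)" using P F by blast
  then obtain G where G: "in_hom C G (t j) s" "G \<bullet> P j \<bullet> F = ident C s"
    using schur[OF ab s b(2)[OF j(1)], of "P j \<bullet> F"] j(2) by blast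
  show ?thesis by (rule that[of "G \<bullet> P j"]) (use G P F in \<open>auto simp: in_hom_def\<close>)
qed

text \<open>Gaussian elimination: the left columns \<open>F\<^sub>1\<close> of \<open>F\<close> are regular, and so is the last column
  after the columns \<open>F\<^sub>1\<close> have been used to reduce it.\<close>

lemma regular_add_column:
  assumes F: "in_hom C F a b" and J: "in_hom C J s a" and P: "in_hom C P a s" and PJ: "P \<bullet> J = ident C s"
    and reg1: "\<And>F1. in_hom C F1 a b \<Longrightarrow> F1 = F \<boxplus> neg_arr C (F \<bullet> J \<bullet> P) \<Longrightarrow> \<exists>G. in_hom C G b a \<and> F1 \<bullet> G \<bullet> F1
        = F1"
    and reg2: "\<And>F2. in_hom C F2 s b \<Longrightarrow> \<exists>H. in_hom C H b s \<and> F2 \<bullet> H \<bullet> F2 = F2"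
  shows "\<exists>G. in_hom C G b a \<and> F \<bullet> G \<bullet> F = F"
proof -
  define F1 where "F1 = F \<boxplus> neg_arr C (F \<bullet> J \<bullet> P)"
  have F1: "in_hom C F1 a b" using F J P by (simp add: F1_def in_hom_def)
  have obj: "a \<in> Obj C" "b \<in> Obj C" "s \<in> Obj C" using F J by (auto dest: in_homD)
  obtain G1 where G1: "in_hom C G1 b a" "F1 \<bullet> G1 \<bullet> F1 = F1" using reg1[OF F1 F1_def] by blast
  note PJ' = cmp_eq_assoc[OF PJ]
  have F1J: "F1 \<bullet> J = zero_arr C s b"
    using F J P PJ by (simp add: F1_def in_hom_def cmp_add_left)
  note F1J' = cmp_eq_assoc[OF F1J]
  \<comment> \<open>The part of \<open>G1\<close> that lands in the summand \<open>s\<close> is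
    removed. As \<open>F1\<close> kills \<open>J\<close>, this does not change
    \<open>F1 \<bullet> G1\<close>, but it gives \<open>P \<bullet> G = 0\<close>, so that
    \<open>F\<close> and \<open>F1\<close> agree on \<open>G\<close>.\<close>
  define G where "G = G1 \<boxplus> neg_arr C (J \<bullet> P \<bullet> G1)"
  have G: "in_hom C G b a" using G1 J P by (simp add: G_def in_hom_def)
  have F1G: "F1 \<bullet> G = F1 \<bullet> G1" using F1 J P G1 obj
    by (simp add: G_def in_hom_def cmp_add_right F1J')
  have PG: "P \<bullet> G = zero_arr C b s" using F1 J P G1 obj
    by (simp add: G_def in_hom_def cmp_add_right PJ')
  note PG' = cmp_eq_assoc[OF PG]
  have F_eq: "F = F1 \<boxplus> F \<bullet> J \<bullet> P" using F J P
    by (simp add: F1_def in_hom_def add_assoc)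
  have FG: "F \<bullet> G = F1 \<bullet> G1"
  proof -
    have "F \<bullet> G = (F1 \<boxplus> F \<bullet> J \<bullet> P) \<bullet> G" using F_eq by simp
    also have "\<dots> = F1 \<bullet> G1" using F1 G G1 F J P obj by (simp add: in_hom_def cmp_add_left F1G PG)
    finally show ?thesis .
  qed
  \<comment> \<open>Projector complementary to the idempotent \<open>F1 \<bullet> G1\<close>. It
    kills \<open>F1\<close>, so \<open>Q \<bullet> F\<close> is carried by the last column alone,
    and that reduced column is \<open>Q \<bullet> F \<bullet> J\<close>.\<close>
  define Q where "Q = ident C b \<boxplus> neg_arr C (F1 \<bullet> G1)"
  have Q: "in_hom C Q b b" using F1 G1 obj by (simp add: Q_def in_hom_def)
  have QF1: "Q \<bullet> F1 = zero_arr C a b" using F1 G1 obj by (simp add: Q_def in_hom_def cmp_add_left G1(2))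
  have QF: "Q \<bullet> F = (Q \<bullet> F \<bullet> J) \<bullet> P"
  proof -
    have "Q \<bullet> F = Q \<bullet> (F1 \<boxplus> F \<bullet> J \<bullet> P)" using F_eq by simp
    also have "\<dots> = (Q \<bullet> F \<bullet> J) \<bullet> P" using Q F1 F J P obj by (simp add: in_hom_def cmp_add_right QF1)
    finally show ?thesis .
  qed
  have "in_hom C (Q \<bullet> F \<bullet> J) s b" using Q F J by blast
  then obtain H where H: "in_hom C H b s" "(Q \<bullet> F \<bullet> J) \<bullet> H \<bullet> Q \<bullet> F \<bullet> J = Q \<bullet> F \<bullet> J"
    using reg2 by blast
  \<comment> \<open>The correction contributed by the last column. The factor \<open>1 - G F\<close>
    is chosen because \<open>F (1 - G F) = Q F\<close>, so \<open>F \<bullet> R\<close> begins with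
    the reduced column.\<close>
  define R where "R = (ident C a \<boxplus> neg_arr C (G \<bullet> F)) \<bullet> J \<bullet> H \<bullet> Q"
  have R: "in_hom C R b a" using G F J H Q obj by (simp add: R_def in_hom_def)
  have FR: "F \<bullet> R = Q \<bullet> F \<bullet> J \<bullet> H \<bullet> Q"
    using F G J H Q F1 G1 obj cmp_eq_assoc[OF FG]
    by (simp add: R_def Q_def in_hom_def cmp_add_left cmp_add_right)
  have QFQ: "Q \<bullet> F \<bullet> J \<bullet> H \<bullet> Q \<bullet> F = Q \<bullet> F"
  proof -
    have "Q \<bullet> F \<bullet> J \<bullet> H \<bullet> Q \<bullet> F = Q \<bullet> F \<bullet> J \<bullet> H \<bullet> (Q \<bullet> F \<bullet> J) \<bullet> P" by (subst QF) simp
    also have "\<dots> = ((Q \<bullet> F \<bullet> J) \<bullet> H \<bullet> Q \<bullet> F \<bullet> J) \<bullet> P" by simp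
    also have "\<dots> = Q \<bullet> F" unfolding H(2) using QF by simp
    finally show ?thesis .
  qed
  \<comment> \<open>The two contributions are the image part \<open>F1 G1 F\<close> and the
    complementary part \<open>Q F\<close>, which add up to \<open>F\<close>.\<close>
  have "F \<bullet> (G \<boxplus> R) \<bullet> F = F1 \<bullet> G1 \<bullet> F \<boxplus> Q \<bullet> F"
    using cmp_eq_assoc[OF FG] cmp_eq_assoc[OF FR] QFQ by (simp add: cmp_add_right cmp_add_left)
  also have "\<dots> = F" using F F1 G1 obj
    by (simp add: Q_def in_hom_def cmp_add_left add_commute[of _ "neg_arr C (F1 \<bullet> G1
        \<bullet> F)"] add_assoc[symmetric])
  finally show ?thesis using G R by (intro exI[of _ "G \<boxplus> R"]) (auto simp: in_hom_def)
qed

text \<open>Column-by-column elimination: \<open>regular_add_column\<close> reduces to an arrow with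
  one more vanishing column, and the reduced column starts at a summand \<open>s j\<close>, where
  \<open>reg\<close> applies.\<close>

lemma regular_from_biprod:
  assumes a: "biprod C a n s J P" and b: "b \<in> Obj C"
    and reg: "\<And>j F. j < n \<Longrightarrow> in_hom C F (s j) b \<Longrightarrow> \<exists>G. in_hom C G b (s j) \<and> F \<bullet> G \<bullet> F = F"
    and F: "in_hom C F a b"
  shows "\<exists>G. in_hom C G b a \<and> F \<bullet> G \<bullet> F = F"
proof -
  have ab: "a \<in> Obj C" using a by (simp add: biprod_def)
  have J: "in_hom C (J j) (s j) a" and P: "in_hom C (P j) a (s j)"
    and PJ: "l < n \<Longrightarrow> P j \<bullet> J l = (if j = l then ident C (s j) else zero_arr C (s l) (s j))" if "j < n"
        for j l
    using a that unfolding biprod_def by auto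
  \<comment> \<open>Induction on \<open>k\<close>, the columns with index at least \<open>k\<close>
    being zero; for \<open>k = n\<close> that is no condition, for \<open>k = 0\<close> it forces
    \<open>F = 0\<close>.\<close>
  have "\<exists>G. in_hom C G b a \<and> F \<bullet> G \<bullet> F = F"
    if "k \<le> n" "in_hom C F a b" "\<And>j. k \<le> j \<Longrightarrow> j < n \<Longrightarrow> F \<bullet> J j = zero_arr C (s j) b" for k F
    using that
  proof (induction k arbitrary: F)
    case 0
    have "F = F \<bullet> psum C a a (\<lambda>j. J j \<bullet> P j) n"
      using a 0(2) unfolding biprod_def by (auto simp: in_hom_def)
    also have "\<dots> = psum C a b (\<lambda>j. F \<bullet> J j \<bullet> P j) n"
      using 0(2) ab by (rule cmp_psum_right)
    also have "\<dots> = zero_arr C a b"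
    proof (rule psum_zer[OF ab b])
      fix j assume j: "j < n"
      then show "F \<bullet> J j \<bullet> P j = zero_arr C a b" using cmp_eq_assoc[OF 0(3)[OF _ j], of "P j"] P[OF j] b
        by (simp add: in_hom_def)
    qed
    finally have "F = zero_arr C a b" .
    then show ?case using ab b by (intro exI[of _ "zero_arr C b a"]) (auto simp: in_hom_def)
  next
    case (Suc k)
    have k: "k < n" using Suc.prems by simp
    show ?case
    proof (rule regular_add_column[OF Suc.prems(2) J[OF k] P[OF k]])
      show "P k \<bullet> J k = ident C (s k)" using PJ[OF k k] by simp
    next
      fix F1 assume F1: "in_hom C F1 a b" "F1 = F \<boxplus> neg_arr C (F \<bullet> J k \<bullet> P k)"
      have "F1 \<bullet> J j = zero_arr C (s j) b" if j: "k \<le> j" "j < n" for j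
        using J[OF k] J[OF j(2)] P[OF k] PJ[OF k j(2)] in_homD(4)[OF J[OF k]]
            in_homD(4)[OF J[OF j(2)]] Suc.prems(2) Suc.prems(3)[of j] j F1(1) b unfolding F1(2)
        by (cases "k = j") (auto simp: in_hom_def cmp_add_left)
      then show "\<exists>G. in_hom C G b a \<and> F1 \<bullet> G \<bullet> F1 = F1" using Suc.IH F1(1) k by simp
    qed (use reg k in blast)
  qed
  from this[of n F] F show ?thesis by simp
qed

text \<open>Both ends are decomposed: the source so that elimination runs over columns starting at
  simple objects, the target so that Schur's lemma makes each such column regular.\<close>

theorem semisimple_imp_regular:
  assumes "semisimple_category C"
  shows "regular_category C"
  unfolding regular_category_def
proof (intro allI impI)
  fix F assume "arr C F"
  then have F: "in_hom C F (source F) (target F)" by (simp add: in_hom_def)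
  have ab: "abelian_category C" using assms unfolding semisimple_category_def by simp
  have dec: "\<exists>n s J P. biprod C x n s J P \<and> (\<forall>j<n. simple_object C (s j))" if "x \<in> Obj C" for x
    using assms that is_biproduct_imp_biprod unfolding semisimple_category_def by metis
  obtain n s J P where a: "biprod C (source F) n s J P" "\<forall>j<n. simple_object C (s j)"
    using dec[of "source F"] in_homD[OF F] by metis
  obtain m t J' P' where b: "biprod C (target F) m t J' P'" "\<forall>j<m. simple_object C (t j)"
    using dec[of "target F"] in_homD[OF F] by metis
  show "\<exists>G. in_hom C G (target F) (source F) \<and> F \<bullet> G \<bullet> F = F"
  proof (rule regular_from_biprod[OF a(1) _ _ F])
    show "target F \<in> Obj C" using F by (rule in_homD)
  next
    fix j F' assume "j < n" "in_hom C F' (s j) (target F)"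
    then show "\<exists>G. in_hom C G (target F) (s j) \<and> F' \<bullet> G \<bullet> F' = F'"
      using regular_from_simple[OF ab _ b(1)] a(2) b(2) by metis
  qed
qed

text \<open>The image of an idempotent \<open>E\<close> is obtained as the kernel of the
  complementary idempotent \<open>1 - E\<close>.\<close>

lemma semisimple_imp_split_idempotents:
  assumes "semisimple_category C"
  shows "split_idempotents C"
  unfolding split_idempotents_def
proof (intro allI impI)
  fix E a assume E: "in_hom C E a a" "E \<bullet> E = E"
  define N where "N = ident C a \<boxplus> neg_arr C E"
  have a: "a \<in> Obj C" using E by (auto dest: in_homD)
  have N: "in_hom C N a a" using E a by (simp add: N_def in_hom_def)
  have N': "mk_arr a (under N) a = N" using N by (rule mk_und)
  obtain k i where ker: "is_kernel C a a (under N) k i"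
    using assms a in_homD(6)[OF N] unfolding semisimple_category_def abelian_category_def by metis
  then have k: "k \<in> Obj C" unfolding is_kernel_def by blast
  define J where "J = mk_arr k i a"
  have J: "in_hom C J k a" "N \<bullet> J = zero_arr C k a" and
    ex: "\<And>x H. in_hom C H x a \<Longrightarrow> N \<bullet> H = zero_arr C x a \<Longrightarrow> \<exists>!L. in_hom C L x k \<and> J \<bullet> L = H"
    using is_kernel_iff[of a "under N" a k i] ker k N unfolding N' J_def by auto
  have "N \<bullet> E = zero_arr C a a" using E a by (simp add: N_def in_hom_def cmp_add_left)
  then obtain P where P: "in_hom C P a k" "J \<bullet> P = E" using ex[OF E(1)] by blast
  have EJ: "E \<bullet> J = J"
  proof -
    have "J \<boxplus> neg_arr C (E \<bullet> J) = zero_arr C k a" using J E a by (simp add: N_def in_hom_def cmp_add_left)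
    then show ?thesis using eq_of_add_neg_eq_zer[of J "E \<bullet> J" k a] a k by simp
  qed
  \<comment> \<open>Both arrows factor \<open>J\<close> through the kernel \<open>J\<close>, and
    such factorizations are unique.\<close>
  have "P \<bullet> J = ident C k"
  proof -
    have "in_hom C (P \<bullet> J) k k" "J \<bullet> P \<bullet> J = J"
      using P J EJ cmp_eq_assoc[OF P(2), of J] by auto
    moreover have "in_hom C (ident C k) k k" "J \<bullet> ident C k = J" using J k by (auto simp: in_hom_def)
    ultimately show ?thesis using ex[OF J] by blast
  qed
  then show "\<exists>k P J. in_hom C P a k \<and> in_hom C J k a \<and> J \<bullet> P = E \<and> P \<bullet> J = ident C k"
    using P J by blast
qed

section \<open>Abelian structure and simple decompositions from regularity\<close>

lemma ident_add_neg_idem: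
  assumes "in_hom C E a a" "E \<bullet> E = E"
  shows "(ident C a \<boxplus> neg_arr C E) \<bullet> (ident C a \<boxplus> neg_arr C E) = ident C a \<boxplus> neg_arr C E"
  using assms in_homD(4)[OF assms(1)] by (simp add: in_hom_def cmp_add_left cmp_add_right)

lemma biprod_2E:
  assumes ab: "abelian_category C" "a \<in> Obj C" "b \<in> Obj C"
  obtains x J0 J1 P0 P1 where "in_hom C J0 a x" "in_hom C J1 b x" "in_hom C P0 x a" "in_hom C P1 x b"
    "P0 \<bullet> J0 = ident C a" "P1 \<bullet> J1 = ident C b" "P0 \<bullet> J1 = zero_arr C b a" "P1 \<bullet> J0 = zero_arr C a b"
    "J0 \<bullet> P0 \<boxplus> J1 \<bullet> P1 = ident C x"
proof -
  obtain x \<iota> \<pi> where "is_biproduct C x 2 (\<lambda>j. if j = 0 then a else b) \<iota> \<pi>"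
    using ab unfolding abelian_category_def by blast
  then obtain J P where bp: "biprod C x 2 (\<lambda>j. if j = 0 then a else b) J P"
    using is_biproduct_imp_biprod by blast
  have "x \<in> Obj C" using bp by (simp add: biprod_def)
  have h: "in_hom C (J j) (if j = 0 then a else b) x" "in_hom C (P j) x (if j = 0 then a else b)"
    "l < 2 \<Longrightarrow> P j \<bullet> J l = (if j = l then ident C (if j = 0 then a else b) else zero_arr C (if l
        = 0 then a else b) (if j = 0 then a else b))"
    if "j < 2" for j l
    using bp that unfolding biprod_def by auto
  show thesis
  proof (rule that[of "J 0" x "J 1" "P 0" "P 1"])
    have "zero_arr C x x \<boxplus> J 0 \<bullet> P 0 \<boxplus> J 1 \<bullet> P 1 = ident C x"
      using bp by (simp add: biprod_def numeral_2_eq_2)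
    then show "J 0 \<bullet> P 0 \<boxplus> J 1 \<bullet> P 1 = ident C x"
      using h(1)[of 0] h(2)[of 0] by (simp add: in_hom_def)
  qed (use h[of 0] h[of 1] in auto)
qed

text \<open>Conjugation \<open>h \<mapsto> F h G\<close> embeds End a into End x, with
  \<open>G _ F\<close> undoing it, and it misses the identity. This is the induction measure for
  decompositions: a proper retract has a smaller endomorphism space.\<close>

lemma dim_end_less:
  assumes F: "in_hom C F a x" and G: "in_hom C G x a" and GF: "G \<bullet> F = ident C a" and FG: "F
      \<bullet> G \<noteq> ident C x"
  shows "vectorspace.dim K (Hom C a a) < vectorspace.dim K (Hom C x x)"
proof -
  have ax: "a \<in> Obj C" "x \<in> Obj C" using F by (auto dest: in_homD)
  interpret A: vectorspace K "Hom C a a" using ax by (intro hom_vectorspace)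
  interpret X: vectorspace K "Hom C x x" using ax by (intro hom_vectorspace)
  let ?T = "\<lambda>h. under F \<cdot> (h \<cdot> under G)"
  have FG': "under F \<in> mor C a x" "under G \<in> mor C x a" using F G by (auto dest: in_homD)
  have T: "mk_arr x (?T h) x = F \<bullet> mk_arr a h a \<bullet> G" if "h \<in> mor C a a" for h
  proof -
    have "mk_arr a (under F) x \<bullet> mk_arr a h a \<bullet> mk_arr x (under G) a = mk_arr x (?T h) x"
      using FG' ax that comp_mor[OF ax(2,1,1) FG'(2) that] by simp
    then show ?thesis using F G by (simp add: mk_und)
  qed
  interpret m1: mod_hom K "Hom C a a" "Hom C x a" "\<lambda>h. h \<cdot> under G" using ax FG' by (intro hom_mod_hom)
  interpret m2: mod_hom K "Hom C x a" "Hom C x x" "\<lambda>h. under F \<cdot> h" using ax FG' by (intro hom_mod_hom)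
  have "?T \<in> module_hom K (Hom C a a) (Hom C x x)"
    unfolding module_hom_def by auto
  then interpret lm: linear_map K "Hom C a a" "Hom C x x" ?T
    by (unfold_locales)
  show ?thesis
  proof (rule lm.dim_less_of_inj_not_surj)
    show "A.fin_dim" "X.fin_dim" using ax by (auto intro: hom_fin_dim)
    show "inj_on ?T (mor C a a)"
    proof (rule inj_onI)
      fix h h' assume h: "h \<in> mor C a a" "h' \<in> mor C a a" "?T h = ?T h'"
      then have "F \<bullet> mk_arr a h a \<bullet> G = F \<bullet> mk_arr a h' a \<bullet> G" by (simp flip: T)
      then have "G \<bullet> (F \<bullet> mk_arr a h a \<bullet> G) \<bullet> F = G \<bullet> (F \<bullet> mk_arr a h' a \<bullet> G) \<bullet> F" by simp
      then show "h = h'" using GF cmp_eq_assoc[OF GF] h(1,2) ax by simp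
    qed
    show "?T ` mor C a a \<noteq> mor C x x"
    proof
      assume "?T ` mor C a a = mor C x x"
      then have "Id C x \<in> ?T ` mor C a a" using id_mor[OF ax(2)] by simp
      then obtain h where h: "Id C x = ?T h" "h \<in> mor C a a" by (rule imageE)
      have id: "ident C x = F \<bullet> mk_arr a h a \<bullet> G" unfolding ident_def h(1) by (rule T[OF h(2)])
      \<comment> \<open>If the identity were \<open>F h G\<close>, then multiplying by
        \<open>F G\<close> on the left would fix it, since \<open>G F = 1\<close>.\<close>
      have "F \<bullet> G = (F \<bullet> G) \<bullet> ident C x" using F G by (simp add: in_hom_def)
      also have "\<dots> = F \<bullet> mk_arr a h a \<bullet> G" unfolding id using cmp_eq_assoc[OF GF] h(2) ax F G
          by (simp add: in_hom_def)
      finally show False using FG id by simp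
    qed
  qed
qed

text \<open>Cancelling the monic \<open>F\<close> on the left of \<open>F G F = F\<close> leaves
  \<open>G F = 1\<close>.\<close>

lemma regular_monic_split:
  assumes reg: "regular_category C" and F: "in_hom C F a b" and mono: "monic C a b (under F)"
  obtains G where "in_hom C G b a" "G \<bullet> F = ident C a"
proof -
  have ab: "a \<in> Obj C" "b \<in> Obj C" using F by (auto dest: in_homD)
  obtain G where G: "in_hom C G b a" "F \<bullet> G \<bullet> F = F" using regularE[OF reg F] .
  have "in_hom C (G \<bullet> F) a a" using F G by blast
  moreover have "F \<bullet> G \<bullet> F = F \<bullet> ident C a" using F G by (simp add: in_hom_def)
  ultimately have "G \<bullet> F = ident C a"
    using mono ab unfolding monic_iff[OF ab] mk_und[OF F] by blast
  then show thesis using that G by blast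
qed

lemma regular_epic_split:
  assumes reg: "regular_category C" and F: "in_hom C F a b" and epi: "epic C a b (under F)"
  obtains G where "in_hom C G b a" "F \<bullet> G = ident C b"
proof -
  have ab: "a \<in> Obj C" "b \<in> Obj C" using F by (auto dest: in_homD)
  obtain G where G: "in_hom C G b a" "F \<bullet> G \<bullet> F = F" using regularE[OF reg F] .
  have "in_hom C (F \<bullet> G) b b" using F G by blast
  moreover have "(F \<bullet> G) \<bullet> F = ident C b \<bullet> F" using F G by (simp add: in_hom_def)
  ultimately have "F \<bullet> G = ident C b"
    using epi ab unfolding epic_iff[OF ab] mk_und[OF F] by blast
  then show thesis using that G by blast
qed

text \<open>If \<open>F H = 0\<close>, then \<open>J P + G F = 1\<close> gives
  \<open>H = J P H\<close>, so \<open>P \<bullet> H\<close> is the factorization; it is unique as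
  \<open>J\<close> is split.\<close>

lemma split_kernel:
  assumes F: "in_hom C F a b" and J: "in_hom C J k a" and P: "in_hom C P a k"
    and PJ: "P \<bullet> J = ident C k" and FJ: "F \<bullet> J = zero_arr C k b"
    and G: "in_hom C G b a" and JP: "J \<bullet> P \<boxplus> G \<bullet> F = ident C a"
  shows "is_kernel C a b (under F) k (under J)"
proof -
  have obj: "a \<in> Obj C" "b \<in> Obj C" "k \<in> Obj C" using F J by (auto dest: in_homD)
  have "\<exists>!L. in_hom C L x k \<and> J \<bullet> L = H" if H: "in_hom C H x a" "F \<bullet> H = zero_arr C x b" for x H
  proof (rule ex1I[of _ "P \<bullet> H"])
    have "H = (J \<bullet> P \<boxplus> G \<bullet> F) \<bullet> H" using H JP by (simp add: in_hom_def)
    also have "\<dots> = J \<bullet> P \<bullet> H" using H J P G in_homD(4)[OF H(1)] by (simp add: cmp_add_left in_hom_def)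
    finally show "in_hom C (P \<bullet> H) x k \<and> J \<bullet> P \<bullet> H = H" using H P by auto
  next
    fix L assume L: "in_hom C L x k \<and> J \<bullet> L = H"
    then show "L = P \<bullet> H" using cmp_eq_assoc[OF PJ, of L] by (auto simp: in_hom_def)
  qed
  then show ?thesis
    using is_kernel_iff[of a "under F" b k "under J"] F J FJ obj(3) by (simp add: mk_und)
qed

lemma split_cokernel:
  assumes F: "in_hom C F a b" and J: "in_hom C J k b" and P: "in_hom C P b k"
    and PJ: "P \<bullet> J = ident C k" and PF: "P \<bullet> F = zero_arr C a k"
    and G: "in_hom C G b a" and JP: "J \<bullet> P \<boxplus> F \<bullet> G = ident C b"
  shows "is_cokernel C a b (under F) k (under P)"
proof -
  have obj: "a \<in> Obj C" "b \<in> Obj C" "k \<in> Obj C" using F J by (auto dest: in_homD)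
  have "\<exists>!L. in_hom C L k x \<and> L \<bullet> P = H" if H: "in_hom C H b x" "H \<bullet> F = zero_arr C a x" for x H
  proof (rule ex1I[of _ "H \<bullet> J"])
    have "H = H \<bullet> (J \<bullet> P \<boxplus> F \<bullet> G)" using H JP by (simp add: in_hom_def)
    also have "\<dots> = H \<bullet> J \<bullet> P" using H J P G in_homD(5)[OF H(1)] cmp_eq_assoc[OF H(2)]
      by (simp add: cmp_add_right in_hom_def)
    finally show "in_hom C (H \<bullet> J) k x \<and> (H \<bullet> J) \<bullet> P = H" using H J by auto
  next
    fix L assume L: "in_hom C L k x \<and> L \<bullet> P = H"
    then have "H \<bullet> J = L \<bullet> P \<bullet> J" by auto
    then show "L = H \<bullet> J" using PJ L by (auto simp: in_hom_def)
  qed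
  then show ?thesis
    using is_cokernel_iff[of a "under F" b k "under P"] F P PF obj(3) by (simp add: mk_und)
qed

lemma biprod_2I:
  assumes "in_hom C J0 a x" "in_hom C J1 b x" "in_hom C P0 x a" "in_hom C P1 x b"
    "P0 \<bullet> J0 = ident C a" "P1 \<bullet> J1 = ident C b" "P0 \<bullet> J1 = zero_arr C b a" "P1 \<bullet> J0 = zero_arr C a b"
    "J0 \<bullet> P0 \<boxplus> J1 \<bullet> P1 = ident C x"
  shows "\<exists>x \<iota> \<pi>. is_biproduct C x 2 (\<lambda>j. if j = 0 then a else b) \<iota> \<pi>"
proof -
  have "biprod C x 2 (\<lambda>j. if j = 0 then a else b) (\<lambda>j. if j = 0 then J0 else J1) (\<lambda>j. if j
      = 0 then P0 else P1)"
    unfolding biprod_def using assms in_homD(5)[OF assms(1)]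
    by (auto simp: numeral_2_eq_2 less_Suc_eq in_hom_def)
  then show ?thesis using biprod_imp_is_biproduct by blast
qed

text \<open>With \<open>F G F = F\<close>, splitting the idempotents \<open>1 - G F\<close> and
  \<open>1 - F G\<close> gives kernel and cokernel of \<open>F\<close>. A monic splits, with
  retraction \<open>G\<close>, and is the kernel of \<open>1 - F G\<close>; dually, an epic with
  section \<open>G\<close> is the cokernel of \<open>1 - G F\<close>.\<close>

theorem regular_imp_abelian:
  assumes reg: "regular_category C" and split: "split_idempotents C" and zero: "\<exists>z. zero_object C z"
    and bip: "\<And>a b. a \<in> Obj C \<Longrightarrow> b \<in> Obj C \<Longrightarrow>
      \<exists>x \<iota> \<pi>. is_biproduct C x 2 (\<lambda>j. if j = 0 then a else b) \<iota> \<pi>"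
  shows "abelian_category C"
  unfolding abelian_category_def
proof (intro conjI ballI allI impI zero bip)
  fix a b f assume ab: "a \<in> Obj C" "b \<in> Obj C" and f: "f \<in> mor C a b"
  define F where "F = mk_arr a f b"
  have F: "in_hom C F a b" and f_eq: "f = under F" using ab f by (auto simp: F_def)
  obtain G where G: "in_hom C G b a" "F \<bullet> G \<bullet> F = F" using regularE[OF reg F] .
  have GF: "in_hom C (G \<bullet> F) a a" "(G \<bullet> F) \<bullet> G \<bullet> F = G \<bullet> F" using F G by auto
  have FG: "in_hom C (F \<bullet> G) b b" "(F \<bullet> G) \<bullet> F \<bullet> G = F \<bullet> G" using F G cmp_eq_assoc[OF G(2), of G] by auto
  have "in_hom C (ident C a \<boxplus> neg_arr C (G \<bullet> F)) a a" using GF ab by (simp add: in_hom_def)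
  from split_idempotentsE[OF split this ident_add_neg_idem[OF GF]]
  obtain k P J where k: "in_hom C P a k" "in_hom C J k a" "J \<bullet> P = ident C a \<boxplus> neg_arr C (G \<bullet> F)" "P \<bullet> J
      = ident C k"
    by metis
  have "F \<bullet> J = F \<bullet> (J \<bullet> P) \<bullet> J" using k(1,2,4) F by (simp add: in_hom_def)
  also have "\<dots> = F \<bullet> (ident C a \<boxplus> neg_arr C (G \<bullet> F)) \<bullet> J" unfolding k(3) ..
  also have "\<dots> = zero_arr C k b"
    using F G(1) k(2) ab in_homD(4)[OF k(2)] cmp_eq_assoc[OF G(2), of J]
    by (simp add: in_hom_def cmp_add_left cmp_add_right)
  finally have FJ: "F \<bullet> J = zero_arr C k b" .
  have "J \<bullet> P \<boxplus> G \<bullet> F = ident C a" using k(3) GF ab by (simp add: in_hom_def add_assoc)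
  then show "\<exists>k i. is_kernel C a b f k i"
    unfolding f_eq using split_kernel[OF F k(2,1,4) FJ G(1)] by blast
  have "in_hom C (ident C b \<boxplus> neg_arr C (F \<bullet> G)) b b" using FG ab by (simp add: in_hom_def)
  from split_idempotentsE[OF split this ident_add_neg_idem[OF FG]]
  obtain q P' J' where q: "in_hom C P' b q" "in_hom C J' q b" "J' \<bullet> P' = ident C b \<boxplus> neg_arr C (F \<bullet> G)" "P'
      \<bullet> J' = ident C q"
    by metis
  have "P' \<bullet> F = P' \<bullet> (J' \<bullet> P') \<bullet> F" using q(1,2) F cmp_eq_assoc[OF q(4)] by (simp add: in_hom_def)
  also have "\<dots> = P' \<bullet> (ident C b \<boxplus> neg_arr C (F \<bullet> G)) \<bullet> F" unfolding q(3) ..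
  also have "\<dots> = zero_arr C a q"
    using F G q(1) ab in_homD(5)[OF q(1)]
    by (simp add: in_hom_def cmp_add_left cmp_add_right)
  finally have PF: "P' \<bullet> F = zero_arr C a q" .
  have "J' \<bullet> P' \<boxplus> F \<bullet> G = ident C b" using q(3) FG ab by (simp add: in_hom_def add_assoc)
  then show "\<exists>q p. is_cokernel C a b f q p"
    unfolding f_eq using split_cokernel[OF F q(2,1,4) PF G(1)] by blast
next
  fix a b f assume ab: "a \<in> Obj C" "b \<in> Obj C" and "monic C a b f"
  define F where "F = mk_arr a f b"
  have F: "in_hom C F a b" and f_eq: "f = under F" using ab \<open>monic C a b f\<close> by (auto simp: F_def monic_def)
  obtain G where G: "in_hom C G b a" "G \<bullet> F = ident C a"
    using regular_monic_split[OF reg F] \<open>monic C a b f\<close> f_eq by blast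
  define N where "N = ident C b \<boxplus> neg_arr C (F \<bullet> G)"
  have N: "in_hom C N b b" using F G ab by (simp add: N_def in_hom_def)
  have "is_kernel C b b (under N) a (under F)"
  proof (rule split_kernel[OF N F G])
    show "N \<bullet> F = zero_arr C a b" using F G ab by (simp add: N_def in_hom_def cmp_add_left)
    show "in_hom C (ident C b) b b" using ab by blast
    show "F \<bullet> G \<boxplus> ident C b \<bullet> N = ident C b" using F G ab N
      by (simp add: N_def in_hom_def add_assoc add_commute[of "F \<bullet> G"])
  qed
  then show "\<exists>c\<in>Obj C. \<exists>g\<in>mor C b c. is_kernel C b c g a f"
    unfolding f_eq using ab in_homD(6)[OF N] by blast
next
  fix a b f assume ab: "a \<in> Obj C" "b \<in> Obj C" and "epic C a b f"
  define F where "F = mk_arr a f b"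
  have F: "in_hom C F a b" and f_eq: "f = under F" using ab \<open>epic C a b f\<close> by (auto simp: F_def epic_def)
  obtain G where G: "in_hom C G b a" "F \<bullet> G = ident C b"
    using regular_epic_split[OF reg F] \<open>epic C a b f\<close> f_eq by blast
  define N where "N = ident C a \<boxplus> neg_arr C (G \<bullet> F)"
  have N: "in_hom C N a a" using F G ab by (simp add: N_def in_hom_def)
  have "is_cokernel C a a (under N) b (under F)"
  proof (rule split_cokernel[OF N G(1) F G(2)])
    show "F \<bullet> N = zero_arr C a b" using F G ab cmp_eq_assoc[OF G(2), of F]
        by (simp add: N_def in_hom_def cmp_add_right)
    show "in_hom C (ident C a) a a" using ab by blast
    show "G \<bullet> F \<boxplus> N \<bullet> ident C a = ident C a" using F G ab N
      by (simp add: N_def in_hom_def add_assoc add_commute[of "G \<bullet> F"])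
  qed
  then show "\<exists>c\<in>Obj C. \<exists>g\<in>mor C c a. is_cokernel C c a g b f"
    unfolding f_eq using ab in_homD(6)[OF N] by blast
qed

text \<open>Failure of simplicity provides a monic from a nonzero object that is not invertible. It
  splits, and \<open>F G = 1\<close> would make it invertible after all.\<close>

lemma nonsimple_retract:
  assumes reg: "regular_category C" and x: "x \<in> Obj C" "\<not> zero_object C x" "\<not> simple_object C x"
  obtains a F G where "in_hom C F a x" "in_hom C G x a" "G \<bullet> F = ident C a" "F \<bullet> G \<noteq> ident C x"
      "\<not> zero_object C a"
proof -
  obtain a f where f: "a \<in> Obj C" "monic C a x f" "\<not> zero_object C a" "\<not> iso_mor C a x f"
    using x unfolding simple_object_def by blast
  define F where "F = mk_arr a f x"
  have F: "in_hom C F a x" and f_eq: "f = under F" using f x by (auto simp: F_def monic_def)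
  obtain G where G: "in_hom C G x a" "G \<bullet> F = ident C a"
    using regular_monic_split[OF reg F] f(2) f_eq by blast
  then have "F \<bullet> G \<noteq> ident C x" using f(4) iso_mor_iff[OF F] f_eq by auto
  then show thesis using that[OF F G _ f(3)] by blast
qed

text \<open>Passing to proper nonzero retracts lowers dim End, so the descent ends at a simple
  object; retracts compose.\<close>

lemma simple_retract:
  assumes reg: "regular_category C" and x: "x \<in> Obj C" "\<not> zero_object C x"
  shows "\<exists>s F G. simple_object C s \<and> in_hom C F s x \<and> in_hom C G x s \<and> G \<bullet> F = ident C s"
  using x
proof (induction "vectorspace.dim K (Hom C x x)" arbitrary: x rule: less_induct)
  case less
  show ?case
  proof (cases "simple_object C x")
    case True
    then show ?thesis using less.prems(1)
      by (intro exI[of _ x] exI[of _ "ident C x"]) (auto simp: in_hom_def)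
  next
    case False
    obtain a F G where a: "in_hom C F a x" "in_hom C G x a" "G \<bullet> F = ident C a" "F \<bullet> G \<noteq> ident C x"
        "\<not> zero_object C a"
      using nonsimple_retract[OF reg less.prems False] .
    obtain s F' G' where s: "simple_object C s" "in_hom C F' s a" "in_hom C G' a s" "G' \<bullet> F' = ident C s"
      using less.hyps[OF dim_end_less[OF a(1-4)] in_homD(4)[OF a(1)] a(5)] by blast
    have "in_hom C (F \<bullet> F') s x" "in_hom C (G' \<bullet> G) x s" using a s by auto
    moreover have "(G' \<bullet> G) \<bullet> F \<bullet> F' = ident C s" using s a cmp_eq_assoc[OF a(3)] by (simp add: in_hom_def)
    ultimately show ?thesis using s(1) by blast
  qed
qed

text \<open>A simple retract is split off, and the complement, obtained by splitting
  \<open>1 - F G\<close>, falls under the induction hypothesis.\<close>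

lemma regular_decomposition:
  assumes reg: "regular_category C" and split: "split_idempotents C" and x: "x \<in> Obj C"
  shows "\<exists>n s J P. biprod C x n s J P \<and> (\<forall>j<n. simple_object C (s j))"
  using x
proof (induction "vectorspace.dim K (Hom C x x)" arbitrary: x rule: less_induct)
  case less
  show ?case
  proof (cases "zero_object C x")
    case True
    \<comment> \<open>The empty biproduct: its sum is a zero arrow, which is the identity of a zero
      object.\<close>
    then have "biprod C x 0 s J P" for s J P
      using less.prems zero_object_iff[of x] by (simp add: biprod_def)
    then show ?thesis by blast
  next
    case False
    obtain s F G where s: "simple_object C s" "in_hom C F s x" "in_hom C G x s" "G \<bullet> F = ident C s"
      using simple_retract[OF reg less.prems False] by blast
    note GF = s(4) cmp_eq_assoc[OF s(4)]
    have sO: "s \<in> Obj C" using s(2) by (auto dest: in_homD)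
    have FG: "in_hom C (F \<bullet> G) x x" "(F \<bullet> G) \<bullet> F \<bullet> G = F \<bullet> G" using s GF by (auto simp: in_hom_def)
    have "in_hom C (ident C x \<boxplus> neg_arr C (F \<bullet> G)) x x" using FG less.prems by (simp add: in_hom_def)
    from split_idempotentsE[OF split this ident_add_neg_idem[OF FG]]
    obtain b P J where b: "in_hom C P x b" "in_hom C J b x" "J \<bullet> P = ident C x \<boxplus> neg_arr C (F \<bullet> G)" "P \<bullet> J
        = ident C b"
      by metis
    note PJ = b(4) cmp_eq_assoc[OF b(4)]
    have bO: "b \<in> Obj C" using b(2) by (auto dest: in_homD)
    have GJ: "G \<bullet> J = zero_arr C b s"
    proof -
      have "G \<bullet> J = G \<bullet> (J \<bullet> P) \<bullet> J" using b(1,2) s PJ by (simp add: in_hom_def)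
      also have "\<dots> = G \<bullet> (ident C x \<boxplus> neg_arr C (F \<bullet> G)) \<bullet> J" unfolding b(3) ..
      also have "\<dots> = zero_arr C b s"
        using s b(2) less.prems sO bO GF by (simp add: in_hom_def cmp_add_left cmp_add_right)
      finally show ?thesis .
    qed
    have PF: "P \<bullet> F = zero_arr C s b"
    proof -
      have "P \<bullet> F = P \<bullet> (J \<bullet> P) \<bullet> F" using b(1,2) s PJ by (simp add: in_hom_def)
      also have "\<dots> = P \<bullet> (ident C x \<boxplus> neg_arr C (F \<bullet> G)) \<bullet> F" unfolding b(3) ..
      also have "\<dots> = zero_arr C s b"
        using s b(1) less.prems sO bO GF by (simp add: in_hom_def cmp_add_left cmp_add_right)
      finally show ?thesis .
    qed
    have sum: "J \<bullet> P \<boxplus> F \<bullet> G = ident C x" using b(3) FG less.prems by (simp add: in_hom_def add_assoc)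
    \<comment> \<open>Were \<open>J P\<close> the identity, \<open>P F = 0\<close> would give
      \<open>F = 0\<close> and the simple \<open>s\<close> would be a zero object. Hence the
      complement is a proper retract.\<close>
    have "J \<bullet> P \<noteq> ident C x"
    proof
      assume "J \<bullet> P = ident C x"
      then have "F = J \<bullet> P \<bullet> F" using s cmp_eq_assoc[of J P "ident C x" F] by (simp add: in_hom_def)
      also have "\<dots> = zero_arr C s x" using PF b sO by (simp add: in_hom_def)
      finally have "ident C s = zero_arr C s s" using s(3,4) sO by (simp add: in_hom_def)
      then show False using s(1) sO zero_object_iff[of s] unfolding simple_object_def by simp
    qed
    then obtain n t J' P' where t: "biprod C b n t J' P'" "\<forall>j<n. simple_object C (t j)"
      using less.hyps[OF dim_end_less[OF b(2,1,4)] bO] by blast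
    have JP': "in_hom C (J' j) (t j) b" "in_hom C (P' j) b (t j)" if "j < n" for j
      using t(1) that unfolding biprod_def by auto
    have tO: "t j \<in> Obj C" if "j < n" for j using JP'(1)[OF that] by (auto dest: in_homD)
    \<comment> \<open>The summands of the complement keep their indices below \<open>n\<close>, and
      \<open>s\<close> becomes summand number \<open>n\<close>.\<close>
    let ?J = "\<lambda>j. if j < n then J \<bullet> J' j else F" and ?P = "\<lambda>j. if j < n then P' j \<bullet> P else G"
    have "psum C x x (\<lambda>j. ?J j \<bullet> ?P j) n = psum C x x (\<lambda>j. J \<bullet> (J' j \<bullet> P' j) \<bullet> P) n"
      by (intro psum_cong) simp
    also have "\<dots> = J \<bullet> psum C x b (\<lambda>j. (J' j \<bullet> P' j) \<bullet> P) n"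
      using b(2) less.prems by (rule cmp_psum_right[symmetric])
    also have "psum C x b (\<lambda>j. (J' j \<bullet> P' j) \<bullet> P) n = psum C b b (\<lambda>j. J' j \<bullet> P' j) n \<bullet> P"
      using b(1) bO by (rule cmp_psum_left[symmetric])
    also have "\<dots> = P" using t(1) b(1) by (simp add: biprod_def in_hom_def)
    finally have sum': "psum C x x (\<lambda>j. ?J j \<bullet> ?P j) n = J \<bullet> P" .
    have "biprod C x (Suc n) (\<lambda>j. if j < n then t j else s) ?J ?P"
      unfolding biprod_def
    proof (intro conjI allI impI)
      fix j assume "j < Suc n"
      show "in_hom C (?J j) (if j < n then t j else s) x" using JP'[of j] b s by auto
      show "in_hom C (?P j) x (if j < n then t j else s)" using JP'[of j] b s by auto
    next
      fix j l assume jl: "j < Suc n" "l < Suc n"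
      have 1: "P' j \<bullet> J' l = (if j = l then ident C (t j) else zero_arr C (t l) (t j))" if "j < n" "l < n"
        using t(1) that unfolding biprod_def by blast
      show "?P j \<bullet> ?J l = (if j = l then ident C (if j < n then t j else s) else
        zero_arr C (if l < n then t l else s) (if j < n then t j else s))"
      proof (cases "j < n"; cases "l < n")
        assume "j < n" "l < n"
        then show ?thesis using 1 JP'[of j] JP'[of l] b PJ by (simp add: in_hom_def)
      next
        assume "j < n" "\<not> l < n"
        then show ?thesis using JP'[of j] b s PF sO by (simp add: in_hom_def)
      next
        assume "\<not> j < n" "l < n"
        then show ?thesis using JP'[of l] b s sO tO[of l] cmp_eq_assoc[OF GJ] by (simp add: in_hom_def)
      next
        assume "\<not> j < n" "\<not> l < n"
        then show ?thesis using jl s by simp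
      qed
    qed (use less.prems sum sum' in simp_all)
    moreover have "\<forall>j<Suc n. simple_object C (if j < n then t j else s)" using t(2) s(1) by simp
    ultimately show ?thesis by blast
  qed
qed

theorem regular_imp_semisimple:
  assumes reg: "regular_category C" and split: "split_idempotents C" and zero: "\<exists>z. zero_object C z"
    and bip: "\<And>a b. a \<in> Obj C \<Longrightarrow> b \<in> Obj C \<Longrightarrow>
      \<exists>x \<iota> \<pi>. is_biproduct C x 2 (\<lambda>j. if j = 0 then a else b) \<iota> \<pi>"
  shows "semisimple_category C"
  unfolding semisimple_category_def
  using regular_imp_abelian[OF assms] regular_decomposition[OF reg split] biprod_imp_is_biproduct
  by meson

end

section \<open>Tensor categories and duals\<close>

definition tensor_arr :: "('o, 'm, 'k, 'y) tensor_cat_scheme \<Rightarrow> ('o, 'm) arrow \<Rightarrow> ('o, 'm) arrow \<Rightarrow> ('o, 'm)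
    arrow"
    (infixr \<open>\<boxtimes>\<index>\<close> 70)
  where "tensor_arr C F G = (if arr C F \<and> arr C G
    then mk_arr (source F \<otimes>\<^sub>o\<^bsub>C\<^esub> source G) (under F \<otimes>\<^sub>m\<^bsub>C\<^esub> under G) (target F \<otimes>\<^sub>o\<^bsub>C\<^esub> target G) else None)"

definition alp :: "('o, 'm, 'k, 'y) tensor_cat_scheme \<Rightarrow> 'o \<Rightarrow> 'o \<Rightarrow> 'o \<Rightarrow> ('o, 'm) arrow"
  where "alp C a b c = mk_arr ((a \<otimes>\<^sub>o\<^bsub>C\<^esub> b) \<otimes>\<^sub>o\<^bsub>C\<^esub> c) (associator C a b c) (a \<otimes>\<^sub>o\<^bsub>C\<^esub> (b \<otimes>\<^sub>o\<^bsub>C\<^esub> c))"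

definition inv_arr :: "('o, 'm, 'k, 'y) linear_cat_scheme \<Rightarrow> ('o, 'm) arrow \<Rightarrow> ('o, 'm) arrow"
  where "inv_arr C F = mk_arr (target F) (inv_mor C (source F) (target F) (under F)) (source F)"

text \<open>Stated with \<open>associator_inv\<close>, the form in which duals and Frobenius
  structures refer to it; \<open>alpi_eq\<close> identifies it with the inverse of
  \<open>alp\<close>.\<close>

definition alpi :: "('o, 'm, 'k, 'y) tensor_cat_scheme \<Rightarrow> 'o \<Rightarrow> 'o \<Rightarrow> 'o \<Rightarrow> ('o, 'm) arrow"
  where "alpi C a b c = mk_arr (a \<otimes>\<^sub>o\<^bsub>C\<^esub> (b \<otimes>\<^sub>o\<^bsub>C\<^esub> c)) (associator_inv C a b c) ((a \<otimes>\<^sub>o\<^bsub>C\<^esub> b) \<otimes>\<^sub>o\<^bsub>C\<^esub> c)"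

definition lun :: "('o, 'm, 'k, 'y) tensor_cat_scheme \<Rightarrow> 'o \<Rightarrow> ('o, 'm) arrow"
  where "lun C a = mk_arr (\<I>\<^bsub>C\<^esub> \<otimes>\<^sub>o\<^bsub>C\<^esub> a) (lunitor C a) a"

definition run :: "('o, 'm, 'k, 'y) tensor_cat_scheme \<Rightarrow> 'o \<Rightarrow> ('o, 'm) arrow"
  where "run C a = mk_arr (a \<otimes>\<^sub>o\<^bsub>C\<^esub> \<I>\<^bsub>C\<^esub>) (runitor C a) a"

abbreviation luni where "luni C a \<equiv> inv_arr C (lun C a)"
abbreviation runi where "runi C a \<equiv> inv_arr C (run C a)"

context linear_category begin

lemma inverse_unique:
  assumes "in_hom C F a b" "in_hom C G b a" "in_hom C G' b a" "G \<bullet> F = ident C a" "F \<bullet> G' = ident C b"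
  shows "G = G'"
proof -
  have "G = G \<bullet> F \<bullet> G'" using assms(2,5) by (simp add: in_hom_def)
  also have "\<dots> = G'" using cmp_eq_assoc[OF assms(4)] assms(3) by (simp add: in_hom_def)
  finally show ?thesis .
qed

lemma inv_arr:
  assumes "iso_mor C a b f" "a \<in> Obj C" "b \<in> Obj C"
  shows "in_hom C (mk_arr a f b) a b" "in_hom C (inv_arr C (mk_arr a f b)) b a"
    "inv_arr C (mk_arr a f b) \<bullet> mk_arr a f b = ident C a" "mk_arr a f b \<bullet> inv_arr C (mk_arr a f b)
        = ident C b"
proof -
  have inverse: "in_hom C (mk_arr b g a) b a \<and> mk_arr b g a \<bullet> mk_arr a f b = ident C a \<and> mk_arr a f b
      \<bullet> mk_arr b g a = ident C b \<and> in_hom C (mk_arr a f b) a b"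
    if "inverse_mor C a b f g" for g
    using that assms(2,3) unfolding inverse_mor_def by (simp add: ident_def)
  obtain g where g: "inverse_mor C a b f g" using assms unfolding iso_mor_def by blast
  have "inv_mor C a b f = g" unfolding inv_mor_def
  proof (rule the_equality)
    fix h assume h: "inverse_mor C a b f h"
    have "mk_arr b h a = mk_arr b g a" using inverse[OF g] inverse[OF h]
      by (metis inverse_unique)
    then show "h = g" by simp
  qed (rule g)
  then have "inv_arr C (mk_arr a f b) = mk_arr b g a" by (simp add: inv_arr_def)
  then show "in_hom C (mk_arr a f b) a b" "in_hom C (inv_arr C (mk_arr a f b)) b a"
    "inv_arr C (mk_arr a f b) \<bullet> mk_arr a f b = ident C a" "mk_arr a f b \<bullet> inv_arr C (mk_arr a f b)
        = ident C b"
    using inverse[OF g] by simp_all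
qed

lemma cancel_right:
  assumes "F \<bullet> X = G \<bullet> X" "X \<bullet> Y = ident C b" "arr C F" "arr C G" "source F = b" "source G = b"
  shows "F = G"
proof -
  have "F \<bullet> X \<bullet> Y = G \<bullet> X \<bullet> Y" using cmp_eq_assoc[OF assms(1), of Y] by simp
  then show ?thesis unfolding assms(2) using assms by simp
qed

lemma cancel_left:
  assumes "X \<bullet> F = X \<bullet> G" "Y \<bullet> X = ident C b" "arr C F" "arr C G" "target F = b" "target G = b"
  shows "F = G"
proof -
  have "ident C b \<bullet> F = ident C b \<bullet> G"
    using cmp_eq_assoc[OF assms(2), of F] cmp_eq_assoc[OF assms(2), of G] unfolding assms(1) by simp
  then show ?thesis using assms(3-) by simp
qed

end

section \<open>The tensor product on arrows, coherence of units, and duals\<close>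

context tensor_category begin

declare tobj_closed [simp] unit_closed [simp]

lemma arr_tns [simp]: "arr C (F \<boxtimes> G) \<longleftrightarrow> arr C F \<and> arr C G"
  using tmor_mor[of "source F" "target F" "source G" "target G" "under F"
      "under G"] arr_und[of C F] arr_und[of C G]
  by (auto simp: tensor_arr_def)

lemma tns_sel [simp]:
  "arr C F \<Longrightarrow> arr C G \<Longrightarrow> source (F \<boxtimes> G) = source F \<otimes>\<^sub>o source G"
  "arr C F \<Longrightarrow> arr C G \<Longrightarrow> target (F \<boxtimes> G) = target F \<otimes>\<^sub>o target G"
  "arr C F \<Longrightarrow> arr C G \<Longrightarrow> under (F \<boxtimes> G) = under F \<otimes>\<^sub>m under G"
  by (auto simp: tensor_arr_def)

lemma mk_tns [simp]:
  "\<lbrakk>a \<in> Obj C; b \<in> Obj C; c \<in> Obj C; d \<in> Obj C; f \<in> mor C a b; g \<in> mor C c d\<rbrakk>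
    \<Longrightarrow> mk_arr a f b \<boxtimes> mk_arr c g d = mk_arr (a \<otimes>\<^sub>o c) (f \<otimes>\<^sub>m g) (b \<otimes>\<^sub>o d)"
  by (simp add: tensor_arr_def)

lemma tns_ident [simp]: "a \<in> Obj C \<Longrightarrow> b \<in> Obj C \<Longrightarrow> ident C a \<boxtimes> ident C b = ident C (a \<otimes>\<^sub>o b)"
  by (simp add: ident_def id_mor tmor_id)

lemma tns_cmp [simp]:
  assumes "arr C F" "arr C G" "arr C F'" "arr C G'" "target F = source G" "target F' = source G'"
  shows "(G \<boxtimes> G') \<bullet> (F \<boxtimes> F') = (G \<bullet> F) \<boxtimes> (G' \<bullet> F')"
  using assms tmor_comp[of "source F" "target F" "target G" "source F'" "target F'" "target G'" "under F"
      "under G" "under F'" "under G'"]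
    arr_und[of C F] arr_und[of C G] arr_und[of C F'] arr_und[of C G']
  by (intro arr_eqI[of C]) auto

lemma tns_cmp_assoc [simp]:
  assumes "arr C F" "arr C G" "arr C F'" "arr C G'" "target F = source G" "target F' = source G'"
  shows "(G \<boxtimes> G') \<bullet> (F \<boxtimes> F') \<bullet> X = ((G \<bullet> F) \<boxtimes> (G' \<bullet> F')) \<bullet> X"
  using tns_cmp[OF assms] by (metis cmp_assoc)

text \<open>The interchange law as a rewrite rule fuses adjacent tensor products. Steps that need
  naturality of an associator or unitor switch it off, so that the factor to be moved stays
  visible.\<close>

lemmas merge = tns_cmp tns_cmp_assoc

lemma tns_mod_hom:
  "\<lbrakk>a \<in> Obj C; b \<in> Obj C; c \<in> Obj C; d \<in> Obj C; g \<in> mor C c d\<rbrakk>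
    \<Longrightarrow> mod_hom K (Hom C a b) (Hom C (a \<otimes>\<^sub>o c) (b \<otimes>\<^sub>o d)) (\<lambda>f. f \<otimes>\<^sub>m g)"
  "\<lbrakk>a \<in> Obj C; b \<in> Obj C; c \<in> Obj C; d \<in> Obj C; f \<in> mor C a b\<rbrakk>
    \<Longrightarrow> mod_hom K (Hom C c d) (Hom C (a \<otimes>\<^sub>o c) (b \<otimes>\<^sub>o d)) (\<lambda>g. f \<otimes>\<^sub>m g)"
  by (simp_all add: mod_hom_def mod_hom_axioms_def hom_module tmor_linear_left tmor_linear_right)

lemma tns_add_left:
  assumes "arr C G" "arr C F" "arr C F'" "source F = source F'" "target F = target F'"
  shows "(F \<boxplus> F') \<boxtimes> G = F \<boxtimes> G \<boxplus> F' \<boxtimes> G"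
proof -
  interpret mod_hom K "Hom C (source F) (target F)" "Hom C (source F \<otimes>\<^sub>o source G) (target F \<otimes>\<^sub>o target G)"
      "\<lambda>f. f \<otimes>\<^sub>m under G"
    using assms arr_und[of C G] by (intro tns_mod_hom) auto
  show ?thesis using assms arr_und[of C F] arr_und[of C F'] f_add[of "under F" "under F'"]
    by (intro arr_eqI[of C]) auto
qed

lemma tns_add_right:
  assumes "arr C G" "arr C F" "arr C F'" "source F = source F'" "target F = target F'"
  shows "G \<boxtimes> (F \<boxplus> F') = G \<boxtimes> F \<boxplus> G \<boxtimes> F'"
proof -
  interpret mod_hom K "Hom C (source F) (target F)" "Hom C (source G \<otimes>\<^sub>o source F) (target G \<otimes>\<^sub>o target F)"
      "\<lambda>f. under G \<otimes>\<^sub>m f"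
    using assms arr_und[of C G] by (intro tns_mod_hom) auto
  show ?thesis using assms arr_und[of C F] arr_und[of C F'] f_add[of "under F" "under F'"]
    by (intro arr_eqI[of C]) auto
qed

lemma tns_zer_left [simp]:
  assumes "arr C G" "a \<in> Obj C" "b \<in> Obj C"
  shows "zero_arr C a b \<boxtimes> G = zero_arr C (a \<otimes>\<^sub>o source G) (b \<otimes>\<^sub>o target G)"
proof -
  interpret mod_hom K "Hom C a b" "Hom C (a \<otimes>\<^sub>o source G) (b \<otimes>\<^sub>o target G)" "\<lambda>f. f \<otimes>\<^sub>m under G"
    using assms arr_und[of C G] by (intro tns_mod_hom) auto
  show ?thesis using assms by (intro arr_eqI[of C]) auto
qed

lemma alp_in_hom: "\<lbrakk>a \<in> Obj C; b \<in> Obj C; c \<in> Obj C\<rbrakk> \<Longrightarrow> in_hom C (alp C a b c) ((a \<otimes>\<^sub>o b) \<otimes>\<^sub>o c) (a \<otimes>\<^sub>o (b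
    \<otimes>\<^sub>o c))"
  unfolding alp_def by (intro inv_arr associator_iso) auto

lemma alpi_eq: "alpi C a b c = inv_arr C (alp C a b c)"
  by (simp add: alpi_def inv_arr_def alp_def associator_inv_def)

lemma alpi_in_hom: "\<lbrakk>a \<in> Obj C; b \<in> Obj C; c \<in> Obj C\<rbrakk> \<Longrightarrow> in_hom C (alpi C a b c) (a \<otimes>\<^sub>o (b \<otimes>\<^sub>o c)) ((a \<otimes>\<^sub>o b)
    \<otimes>\<^sub>o c)"
  unfolding alpi_eq alp_def by (intro inv_arr associator_iso) auto

lemma lun_in_hom: "a \<in> Obj C \<Longrightarrow> in_hom C (lun C a) (\<I> \<otimes>\<^sub>o a) a"
  unfolding lun_def by (intro inv_arr lunitor_iso) auto

lemma luni_in_hom: "a \<in> Obj C \<Longrightarrow> in_hom C (luni C a) a (\<I> \<otimes>\<^sub>o a)"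
  unfolding lun_def by (intro inv_arr lunitor_iso) auto

lemma run_in_hom: "a \<in> Obj C \<Longrightarrow> in_hom C (run C a) (a \<otimes>\<^sub>o \<I>) a"
  unfolding run_def by (intro inv_arr runitor_iso) auto

lemma runi_in_hom: "a \<in> Obj C \<Longrightarrow> in_hom C (runi C a) a (a \<otimes>\<^sub>o \<I>)"
  unfolding run_def by (intro inv_arr runitor_iso) auto

lemma structural_sel [simp]:
  "source (alp C a b c) = (a \<otimes>\<^sub>o b) \<otimes>\<^sub>o c" "target (alp C a b c) = a \<otimes>\<^sub>o (b \<otimes>\<^sub>o c)"
  "source (alpi C a b c) = a \<otimes>\<^sub>o (b \<otimes>\<^sub>o c)" "target (alpi C a b c) = (a \<otimes>\<^sub>o b) \<otimes>\<^sub>o c"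
  "source (lun C a) = \<I> \<otimes>\<^sub>o a" "target (lun C a) = a" "source (run C a) = a \<otimes>\<^sub>o \<I>" "target (run C a) = a"
  "source (luni C a) = a" "target (luni C a) = \<I> \<otimes>\<^sub>o a" "source (runi C a) = a" "target (runi C a)
      = a \<otimes>\<^sub>o \<I>"
  "under (alp C a b c) = associator C a b c" "under (alpi C a b c) = associator_inv C a b c"
  "under (lun C a) = lunitor C a" "under (run C a) = runitor C a"
  by (simp_all add: alp_def alpi_def lun_def run_def inv_arr_def)

lemma structural_arr [simp]:
  "\<lbrakk>a \<in> Obj C; b \<in> Obj C; c \<in> Obj C\<rbrakk> \<Longrightarrow> arr C (alp C a b c)"
  "\<lbrakk>a \<in> Obj C; b \<in> Obj C; c \<in> Obj C\<rbrakk> \<Longrightarrow> arr C (alpi C a b c)"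
  "a \<in> Obj C \<Longrightarrow> arr C (lun C a)" "a \<in> Obj C \<Longrightarrow> arr C (run C a)"
  "a \<in> Obj C \<Longrightarrow> arr C (luni C a)" "a \<in> Obj C \<Longrightarrow> arr C (runi C a)"
  using alp_in_hom alpi_in_hom lun_in_hom luni_in_hom run_in_hom runi_in_hom by (auto simp: in_hom_def)

lemma alp_inv [simp]:
  assumes "a \<in> Obj C" "b \<in> Obj C" "c \<in> Obj C"
  shows "alp C a b c \<bullet> alpi C a b c = ident C (a \<otimes>\<^sub>o (b \<otimes>\<^sub>o c))"
    "alpi C a b c \<bullet> alp C a b c = ident C ((a \<otimes>\<^sub>o b) \<otimes>\<^sub>o c)"
  using inv_arr[OF associator_iso[OF assms]] assms unfolding alpi_eq alp_def by auto

lemma lun_inv [simp]: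
  assumes "a \<in> Obj C"
  shows "lun C a \<bullet> luni C a = ident C a" "luni C a \<bullet> lun C a = ident C (\<I> \<otimes>\<^sub>o a)"
  using inv_arr[OF lunitor_iso[OF assms]] assms unfolding lun_def by auto

lemma run_inv [simp]:
  assumes "a \<in> Obj C"
  shows "run C a \<bullet> runi C a = ident C a" "runi C a \<bullet> run C a = ident C (a \<otimes>\<^sub>o \<I>)"
  using inv_arr[OF runitor_iso[OF assms]] assms unfolding run_def by auto

lemma structural_inv_assoc [simp]:
  "\<lbrakk>a \<in> Obj C; b \<in> Obj C; c \<in> Obj C; arr C X; target X = a \<otimes>\<^sub>o (b \<otimes>\<^sub>o c)\<rbrakk> \<Longrightarrow> alp C a b c \<bullet> alpi C a b c \<bullet> X
      = X"
  "\<lbrakk>a \<in> Obj C; b \<in> Obj C; c \<in> Obj C; arr C X; target X = (a \<otimes>\<^sub>o b) \<otimes>\<^sub>o c\<rbrakk> \<Longrightarrow> alpi C a b c \<bullet> alp C a b c \<bullet> X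
      = X"
  "\<lbrakk>a \<in> Obj C; arr C X; target X = a\<rbrakk> \<Longrightarrow> lun C a \<bullet> luni C a \<bullet> X = X"
  "\<lbrakk>a \<in> Obj C; arr C X; target X = \<I> \<otimes>\<^sub>o a\<rbrakk> \<Longrightarrow> luni C a \<bullet> lun C a \<bullet> X = X"
  "\<lbrakk>a \<in> Obj C; arr C X; target X = a\<rbrakk> \<Longrightarrow> run C a \<bullet> runi C a \<bullet> X = X"
  "\<lbrakk>a \<in> Obj C; arr C X; target X = a \<otimes>\<^sub>o \<I>\<rbrakk> \<Longrightarrow> runi C a \<bullet> run C a \<bullet> X = X"
  by (simp_all add: cmp_eq_assoc[OF alp_inv(1)] cmp_eq_assoc[OF alp_inv(2)] cmp_eq_assoc[OF lun_inv(1)]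
      cmp_eq_assoc[OF lun_inv(2)] cmp_eq_assoc[OF run_inv(1)] cmp_eq_assoc[OF run_inv(2)])

lemma alp_natural:
  assumes "arr C F" "arr C G" "arr C H"
  shows "alp C (target F) (target G) (target H) \<bullet> ((F \<boxtimes> G) \<boxtimes> H) = (F \<boxtimes> (G \<boxtimes> H))
      \<bullet> alp C (source F) (source G) (source H)"
  using assms associator_natural[of "source F" "source G" "source H" "target F" "target G" "target H"
      "under F" "under G" "under H"]
    arr_und[of C F] arr_und[of C G] arr_und[of C H]
  by (intro arr_eqI[of C]) auto

lemma alpi_natural:
  assumes "arr C F" "arr C G" "arr C H"
  shows "alpi C (target F) (target G) (target H) \<bullet> (F \<boxtimes> (G \<boxtimes> H)) = ((F \<boxtimes> G) \<boxtimes> H)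
      \<bullet> alpi C (source F) (source G) (source H)"
proof -
  let ?B = "alpi C (target F) (target G) (target H)" and ?A = "alp C (source F) (source G) (source H)"
      and ?A' = "alpi C (source F) (source G) (source H)"
  have "?B \<bullet> (F \<boxtimes> (G \<boxtimes> H)) = ?B \<bullet> ((F \<boxtimes> (G \<boxtimes> H)) \<bullet> ?A) \<bullet> ?A'"
    using assms by simp
  also have "\<dots> = ((F \<boxtimes> G) \<boxtimes> H) \<bullet> ?A'" unfolding alp_natural[OF assms, symmetric] using assms by simp
  finally show ?thesis .
qed

lemma lun_natural: "arr C F \<Longrightarrow> lun C (target F) \<bullet> (ident C \<I> \<boxtimes> F) = F \<bullet> lun C (source F)"
  using lunitor_natural[of "source F" "target F" "under F"] arr_und[of C F]
  by (intro arr_eqI[of C]) auto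

lemma run_natural: "arr C F \<Longrightarrow> run C (target F) \<bullet> (F \<boxtimes> ident C \<I>) = F \<bullet> run C (source F)"
  using runitor_natural[of "source F" "target F" "under F"] arr_und[of C F]
  by (intro arr_eqI[of C]) auto

lemma luni_natural: "arr C F \<Longrightarrow> luni C (target F) \<bullet> F = (ident C \<I> \<boxtimes> F) \<bullet> luni C (source F)"
  by (rule cancel_left[of "lun C (target F)" _ _ "luni C (target F)" "\<I> \<otimes>\<^sub>o target F"])
    (auto simp: cmp_eq_assoc[OF lun_natural])

lemma runi_natural: "arr C F \<Longrightarrow> runi C (target F) \<bullet> F = (F \<boxtimes> ident C \<I>) \<bullet> runi C (source F)"
  by (rule cancel_left[of "run C (target F)" _ _ "runi C (target F)" "target F \<otimes>\<^sub>o \<I>"])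
    (auto simp: cmp_eq_assoc[OF run_natural])

lemma triangle_arr: "a \<in> Obj C \<Longrightarrow> b \<in> Obj C \<Longrightarrow>
    (ident C a \<boxtimes> lun C b) \<bullet> alp C a \<I> b = run C a \<boxtimes> ident C b"
  using triangle[of a b]
  by (intro arr_eqI[of C]) auto

lemma pentagon_arr:
  assumes "a \<in> Obj C" "b \<in> Obj C" "c \<in> Obj C" "d \<in> Obj C"
  shows "(ident C a \<boxtimes> alp C b c d) \<bullet> alp C a (b \<otimes>\<^sub>o c) d \<bullet> (alp C a b c \<boxtimes> ident C d)
    = alp C a b (c \<otimes>\<^sub>o d) \<bullet> alp C (a \<otimes>\<^sub>o b) c d"
proof -
  have "((ident C a \<boxtimes> alp C b c d) \<bullet> alp C a (b \<otimes>\<^sub>o c) d) \<bullet> (alp C a b c \<boxtimes> ident C d)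
    = alp C a b (c \<otimes>\<^sub>o d) \<bullet> alp C (a \<otimes>\<^sub>o b) c d"
    using pentagon[OF assms] assms
    by (intro arr_eqI[of C]) (auto simp del: cmp_assoc)
  then show ?thesis by simp
qed

text \<open>Through \<open>lun\<close>, tensoring with the unit is naturally isomorphic to the
  identity functor. Coherence identities may therefore be checked after tensoring with the unit,
  where pentagon and triangle become available.\<close>

lemma tns_unit_faithful_left:
  assumes "arr C F" "arr C G" "source F = source G" "target F = target G" "ident C \<I> \<boxtimes> F = ident C \<I> \<boxtimes> G"
  shows "F = G"
  using lun_natural[of F] lun_natural[of G] assms
  by - (rule cancel_right[of F "lun C (source F)" G "luni C (source F)" "source F"], auto)

lemma tns_unit_faithful_right:
  assumes "arr C F" "arr C G" "source F = source G" "target F = target G" "F \<boxtimes> ident C \<I> = G \<boxtimes> ident C \<I>"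
  shows "F = G"
  using run_natural[of F] run_natural[of G] assms
  by - (rule cancel_right[of F "run C (source F)" G "runi C (source F)" "source F"], auto)

text \<open>Kelly's argument: after tensoring with the unit on the left and composing with the
  invertible \<open>?X\<close>, pentagon, triangle and naturality identify both sides.\<close>

lemma lun_tensor:
  assumes [simp]: "a \<in> Obj C" "b \<in> Obj C"
  shows "lun C (a \<otimes>\<^sub>o b) \<bullet> alp C \<I> a b = lun C a \<boxtimes> ident C b"
proof (rule tns_unit_faithful_left)
  let ?i = "ident C \<I>"
  let ?X = "alp C \<I> (\<I> \<otimes>\<^sub>o a) b \<bullet> (alp C \<I> \<I> a \<boxtimes> ident C b)"
  let ?Y = "(alpi C \<I> \<I> a \<boxtimes> ident C b) \<bullet> alpi C \<I> (\<I> \<otimes>\<^sub>o a) b"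
  have "(?i \<boxtimes> (lun C (a \<otimes>\<^sub>o b) \<bullet> alp C \<I> a b)) \<bullet> ?X
      = (?i \<boxtimes> lun C (a \<otimes>\<^sub>o b)) \<bullet> (?i \<boxtimes> alp C \<I> a b) \<bullet> alp C \<I> (\<I> \<otimes>\<^sub>o a) b \<bullet> (alp C \<I> \<I> a \<boxtimes> ident C b)"
    by simp
  also have "\<dots> = (?i \<boxtimes> lun C (a \<otimes>\<^sub>o b)) \<bullet> alp C \<I> \<I> (a \<otimes>\<^sub>o b) \<bullet> alp C (\<I> \<otimes>\<^sub>o \<I>) a b"
    by (subst pentagon_arr) simp_all
  also have "\<dots> = (run C \<I> \<boxtimes> (ident C a \<boxtimes> ident C b)) \<bullet> alp C (\<I> \<otimes>\<^sub>o \<I>) a b"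
    by (simp add: cmp_eq_assoc[OF triangle_arr])
  also have "\<dots> = alp C \<I> a b \<bullet> ((run C \<I> \<boxtimes> ident C a) \<boxtimes> ident C b)"
    using alp_natural[of "run C \<I>" "ident C a" "ident C b"] by simp
  also have "\<dots> = alp C \<I> a b \<bullet> ((?i \<boxtimes> lun C a) \<boxtimes> ident C b) \<bullet> (alp C \<I> \<I> a \<boxtimes> ident C b)"
    by (simp add: triangle_arr)
  also have "\<dots> = (?i \<boxtimes> (lun C a \<boxtimes> ident C b)) \<bullet> ?X"
    using cmp_eq_assoc[OF alp_natural[of ?i "lun C a" "ident C b"]] by (simp del: merge)
  finally show "?i \<boxtimes> (lun C (a \<otimes>\<^sub>o b) \<bullet> alp C \<I> a b) = ?i \<boxtimes> (lun C a \<boxtimes> ident C b)"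
    by (rule cancel_right[of _ ?X _ ?Y "\<I> \<otimes>\<^sub>o ((\<I> \<otimes>\<^sub>o a) \<otimes>\<^sub>o b)"]) simp_all
qed simp_all

text \<open>Mirror image of \<open>lun_tensor\<close>: the extra unit is on the right, and
  \<open>alp C a b \<I>\<close> is cancelled at the end.\<close>

lemma run_tensor:
  assumes [simp]: "a \<in> Obj C" "b \<in> Obj C"
  shows "(ident C a \<boxtimes> run C b) \<bullet> alp C a b \<I> = run C (a \<otimes>\<^sub>o b)"
proof (rule tns_unit_faithful_right)
  let ?i = "ident C \<I>"
  have "alp C a b \<I> \<bullet> (((ident C a \<boxtimes> run C b) \<bullet> alp C a b \<I>) \<boxtimes> ?i)
    = alp C a b \<I> \<bullet> ((ident C a \<boxtimes> run C b) \<boxtimes> ?i) \<bullet> (alp C a b \<I> \<boxtimes> ?i)"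
    by simp
  also have "\<dots> = (ident C a \<boxtimes> (run C b \<boxtimes> ?i)) \<bullet> alp C a (b \<otimes>\<^sub>o \<I>) \<I> \<bullet> (alp C a b \<I> \<boxtimes> ?i)"
    using cmp_eq_assoc[OF alp_natural[of "ident C a" "run C b" ?i]] by (simp del: merge)
  also have "\<dots> = (ident C a \<boxtimes> (ident C b \<boxtimes> lun C \<I>)) \<bullet> (ident C a \<boxtimes> alp C b \<I> \<I>) \<bullet> alp C a (b \<otimes>\<^sub>o \<I>) \<I>
      \<bullet> (alp C a b \<I> \<boxtimes> ?i)"
    by (simp add: triangle_arr)
  also have "\<dots> = (ident C a \<boxtimes> (ident C b \<boxtimes> lun C \<I>)) \<bullet> alp C a b (\<I> \<otimes>\<^sub>o \<I>) \<bullet> alp C (a \<otimes>\<^sub>o b) \<I> \<I>"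
    by (subst pentagon_arr) simp_all
  also have "\<dots> = alp C a b \<I> \<bullet> ((ident C a \<boxtimes> ident C b) \<boxtimes> lun C \<I>) \<bullet> alp C (a \<otimes>\<^sub>o b) \<I> \<I>"
    using cmp_eq_assoc[OF alp_natural[of "ident C a" "ident C b" "lun C \<I>"]] by (simp del: merge)
  also have "\<dots> = alp C a b \<I> \<bullet> (run C (a \<otimes>\<^sub>o b) \<boxtimes> ?i)"
    by (simp add: triangle_arr)
  finally show "((ident C a \<boxtimes> run C b) \<bullet> alp C a b \<I>) \<boxtimes> ?i = run C (a \<otimes>\<^sub>o b) \<boxtimes> ?i"
    by (rule cancel_left[of "alp C a b \<I>" _ _ "alpi C a b \<I>" "(a \<otimes>\<^sub>o b) \<otimes>\<^sub>o \<I>"]) simp_all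
qed simp_all

text \<open>Naturality of \<open>lun\<close> at \<open>lun C \<I>\<close> itself computes the unitor
  of the square of the unit; \<open>lun_tensor\<close> and the triangle then compare both unitors
  after tensoring with the unit.\<close>

lemma lun_unit_eq_run_unit: "lun C \<I> = run C \<I>"
proof (rule tns_unit_faithful_right)
  have "lun C (\<I> \<otimes>\<^sub>o \<I>) = ident C \<I> \<boxtimes> lun C \<I>"
    using lun_natural[of "lun C \<I>"]
    by - (rule cancel_left[of "lun C \<I>" _ _ "luni C \<I>" "\<I> \<otimes>\<^sub>o \<I>"], simp_all)
  then show "lun C \<I> \<boxtimes> ident C \<I> = run C \<I> \<boxtimes> ident C \<I>"
    using lun_tensor[of \<I> \<I>] triangle_arr[of \<I> \<I>] by simp
qed simp_all

text \<open>This and its variants are the pentagon with some edges inverted, one for each pattern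
  met when an arrow is transposed along a dual.\<close>

lemma pentagon_alpi_left:
  assumes [simp]: "a \<in> Obj C" "b \<in> Obj C" "c \<in> Obj C" "d \<in> Obj C"
  shows "(ident C a \<boxtimes> alpi C b c d) \<bullet> alp C a b (c \<otimes>\<^sub>o d)
    = alp C a (b \<otimes>\<^sub>o c) d \<bullet> (alp C a b c \<boxtimes> ident C d) \<bullet> alpi C (a \<otimes>\<^sub>o b) c d"
proof -
  have "(ident C a \<boxtimes> alpi C b c d) \<bullet> alp C a b (c \<otimes>\<^sub>o d)
    = (ident C a \<boxtimes> alpi C b c d) \<bullet> (alp C a b (c \<otimes>\<^sub>o d) \<bullet> alp C (a \<otimes>\<^sub>o b) c d) \<bullet> alpi C (a \<otimes>\<^sub>o b) c d"
    by simp
  also have "\<dots> = alp C a (b \<otimes>\<^sub>o c) d \<bullet> (alp C a b c \<boxtimes> ident C d) \<bullet> alpi C (a \<otimes>\<^sub>o b) c d"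
    unfolding pentagon_arr[symmetric, OF assms] by simp
  finally show ?thesis .
qed

lemma pentagon_alpi_right:
  assumes [simp]: "a \<in> Obj C" "b \<in> Obj C" "c \<in> Obj C" "d \<in> Obj C"
  shows "alpi C a b (c \<otimes>\<^sub>o d) \<bullet> (ident C a \<boxtimes> alp C b c d)
    = alp C (a \<otimes>\<^sub>o b) c d \<bullet> (alpi C a b c \<boxtimes> ident C d) \<bullet> alpi C a (b \<otimes>\<^sub>o c) d"
proof -
  have "alpi C a b (c \<otimes>\<^sub>o d) \<bullet> (ident C a \<boxtimes> alp C b c d)
    = alpi C a b (c \<otimes>\<^sub>o d) \<bullet> ((ident C a \<boxtimes> alp C b c d) \<bullet> alp C a (b \<otimes>\<^sub>o c) d \<bullet> (alp C a b c \<boxtimes> ident C d))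
      \<bullet> (alpi C a b c \<boxtimes> ident C d) \<bullet> alpi C a (b \<otimes>\<^sub>o c) d"
    by simp
  also have "\<dots> = alp C (a \<otimes>\<^sub>o b) c d \<bullet> (alpi C a b c \<boxtimes> ident C d) \<bullet> alpi C a (b \<otimes>\<^sub>o c) d"
    unfolding pentagon_arr[OF assms] by simp
  finally show ?thesis .
qed

text \<open>Transposition of \<open>F : X -> a \<otimes> Y\<close> along
  \<open>ev : d \<otimes> a -> 1\<close> to an arrow \<open>d \<otimes> X -> Y\<close>. The pairing
  is a parameter, so the pairing \<open>E \<bullet> Mu\<close> of an algebra with itself can take
  the place of an evaluation.\<close>

definition hat :: "'o \<Rightarrow> 'o \<Rightarrow> ('o, 'm) arrow \<Rightarrow> 'o \<Rightarrow> ('o, 'm) arrow \<Rightarrow> ('o, 'm) arrow"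
  where "hat a d ev Y F = lun C Y \<bullet> (ev \<boxtimes> ident C Y) \<bullet> alpi C d a Y \<bullet> (ident C d \<boxtimes> F)"

definition unhat :: "'o \<Rightarrow> 'o \<Rightarrow> ('o, 'm) arrow \<Rightarrow> 'o \<Rightarrow> ('o, 'm) arrow \<Rightarrow> ('o, 'm) arrow"
  where "unhat a d cv X F = (ident C a \<boxtimes> F) \<bullet> alp C a d X \<bullet> (cv \<boxtimes> ident C X) \<bullet> luni C X"

text \<open>The two zig-zags are kept apart: the one at \<open>a\<close> makes \<open>hat\<close>
  injective and is the one transported along the tensor functor, while \<open>zigzag_dual\<close>
  supplies surjectivity.\<close>

definition zigzag_obj :: "'o \<Rightarrow> 'o \<Rightarrow> ('o, 'm) arrow \<Rightarrow> ('o, 'm) arrow \<Rightarrow> bool"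
  where "zigzag_obj a d cv ev \<longleftrightarrow> a \<in> Obj C \<and> d \<in> Obj C \<and> in_hom C cv \<I> (a \<otimes>\<^sub>o d) \<and> in_hom C ev (d \<otimes>\<^sub>o a) \<I> \<and>
    run C a \<bullet> (ident C a \<boxtimes> ev) \<bullet> alp C a d a \<bullet> (cv \<boxtimes> ident C a) = lun C a"

definition zigzag_dual :: "'o \<Rightarrow> 'o \<Rightarrow> ('o, 'm) arrow \<Rightarrow> ('o, 'm) arrow \<Rightarrow> bool"
  where "zigzag_dual a d cv ev \<longleftrightarrow>
    lun C d \<bullet> (ev \<boxtimes> ident C d) \<bullet> alpi C d a d \<bullet> (ident C d \<boxtimes> cv) = run C d"

lemma is_dualE:
  assumes "is_dual C a d" "a \<in> Obj C"
  obtains cv ev where "zigzag_obj a d cv ev" "zigzag_dual a d cv ev"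
proof -
  obtain coev ev where *: "coev \<in> mor C \<I> (a \<otimes>\<^sub>o d)" "ev \<in> mor C (d \<otimes>\<^sub>o a) \<I>" "d \<in> Obj C"
    and z1: "runitor C a \<cdot> (Id C a \<otimes>\<^sub>m ev) \<cdot> associator C a d a \<cdot> (coev \<otimes>\<^sub>m Id C a) = lunitor C a"
    and z2: "lunitor C d \<cdot> (ev \<otimes>\<^sub>m Id C d) \<cdot> associator_inv C d a d \<cdot> (Id C d \<otimes>\<^sub>m coev) = runitor C d"
    using assms unfolding is_dual_def by blast
  let ?cv = "mk_arr \<I> coev (a \<otimes>\<^sub>o d)" and ?ev = "mk_arr (d \<otimes>\<^sub>o a) ev \<I>"
  have ar: "arr C ?cv" "arr C ?ev" using * assms by simp_all
  have "((run C a \<bullet> (ident C a \<boxtimes> ?ev)) \<bullet> alp C a d a) \<bullet> (?cv \<boxtimes> ident C a) = lun C a"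
    using z1 * assms ar by (intro arr_eqI[of C]) (simp_all del: cmp_assoc)
  moreover have "((lun C d \<bullet> (?ev \<boxtimes> ident C d)) \<bullet> alpi C d a d) \<bullet> (ident C d \<boxtimes> ?cv) = run C d"
    using z2 * assms ar by (intro arr_eqI[of C]) (simp_all del: cmp_assoc)
  ultimately show thesis using that[of ?cv ?ev] * assms ar
    unfolding zigzag_obj_def zigzag_dual_def by simp
qed

lemma hat_in_hom:
  assumes "zigzag_obj a d cv ev" "in_hom C F X (a \<otimes>\<^sub>o Y)" "Y \<in> Obj C"
  shows "in_hom C (hat a d ev Y F) (d \<otimes>\<^sub>o X) Y"
  using assms by (simp add: zigzag_obj_def hat_def in_hom_def)

lemma unhat_in_hom:
  assumes "zigzag_obj a d cv ev" "in_hom C F (d \<otimes>\<^sub>o X) Y" "X \<in> Obj C"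
  shows "in_hom C (unhat a d cv X F) X (a \<otimes>\<^sub>o Y)"
  using assms by (simp add: zigzag_obj_def unhat_def in_hom_def)

text \<open>Naturality slides \<open>F\<close> to the far right; what is left is the zig-zag at
  \<open>a\<close> tensored with \<open>Y\<close>.\<close>

lemma unhat_hat:
  assumes z: "zigzag_obj a d cv ev" and F: "in_hom C F X (a \<otimes>\<^sub>o Y)" and Y [simp]: "Y \<in> Obj C"
  shows "unhat a d cv X (hat a d ev Y F) = F"
proof -
  have [simp]: "a \<in> Obj C" "d \<in> Obj C" and cv: "in_hom C cv \<I> (a \<otimes>\<^sub>o d)" and ev: "in_hom C ev (d \<otimes>\<^sub>o a) \<I>"
    and z1: "run C a \<bullet> (ident C a \<boxtimes> ev) \<bullet> alp C a d a \<bullet> (cv \<boxtimes> ident C a) = lun C a"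
    using z by (auto simp: zigzag_obj_def)
  note [simp] = in_homD(1-5)[OF cv] in_homD(1-5)[OF ev] in_homD(1-5)[OF F]
  let ?a = "ident C a" and ?Y = "ident C Y" and ?aY = "a \<otimes>\<^sub>o Y"
  have "unhat a d cv X (hat a d ev Y F)
      = (?a \<boxtimes> lun C Y) \<bullet> (?a \<boxtimes> (ev \<boxtimes> ?Y)) \<bullet> (?a \<boxtimes> alpi C d a Y) \<bullet> (?a \<boxtimes> (ident C d \<boxtimes> F)) \<bullet> alp C a d X
          \<bullet> (cv \<boxtimes> ident C X) \<bullet> luni C X"
    by (simp add: unhat_def hat_def)
  also have "\<dots> = (?a \<boxtimes> lun C Y) \<bullet> (?a \<boxtimes> (ev \<boxtimes> ?Y)) \<bullet> (?a \<boxtimes> alpi C d a Y) \<bullet> alp C a d ?aY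
      \<bullet> ((?a \<boxtimes> ident C d) \<boxtimes> F) \<bullet> (cv \<boxtimes> ident C X) \<bullet> luni C X"
    using cmp_eq_assoc[OF alp_natural[of ?a "ident C d" F]] by (simp del: merge tns_ident)
  also have "\<dots> = (?a \<boxtimes> lun C Y) \<bullet> (?a \<boxtimes> (ev \<boxtimes> ?Y)) \<bullet> ((?a \<boxtimes> alpi C d a Y) \<bullet> alp C a d ?aY)
      \<bullet> (cv \<boxtimes> ident C ?aY) \<bullet> (ident C \<I> \<boxtimes> F) \<bullet> luni C X"
    by simp
  also have "\<dots> = (?a \<boxtimes> lun C Y) \<bullet> (?a \<boxtimes> (ev \<boxtimes> ?Y)) \<bullet> alp C a (d \<otimes>\<^sub>o a) Y \<bullet> (alp C a d a \<boxtimes> ?Y)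
      \<bullet> alpi C (a \<otimes>\<^sub>o d) a Y \<bullet> (cv \<boxtimes> (?a \<boxtimes> ?Y)) \<bullet> luni C ?aY \<bullet> F"
    unfolding pentagon_alpi_left[of a d a Y, simplified] using luni_natural[of F] by simp
  also have "\<dots> = (?a \<boxtimes> lun C Y) \<bullet> (?a \<boxtimes> (ev \<boxtimes> ?Y)) \<bullet> alp C a (d \<otimes>\<^sub>o a) Y \<bullet> (alp C a d a \<boxtimes> ?Y)
      \<bullet> ((cv \<boxtimes> ?a) \<boxtimes> ?Y) \<bullet> alpi C \<I> a Y \<bullet> luni C ?aY \<bullet> F"
    using cmp_eq_assoc[OF alpi_natural[of cv ?a ?Y]] by (simp del: merge tns_ident)
  also have "\<dots> = (?a \<boxtimes> lun C Y) \<bullet> alp C a \<I> Y \<bullet> ((?a \<boxtimes> ev) \<boxtimes> ?Y) \<bullet> (alp C a d a \<boxtimes> ?Y) \<bullet> ((cv \<boxtimes> ?a) \<boxtimes> ?Y)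
      \<bullet> alpi C \<I> a Y \<bullet> luni C ?aY \<bullet> F"
    using cmp_eq_assoc[OF alp_natural[of ?a ev ?Y]] by (simp del: merge tns_ident)
  also have "\<dots> = ((run C a \<bullet> (?a \<boxtimes> ev) \<bullet> alp C a d a \<bullet> (cv \<boxtimes> ?a)) \<boxtimes> ?Y) \<bullet> alpi C \<I> a Y \<bullet> luni C ?aY \<bullet> F"
    using cmp_eq_assoc[OF triangle_arr[of a Y]] by simp
  also have "\<dots> = lun C ?aY \<bullet> alp C \<I> a Y \<bullet> alpi C \<I> a Y \<bullet> luni C ?aY \<bullet> F"
    unfolding z1 lun_tensor[symmetric, OF \<open>a \<in> Obj C\<close> Y] by simp
  also have "\<dots> = F" by simp
  finally show ?thesis .
qed

text \<open>Here \<open>F\<close> slides to the far left, leaving the zig-zag at \<open>d\<close>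
  tensored with \<open>X\<close>.\<close>

lemma hat_unhat:
  assumes z: "zigzag_obj a d cv ev" "zigzag_dual a d cv ev" and F: "in_hom C F (d \<otimes>\<^sub>o X) Y"
      and X [simp]: "X \<in> Obj C"
  shows "hat a d ev Y (unhat a d cv X F) = F"
proof -
  have [simp]: "a \<in> Obj C" "d \<in> Obj C" and cv: "in_hom C cv \<I> (a \<otimes>\<^sub>o d)" and ev: "in_hom C ev (d \<otimes>\<^sub>o a) \<I>"
    and z2: "lun C d \<bullet> (ev \<boxtimes> ident C d) \<bullet> alpi C d a d \<bullet> (ident C d \<boxtimes> cv) = run C d"
    using z by (auto simp: zigzag_obj_def zigzag_dual_def)
  note [simp] = in_homD(1-5)[OF cv] in_homD(1-5)[OF ev] in_homD(1-5)[OF F]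
  let ?d = "ident C d" and ?X = "ident C X" and ?dX = "d \<otimes>\<^sub>o X" and ?Y = "ident C Y"
  have "hat a d ev Y (unhat a d cv X F)
      = lun C Y \<bullet> (ev \<boxtimes> ?Y) \<bullet> alpi C d a Y \<bullet> (?d \<boxtimes> (ident C a \<boxtimes> F)) \<bullet> (?d \<boxtimes> alp C a d X) \<bullet> (?d \<boxtimes> (cv \<boxtimes> ?X))
          \<bullet> (?d \<boxtimes> luni C X)"
    by (simp add: unhat_def hat_def)
  also have "\<dots> = lun C Y \<bullet> (ev \<boxtimes> ?Y) \<bullet> ((?d \<boxtimes> ident C a) \<boxtimes> F) \<bullet> alpi C d a ?dX \<bullet> (?d \<boxtimes> alp C a d X)
      \<bullet> (?d \<boxtimes> (cv \<boxtimes> ?X)) \<bullet> (?d \<boxtimes> luni C X)"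
    using cmp_eq_assoc[OF alpi_natural[of ?d "ident C a" F]] by (simp del: merge tns_ident)
  also have "\<dots> = lun C Y \<bullet> (ident C \<I> \<boxtimes> F) \<bullet> (ev \<boxtimes> ident C ?dX) \<bullet> (alpi C d a ?dX \<bullet> (?d \<boxtimes> alp C a d X))
      \<bullet> (?d \<boxtimes> (cv \<boxtimes> ?X)) \<bullet> (?d \<boxtimes> luni C X)"
    by simp
  also have "\<dots> = F \<bullet> lun C ?dX \<bullet> (ev \<boxtimes> (?d \<boxtimes> ?X)) \<bullet> alp C (d \<otimes>\<^sub>o a) d X \<bullet> (alpi C d a d \<boxtimes> ?X)
      \<bullet> alpi C d (a \<otimes>\<^sub>o d) X \<bullet> (?d \<boxtimes> (cv \<boxtimes> ?X)) \<bullet> (?d \<boxtimes> luni C X)"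
    unfolding pentagon_alpi_right[of d a d X, simplified] using cmp_eq_assoc[OF lun_natural[of F]]
        by (simp del: merge)
  also have "\<dots> = F \<bullet> lun C ?dX \<bullet> (ev \<boxtimes> (?d \<boxtimes> ?X)) \<bullet> alp C (d \<otimes>\<^sub>o a) d X \<bullet> (alpi C d a d \<boxtimes> ?X)
      \<bullet> ((?d \<boxtimes> cv) \<boxtimes> ?X) \<bullet> alpi C d \<I> X \<bullet> (?d \<boxtimes> luni C X)"
    using cmp_eq_assoc[OF alpi_natural[of ?d cv ?X]] by (simp del: merge tns_ident)
  also have "\<dots> = F \<bullet> lun C ?dX \<bullet> alp C \<I> d X \<bullet> ((ev \<boxtimes> ?d) \<boxtimes> ?X) \<bullet> (alpi C d a d \<boxtimes> ?X) \<bullet> ((?d \<boxtimes> cv) \<boxtimes> ?X)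
      \<bullet> alpi C d \<I> X \<bullet> (?d \<boxtimes> luni C X)"
    using cmp_eq_assoc[OF alp_natural[of ev ?d ?X]] by (simp del: merge tns_ident)
  also have "\<dots> = F \<bullet> ((lun C d \<bullet> (ev \<boxtimes> ?d) \<bullet> alpi C d a d \<bullet> (?d \<boxtimes> cv)) \<boxtimes> ?X) \<bullet> alpi C d \<I> X
      \<bullet> (?d \<boxtimes> luni C X)"
    using cmp_eq_assoc[OF lun_tensor[of d X]] by simp
  also have "\<dots> = F" unfolding z2 triangle_arr[symmetric, OF \<open>d \<in> Obj C\<close> X] by simp
  finally show ?thesis .
qed

lemma tns_scl:
  assumes "c \<in> carrier K" "arr C F" "arr C H"
  shows "H \<boxtimes> smult_arr C c F = smult_arr C c (H \<boxtimes> F)" "smult_arr C c F \<boxtimes> H = smult_arr C c (F \<boxtimes> H)"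
proof -
  interpret m1: mod_hom K "Hom C (source F) (target F)" "Hom C (source H \<otimes>\<^sub>o source F) (target H \<otimes>\<^sub>o target
      F)" "\<lambda>f. under H \<otimes>\<^sub>m f"
    using assms arr_und[of C H] by (intro tns_mod_hom) auto
  interpret m2: mod_hom K "Hom C (source F) (target F)" "Hom C (source F \<otimes>\<^sub>o source H) (target F \<otimes>\<^sub>o target
      H)" "\<lambda>f. f \<otimes>\<^sub>m under H"
    using assms arr_und[of C H] by (intro tns_mod_hom) auto
  show "H \<boxtimes> smult_arr C c F = smult_arr C c (H \<boxtimes> F)" "smult_arr C c F \<boxtimes> H = smult_arr C c (F \<boxtimes> H)"
    using assms arr_und[of C F] m1.f_smult[of c "under F"] m2.f_smult[of c "under F"]
    by (auto intro!: arr_eqI[of C])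
qed

lemma pentagon_alpi:
  assumes [simp]: "a \<in> Obj C" "b \<in> Obj C" "c \<in> Obj C" "d \<in> Obj C"
  shows "(alpi C a b c \<boxtimes> ident C d) \<bullet> alpi C a (b \<otimes>\<^sub>o c) d \<bullet> (ident C a \<boxtimes> alpi C b c d)
    = alpi C (a \<otimes>\<^sub>o b) c d \<bullet> alpi C a b (c \<otimes>\<^sub>o d)"
proof -
  have "alpi C (a \<otimes>\<^sub>o b) c d \<bullet> alpi C a b (c \<otimes>\<^sub>o d)
    = alpi C (a \<otimes>\<^sub>o b) c d \<bullet> (alpi C a b (c \<otimes>\<^sub>o d) \<bullet> (ident C a \<boxtimes> alp C b c d))
        \<bullet> (ident C a \<boxtimes> alpi C b c d)"
    by simp
  also have "\<dots> = (alpi C a b c \<boxtimes> ident C d) \<bullet> alpi C a (b \<otimes>\<^sub>o c) d \<bullet> (ident C a \<boxtimes> alpi C b c d)"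
    unfolding pentagon_alpi_right[OF assms] by simp
  finally show ?thesis by simp
qed

lemma pentagon_alpi_tns:
  assumes [simp]: "a \<in> Obj C" "b \<in> Obj C" "c \<in> Obj C" "d \<in> Obj C"
  shows "alp C (a \<otimes>\<^sub>o b) c d \<bullet> (alpi C a b c \<boxtimes> ident C d)
    = alpi C a b (c \<otimes>\<^sub>o d) \<bullet> (ident C a \<boxtimes> alp C b c d) \<bullet> alp C a (b \<otimes>\<^sub>o c) d"
proof -
  have "alpi C a b (c \<otimes>\<^sub>o d) \<bullet> (ident C a \<boxtimes> alp C b c d) \<bullet> alp C a (b \<otimes>\<^sub>o c) d
    = (alpi C a b (c \<otimes>\<^sub>o d) \<bullet> (ident C a \<boxtimes> alp C b c d)) \<bullet> alp C a (b \<otimes>\<^sub>o c) d"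
    by simp
  also have "\<dots> = alp C (a \<otimes>\<^sub>o b) c d \<bullet> (alpi C a b c \<boxtimes> ident C d)"
    unfolding pentagon_alpi_right[OF assms] by simp
  finally show ?thesis by simp
qed

lemma runi_tensor:
  assumes [simp]: "a \<in> Obj C" "b \<in> Obj C"
  shows "alpi C a b \<I> \<bullet> (ident C a \<boxtimes> runi C b) = runi C (a \<otimes>\<^sub>o b)"
proof (rule cancel_left[of "run C (a \<otimes>\<^sub>o b)" _ _ "runi C (a \<otimes>\<^sub>o b)" "(a \<otimes>\<^sub>o b) \<otimes>\<^sub>o \<I>"])
  show "run C (a \<otimes>\<^sub>o b) \<bullet> alpi C a b \<I> \<bullet> (ident C a \<boxtimes> runi C b) = run C (a \<otimes>\<^sub>o b) \<bullet> runi C (a \<otimes>\<^sub>o b)"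
    using cmp_eq_assoc[OF run_tensor[OF assms], of "alpi C a b \<I> \<bullet> (ident C a \<boxtimes> runi C b)"] by simp
qed simp_all

text \<open>The left-hand side is the transpose along \<open>k\<close> of the inverse right unitor
  of \<open>b\<close>. It collapses because both unitors agree at the unit object.\<close>

lemma pairing_unit:
  assumes k: "in_hom C k (a \<otimes>\<^sub>o b) \<I>" and [simp]: "a \<in> Obj C" "b \<in> Obj C"
  shows "lun C \<I> \<bullet> (k \<boxtimes> ident C \<I>) \<bullet> alpi C a b \<I> \<bullet> (ident C a \<boxtimes> runi C b) = k"
  using in_homD(1-3)[OF k] cmp_eq_assoc[OF run_natural[of k]]
  by (simp add: runi_tensor lun_unit_eq_run_unit)

text \<open>Inserting \<open>cv\<close> to the right of the pairing and contracting by the zig-zag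
  at \<open>d\<close> recovers \<open>H\<close>.\<close>

lemma pairing_inj:
  assumes z: "zigzag_obj a d cv ev" "zigzag_dual a d cv ev" and H: "in_hom C H x d" "in_hom C H' x d"
    and eq: "ev \<bullet> (H \<boxtimes> ident C a) = ev \<bullet> (H' \<boxtimes> ident C a)"
  shows "H = H'"
proof -
  have [simp]: "a \<in> Obj C" "d \<in> Obj C" and cv: "in_hom C cv \<I> (a \<otimes>\<^sub>o d)" and ev: "in_hom C ev (d \<otimes>\<^sub>o a) \<I>"
    and z2: "lun C d \<bullet> (ev \<boxtimes> ident C d) \<bullet> alpi C d a d \<bullet> (ident C d \<boxtimes> cv) = run C d"
    using z by (auto simp: zigzag_obj_def zigzag_dual_def)
  note [simp] = in_homD(1-5)[OF cv] in_homD(1-5)[OF ev]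
  let ?d = "ident C d" and ?a = "ident C a"
  have *: "lun C d \<bullet> ((ev \<bullet> (H \<boxtimes> ?a)) \<boxtimes> ?d) \<bullet> alpi C x a d \<bullet> (ident C x \<boxtimes> cv) \<bullet> runi C x = H"
    if "in_hom C H x d" for H
  proof -
    note [simp] = in_homD(1-5)[OF that]
    have "lun C d \<bullet> ((ev \<bullet> (H \<boxtimes> ?a)) \<boxtimes> ?d) \<bullet> alpi C x a d \<bullet> (ident C x \<boxtimes> cv) \<bullet> runi C x
      = lun C d \<bullet> (ev \<boxtimes> ?d) \<bullet> (((H \<boxtimes> ?a) \<boxtimes> ?d) \<bullet> alpi C x a d) \<bullet> (ident C x \<boxtimes> cv) \<bullet> runi C x" by simp
    also have "\<dots> = lun C d \<bullet> (ev \<boxtimes> ?d) \<bullet> alpi C d a d \<bullet> (H \<boxtimes> (?a \<boxtimes> ?d)) \<bullet> (ident C x \<boxtimes> cv) \<bullet> runi C x"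
      using cmp_eq_assoc[OF alpi_natural[of H ?a ?d]] by (simp del: merge tns_ident)
    also have "\<dots> = (lun C d \<bullet> (ev \<boxtimes> ?d) \<bullet> alpi C d a d \<bullet> (?d \<boxtimes> cv)) \<bullet> (H \<boxtimes> ident C \<I>) \<bullet> runi C x" by simp
    also have "\<dots> = H" unfolding z2 using cmp_eq_assoc[OF run_natural[of H]] by simp
    finally show ?thesis .
  qed
  show ?thesis using *[OF H(1)] *[OF H(2)] unfolding eq by (rule trans[OF sym])
qed

text \<open>The witness inserts \<open>cv\<close> next to \<open>x\<close> and contracts with
  \<open>k\<close>; pairing it with \<open>a\<close> again, the zig-zag at \<open>a\<close>
  straightens the strand and returns \<open>k\<close>.\<close>

lemma pairing_transpose:
  assumes z: "zigzag_obj a d cv ev" and k: "in_hom C k (x \<otimes>\<^sub>o a) \<I>" and [simp]: "x \<in> Obj C"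
  obtains f where "in_hom C f x d" "ev \<bullet> (f \<boxtimes> ident C a) = k"
proof -
  have [simp]: "a \<in> Obj C" "d \<in> Obj C" and cv: "in_hom C cv \<I> (a \<otimes>\<^sub>o d)" and ev: "in_hom C ev (d \<otimes>\<^sub>o a) \<I>"
    and z1: "run C a \<bullet> (ident C a \<boxtimes> ev) \<bullet> alp C a d a \<bullet> (cv \<boxtimes> ident C a) = lun C a"
    using z by (auto simp: zigzag_obj_def)
  note [simp] = in_homD(1-5)[OF cv] in_homD(1-5)[OF ev] in_homD(1-5)[OF k]
  let ?d = "ident C d" and ?a = "ident C a" and ?x = "ident C x" and ?i = "ident C \<I>"
  have z1': "(?a \<boxtimes> ev) \<bullet> alp C a d a \<bullet> (cv \<boxtimes> ?a) = runi C a \<bullet> lun C a"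
    unfolding z1[symmetric] by simp
  let ?f = "lun C d \<bullet> (k \<boxtimes> ?d) \<bullet> alpi C x a d \<bullet> (?x \<boxtimes> cv) \<bullet> runi C x"
  have "ev \<bullet> (?f \<boxtimes> ?a) = ev \<bullet> (lun C d \<boxtimes> ?a) \<bullet> ((k \<boxtimes> ?d) \<boxtimes> ?a) \<bullet> (alpi C x a d \<boxtimes> ?a) \<bullet> ((?x \<boxtimes> cv) \<boxtimes> ?a)
      \<bullet> (runi C x \<boxtimes> ?a)"
    by simp
  also have "\<dots> = ev \<bullet> lun C (d \<otimes>\<^sub>o a) \<bullet> alp C \<I> d a \<bullet> ((k \<boxtimes> ?d) \<boxtimes> ?a) \<bullet> (alpi C x a d \<boxtimes> ?a)
      \<bullet> ((?x \<boxtimes> cv) \<boxtimes> ?a) \<bullet> (runi C x \<boxtimes> ?a)"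
    unfolding lun_tensor[symmetric, OF \<open>d \<in> Obj C\<close> \<open>a \<in> Obj C\<close>] by simp
  also have "\<dots> = lun C \<I> \<bullet> (?i \<boxtimes> ev) \<bullet> alp C \<I> d a \<bullet> ((k \<boxtimes> ?d) \<boxtimes> ?a) \<bullet> (alpi C x a d \<boxtimes> ?a)
      \<bullet> ((?x \<boxtimes> cv) \<boxtimes> ?a) \<bullet> (runi C x \<boxtimes> ?a)"
    using cmp_eq_assoc[OF lun_natural[of ev]] by (simp del: merge)
  also have "\<dots> = lun C \<I> \<bullet> (?i \<boxtimes> ev) \<bullet> (k \<boxtimes> (?d \<boxtimes> ?a)) \<bullet> alp C (x \<otimes>\<^sub>o a) d a \<bullet> (alpi C x a d \<boxtimes> ?a)
      \<bullet> ((?x \<boxtimes> cv) \<boxtimes> ?a) \<bullet> (runi C x \<boxtimes> ?a)"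
    using cmp_eq_assoc[OF alp_natural[of k ?d ?a]] by (simp del: merge tns_ident)
  also have "\<dots> = lun C \<I> \<bullet> (k \<boxtimes> ?i) \<bullet> ((?x \<boxtimes> ?a) \<boxtimes> ev) \<bullet> (alp C (x \<otimes>\<^sub>o a) d a \<bullet> (alpi C x a d \<boxtimes> ?a))
      \<bullet> ((?x \<boxtimes> cv) \<boxtimes> ?a) \<bullet> (runi C x \<boxtimes> ?a)"
    by simp
  also have "\<dots> = lun C \<I> \<bullet> (k \<boxtimes> ?i) \<bullet> (((?x \<boxtimes> ?a) \<boxtimes> ev) \<bullet> alpi C x a (d \<otimes>\<^sub>o a)) \<bullet> (?x \<boxtimes> alp C a d a)
      \<bullet> (alp C x (a \<otimes>\<^sub>o d) a \<bullet> ((?x \<boxtimes> cv) \<boxtimes> ?a)) \<bullet> (runi C x \<boxtimes> ?a)"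
    by (subst pentagon_alpi_tns) simp_all
  also have "\<dots> = lun C \<I> \<bullet> (k \<boxtimes> ?i) \<bullet> alpi C x a \<I> \<bullet> (?x \<boxtimes> (?a \<boxtimes> ev)) \<bullet> (?x \<boxtimes> alp C a d a)
      \<bullet> (?x \<boxtimes> (cv \<boxtimes> ?a)) \<bullet> alp C x \<I> a \<bullet> (runi C x \<boxtimes> ?a)"
    using cmp_eq_assoc[OF alpi_natural[of ?x ?a ev]] cmp_eq_assoc[OF alp_natural[of ?x cv ?a]]
        by (simp del: merge tns_ident)
  also have "\<dots> = lun C \<I> \<bullet> (k \<boxtimes> ?i) \<bullet> alpi C x a \<I> \<bullet> (?x \<boxtimes> ((?a \<boxtimes> ev) \<bullet> alp C a d a \<bullet> (cv \<boxtimes> ?a)))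
      \<bullet> alp C x \<I> a \<bullet> (runi C x \<boxtimes> ?a)"
    by simp
  also have "\<dots> = lun C \<I> \<bullet> (k \<boxtimes> ?i) \<bullet> alpi C x a \<I> \<bullet> (?x \<boxtimes> runi C a) \<bullet> ((?x \<boxtimes> lun C a) \<bullet> alp C x \<I> a)
      \<bullet> (runi C x \<boxtimes> ?a)"
    unfolding z1' by simp
  also have "\<dots> = lun C \<I> \<bullet> (k \<boxtimes> ?i) \<bullet> alpi C x a \<I> \<bullet> (?x \<boxtimes> runi C a)"
    by (subst triangle_arr) simp_all
  also have "\<dots> = k" using k by (intro pairing_unit) simp_all
  finally show thesis by (intro that[of ?f]) (simp_all add: in_hom_def)
qed

text \<open>Like \<open>hat_whisker\<close> and \<open>hat_tns\<close>, this holds for an arbitrary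
  pairing, so it can be applied to \<open>E \<bullet> Mu\<close>; the Frobenius axioms are computed
  with these three rules.\<close>

lemma hat_cmp:
  assumes "in_hom C ev (d \<otimes>\<^sub>o a) \<I>" "in_hom C X x (a \<otimes>\<^sub>o Y)" "in_hom C W w x" "a \<in> Obj C" "d \<in> Obj C"
      "Y \<in> Obj C"
  shows "hat a d ev Y (X \<bullet> W) = hat a d ev Y X \<bullet> (ident C d \<boxtimes> W)"
  using assms by (simp add: hat_def in_hom_def)

lemma hat_whisker:
  assumes ev: "in_hom C ev (d \<otimes>\<^sub>o a) \<I>" and X: "in_hom C X x (a \<otimes>\<^sub>o Y)" and W: "in_hom C W Y Z"
      and [simp]: "a \<in> Obj C" "d \<in> Obj C"
  shows "hat a d ev Z ((ident C a \<boxtimes> W) \<bullet> X) = W \<bullet> hat a d ev Y X"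
proof -
  note [simp] = in_homD(1-5)[OF X] in_homD(1-5)[OF W] in_homD(1-5)[OF ev]
  have "hat a d ev Z ((ident C a \<boxtimes> W) \<bullet> X) = lun C Z \<bullet> (ev \<boxtimes> ident C Z) \<bullet> (alpi C d a Z
      \<bullet> (ident C d \<boxtimes> (ident C a \<boxtimes> W))) \<bullet> (ident C d \<boxtimes> X)"
    by (simp add: hat_def)
  also have "\<dots> = lun C Z \<bullet> (ev \<boxtimes> ident C Z) \<bullet> ((ident C d \<boxtimes> ident C a) \<boxtimes> W) \<bullet> alpi C d a Y
      \<bullet> (ident C d \<boxtimes> X)"
    using cmp_eq_assoc[OF alpi_natural[of "ident C d" "ident C a" W]] by (simp del: merge tns_ident)
  also have "\<dots> = (lun C Z \<bullet> (ident C \<I> \<boxtimes> W)) \<bullet> (ev \<boxtimes> ident C Y) \<bullet> alpi C d a Y \<bullet> (ident C d \<boxtimes> X)" by simp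
  also have "\<dots> = W \<bullet> hat a d ev Y X" using lun_natural[of W] by (simp add: hat_def)
  finally show ?thesis .
qed

lemma hat_tns:
  assumes ev: "in_hom C ev (d \<otimes>\<^sub>o a) \<I>" and X: "in_hom C X x (a \<otimes>\<^sub>o Y)" and [simp]: "Y \<in> Obj C" "Z \<in> Obj C"
      "a \<in> Obj C" "d \<in> Obj C"
  shows "hat a d ev (Y \<otimes>\<^sub>o Z) (alp C a Y Z \<bullet> (X \<boxtimes> ident C Z)) = (hat a d ev Y X \<boxtimes> ident C Z) \<bullet> alpi C d x Z"
proof -
  note [simp] = in_homD(1-5)[OF X] in_homD(1-5)[OF ev]
  let ?YZ = "Y \<otimes>\<^sub>o Z" and ?d = "ident C d" and ?Y = "ident C Y" and ?Z = "ident C Z"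
  have "hat a d ev ?YZ (alp C a Y Z \<bullet> (X \<boxtimes> ?Z)) = lun C ?YZ \<bullet> (ev \<boxtimes> ident C ?YZ) \<bullet> (alpi C d a ?YZ
      \<bullet> (?d \<boxtimes> alp C a Y Z)) \<bullet> (?d \<boxtimes> (X \<boxtimes> ?Z))"
    by (simp add: hat_def)
  also have "\<dots> = lun C ?YZ \<bullet> (ev \<boxtimes> (?Y \<boxtimes> ?Z)) \<bullet> alp C (d \<otimes>\<^sub>o a) Y Z \<bullet> (alpi C d a Y \<boxtimes> ?Z)
      \<bullet> (alpi C d (a \<otimes>\<^sub>o Y) Z \<bullet> (?d \<boxtimes> (X \<boxtimes> ?Z)))"
    by (subst pentagon_alpi_right) simp_all
  also have "\<dots> = lun C ?YZ \<bullet> alp C \<I> Y Z \<bullet> ((ev \<boxtimes> ?Y) \<boxtimes> ?Z) \<bullet> (alpi C d a Y \<boxtimes> ?Z) \<bullet> ((?d \<boxtimes> X) \<boxtimes> ?Z)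
      \<bullet> alpi C d x Z"
    using alpi_natural[of ?d X ?Z] cmp_eq_assoc[OF alp_natural[of ev ?Y ?Z]] by (simp del: merge tns_ident)
  also have "\<dots> = (hat a d ev Y X \<boxtimes> ?Z) \<bullet> alpi C d x Z"
    using cmp_eq_assoc[OF lun_tensor[of Y Z]] by (simp add: hat_def)
  finally show ?thesis .
qed

end

section \<open>Modules over an algebra\<close>

locale algebra_in = tensor_category K C
  for K :: "('k, 'z) ring_scheme" and C :: "('o, 'm, 'k, 'y) tensor_cat_scheme" (structure) +
  fixes A :: 'o and m i :: 'm
  assumes algebra: "algebra_object C A m i"
begin

definition Mu :: "('o, 'm) arrow" where "Mu = mk_arr (A \<otimes>\<^sub>o A) m A"
definition Unt :: "('o, 'm) arrow" where "Unt = mk_arr \<I> i A"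

abbreviation idA where "idA \<equiv> ident C A"

definition modl :: "'o \<Rightarrow> ('o, 'm) arrow \<Rightarrow> bool"
  where "modl x R \<longleftrightarrow> in_hom C R (x \<otimes>\<^sub>o A) x \<and> x \<in> Obj C \<and>
    R \<bullet> (R \<boxtimes> idA) = R \<bullet> (ident C x \<boxtimes> Mu) \<bullet> alp C x A A \<and>
    R \<bullet> (ident C x \<boxtimes> Unt) = run C x"

definition modhom :: "'o \<Rightarrow> ('o, 'm) arrow \<Rightarrow> 'o \<Rightarrow> ('o, 'm) arrow \<Rightarrow> ('o, 'm) arrow \<Rightarrow> bool"
  where "modhom x R y S F \<longleftrightarrow> in_hom C F x y \<and> F \<bullet> R = S \<bullet> (F \<boxtimes> idA)"

abbreviation "Mod_A \<equiv> module_category C A m i"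

lemma algebra_obj [simp]: "A \<in> Obj C" and algebra_mor: "m \<in> mor C (A \<otimes>\<^sub>o A) A" "i \<in> mor C \<I> A"
  using algebra by (auto simp: algebra_object_def)

lemma Mu_Unt [simp]: "arr C Mu" "source Mu = A \<otimes>\<^sub>o A" "target Mu = A" "arr C Unt" "source Unt = \<I>"
    "target Unt = A"
  "under Mu = m" "under Unt = i"
  using algebra_mor by (auto simp: Mu_def Unt_def)

lemma Mu_assoc: "Mu \<bullet> (Mu \<boxtimes> idA) = Mu \<bullet> (idA \<boxtimes> Mu) \<bullet> alp C A A A"
  and Mu_left_unit: "Mu \<bullet> (Unt \<boxtimes> idA) = lun C A"
  and Mu_right_unit: "Mu \<bullet> (idA \<boxtimes> Unt) = run C A"
proof -
  have "(Mu \<bullet> (idA \<boxtimes> Mu)) \<bullet> alp C A A A = Mu \<bullet> (Mu \<boxtimes> idA)"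
    using algebra by (intro arr_eqI[of C]) (auto simp: algebra_object_def simp del: cmp_assoc)
  then show "Mu \<bullet> (Mu \<boxtimes> idA) = Mu \<bullet> (idA \<boxtimes> Mu) \<bullet> alp C A A A" by simp
  show "Mu \<bullet> (Unt \<boxtimes> idA) = lun C A" "Mu \<bullet> (idA \<boxtimes> Unt) = run C A"
    using algebra by (auto intro!: arr_eqI[of C] simp: algebra_object_def)
qed

lemma modlD [simp]:
  assumes "modl x R"
  shows "x \<in> Obj C" "arr C R" "source R = x \<otimes>\<^sub>o A" "target R = x"
  using assms by (auto simp: modl_def in_hom_def)

lemma modhomD:
  assumes "modhom x R y S F" shows "arr C F" "source F = x" "target F = y" "in_hom C F x y" "F \<bullet> R = S
      \<bullet> (F \<boxtimes> idA)"
  using assms by (auto simp: modhom_def in_hom_def)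

lemma module_object_iff:
  "module_object C A m i x r \<longleftrightarrow> modl x (mk_arr (x \<otimes>\<^sub>o A) r x)"
proof (cases "x \<in> Obj C \<and> r \<in> mor C (x \<otimes>\<^sub>o A) x")
  case True
  let ?R = "mk_arr (x \<otimes>\<^sub>o A) r x"
  have R: "arr C ?R" using True by simp
  have "?R \<bullet> (?R \<boxtimes> idA) = (?R \<bullet> (ident C x \<boxtimes> Mu)) \<bullet> alp C x A A \<longleftrightarrow>
      r \<cdot> (r \<otimes>\<^sub>m Id C A) = r \<cdot> (Id C x \<otimes>\<^sub>m m) \<cdot> associator C x A A"
    using True R by (subst arr_eq_iff[of C]) (simp_all del: cmp_assoc)
  moreover have "?R \<bullet> (ident C x \<boxtimes> Unt) = run C x \<longleftrightarrow> r \<cdot> (Id C x \<otimes>\<^sub>m i) = runitor C x"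
    using True R by (subst arr_eq_iff[of C]) simp_all
  ultimately show ?thesis unfolding modl_def module_object_def using True by auto
qed (auto simp: module_object_def modl_def)

lemma MC_Obj: "(x, r) \<in> Obj Mod_A \<longleftrightarrow> modl x (mk_arr (x \<otimes>\<^sub>o A) r x)"
  by (simp add: module_category_def module_object_iff)

lemma MC_Hom: "Hom Mod_A (x, r) (y, s) = (Hom C x y)\<lparr>carrier := {f \<in> mor C x y. f \<cdot> r
    = s \<cdot> (f \<otimes>\<^sub>m Id C A)}\<rparr>"
  by (simp add: module_category_def)

lemma MC_Comp [simp]: "g \<cdot>\<^bsub>Mod_A\<^esub> f = g \<cdot> f" and MC_Id [simp]: "Id Mod_A X = Id C (fst X)"
  by (simp_all add: module_category_def split_def)

lemma modl_und: "modl x R \<Longrightarrow> mk_arr (x \<otimes>\<^sub>o A) (under R) x = R"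
  by (intro mk_und[of C]) (simp add: in_hom_def)

lemma modl_mor: "modl x R \<Longrightarrow> under R \<in> mor C (x \<otimes>\<^sub>o A) x"
  using arr_und[of C R] modlD[of x R] by simp

lemma MC_mor:
  assumes "modl x R" "modl y S"
  shows "f \<in> mor Mod_A (x, under R) (y, under S) \<longleftrightarrow> modhom x R y S (mk_arr x f y)"
proof (cases "f \<in> mor C x y")
  case True
  then have "mk_arr x f y \<bullet> R = S \<bullet> (mk_arr x f y \<boxtimes> idA) \<longleftrightarrow> f \<cdot> under R = under S \<cdot> (f \<otimes>\<^sub>m Id C A)"
    using assms by (subst arr_eq_iff[of C]) simp_all
  then show ?thesis using True assms by (simp add: MC_Hom modhom_def)
next
  case False
  then show ?thesis using assms by (simp add: MC_Hom modhom_def)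
qed

text \<open>Both sides of the intertwining condition are linear in \<open>f\<close>. Vector space
  structure and finite dimension of the hom-spaces of modules come from here.\<close>

lemma modhom_subspace:
  assumes R: "modl x R" and S: "modl y S"
  shows "subspace K {f \<in> mor C x y. f \<cdot> under R = under S \<cdot> (f \<otimes>\<^sub>m Id C A)} (Hom C x y)"
proof -
  have xy: "x \<in> Obj C" "y \<in> Obj C" using R S by auto
  interpret V: vectorspace K "Hom C x y" using xy by (rule hom_vectorspace)
  interpret m1: mod_hom K "Hom C x y" "Hom C (x \<otimes>\<^sub>o A) y" "\<lambda>f. f \<cdot> under R"
    using xy modl_mor[OF R] by (intro hom_mod_hom) auto
  interpret m2: mod_hom K "Hom C x y" "Hom C (x \<otimes>\<^sub>o A) (y \<otimes>\<^sub>o A)" "\<lambda>f. f \<otimes>\<^sub>m Id C A"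
    using xy id_mor by (intro tns_mod_hom) auto
  interpret m3: mod_hom K "Hom C (x \<otimes>\<^sub>o A) (y \<otimes>\<^sub>o A)" "Hom C (x \<otimes>\<^sub>o A) y" "\<lambda>f. under S \<cdot> f"
    using xy modl_mor[OF S] by (intro hom_mod_hom) auto
  show ?thesis unfolding subspace_def
  proof (intro conjI)
    show "vectorspace K (Hom C x y)" by (rule V.vectorspace_axioms)
    show "LinearCombinations.submodule K {f \<in> mor C x y. f \<cdot> under R
        = under S \<cdot> (f \<otimes>\<^sub>m Id C A)} (Hom C x y)"
      by (unfold_locales) auto
  qed
qed

lemma MC_ObjE:
  assumes "X \<in> Obj Mod_A"
  obtains x R where "X = (x, under R)" "modl x R"
proof (cases X)
  case (Pair x r)
  then show thesis using assms that[of x "mk_arr (x \<otimes>\<^sub>o A) r x"] by (simp add: MC_Obj)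
qed

lemma MC_ObjI: "modl x R \<Longrightarrow> (x, under R) \<in> Obj Mod_A"
  by (simp add: MC_Obj modl_und)

lemma modhom_cmp: "\<lbrakk>modl x R; modl y S; modl z T; modhom x R y S F; modhom y S z T G\<rbrakk> \<Longrightarrow> modhom x R z T (G
    \<bullet> F)"
proof -
  assume *: "modl x R" "modl y S" "modl z T" "modhom x R y S F" "modhom y S z T G"
  note F = modhomD[OF *(4)] and G = modhomD[OF *(5)]
  have "(G \<bullet> F) \<bullet> R = G \<bullet> S \<bullet> (F \<boxtimes> idA)" using F(5) by simp
  also have "\<dots> = T \<bullet> (G \<boxtimes> idA) \<bullet> (F \<boxtimes> idA)" using cmp_eq_assoc[OF G(5)] by simp
  also have "\<dots> = T \<bullet> ((G \<bullet> F) \<boxtimes> idA)" using F G * by simp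
  finally show ?thesis using F G by (auto simp: modhom_def)
qed

lemma modhom_ident: "modl x R \<Longrightarrow> modhom x R x R (ident C x)"
  by (simp add: modhom_def in_hom_def)

lemma MC_linear_category: "linear_category K Mod_A"
proof (rule linear_category.intro)
  show "field K" by (rule field)
next
  fix X Y assume "X \<in> Obj Mod_A" "Y \<in> Obj Mod_A"
  then obtain x R y S where XY: "X = (x, under R)" "Y = (y, under S)" "modl x R" "modl y S"
      by (metis MC_ObjE)
  then have xy: "x \<in> Obj C" "y \<in> Obj C" by auto
  interpret V: vectorspace K "Hom C x y" using xy by (rule hom_vectorspace)
  show "vectorspace K (Hom Mod_A X Y)" unfolding XY MC_Hom
    by (rule V.subspace_is_vs[OF modhom_subspace[OF XY(3,4)]])
  show "vectorspace.fin_dim K (Hom Mod_A X Y)" unfolding XY MC_Hom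
    by (rule V.subspace_fin_dim[OF hom_fin_dim[OF xy] modhom_subspace[OF XY(3,4)]])
next
  fix X assume "X \<in> Obj Mod_A"
  then obtain x R where X: "X = (x, under R)" "modl x R" by (metis MC_ObjE)
  then show "Id Mod_A X \<in> mor Mod_A X X"
    using MC_mor[OF X(2,2), of "Id C x"] modhom_ident[OF X(2)] by (simp add: ident_def)
next
  fix X Y Z f g assume "X \<in> Obj Mod_A" "Y \<in> Obj Mod_A" "Z \<in> Obj Mod_A" and fg: "f \<in> mor Mod_A X Y"
      "g \<in> mor Mod_A Y Z"
  then obtain x R y S z T where X: "X = (x, under R)" "Y = (y, under S)" "Z = (z, under T)" "modl x R"
      "modl y S" "modl z T"
    by (metis MC_ObjE)
  have "modhom x R z T (mk_arr y g z \<bullet> mk_arr x f y)"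
    using X fg by (intro modhom_cmp[of x R y S]) (auto simp: MC_mor)
  moreover have "mk_arr y g z \<bullet> mk_arr x f y = mk_arr x (g \<cdot> f) z" using X fg by (auto simp: MC_Hom)
  ultimately show "g \<cdot>\<^bsub>Mod_A\<^esub> f \<in> mor Mod_A X Z" using X by (simp add: MC_mor)
next
  fix X Y f assume "X \<in> Obj Mod_A" "Y \<in> Obj Mod_A" and f: "f \<in> mor Mod_A X Y"
  then obtain x R y S where X: "X = (x, under R)" "Y = (y, under S)" "modl x R" "modl y S"
      by (metis MC_ObjE)
  then have "f \<in> mor C x y" "x \<in> Obj C" "y \<in> Obj C" using f by (auto simp: MC_Hom)
  then show "f \<cdot>\<^bsub>Mod_A\<^esub> Id Mod_A X = f" "Id Mod_A Y \<cdot>\<^bsub>Mod_A\<^esub> f = f"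
    using X comp_id_right[of x y f] comp_id_left[of x y f] by auto
next
  fix X Y Z W f g h
  assume "X \<in> Obj Mod_A" "Y \<in> Obj Mod_A" "Z \<in> Obj Mod_A" "W \<in> Obj Mod_A"
    and fg: "f \<in> mor Mod_A X Y" "g \<in> mor Mod_A Y Z" "h \<in> mor Mod_A Z W"
  then obtain x R y S z T w Q where X: "X = (x, under R)" "Y = (y, under S)" "Z = (z, under T)" "W
      = (w, under Q)"
      "modl x R" "modl y S" "modl z T" "modl w Q"
    by (metis MC_ObjE)
  then have "f \<in> mor C x y" "g \<in> mor C y z" "h \<in> mor C z w" using fg by (auto simp: MC_Hom)
  then show "h \<cdot>\<^bsub>Mod_A\<^esub> g \<cdot>\<^bsub>Mod_A\<^esub> f = h \<cdot>\<^bsub>Mod_A\<^esub> (g \<cdot>\<^bsub>Mod_A\<^esub> f)"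
    using X comp_assoc[of x y z w f g h] by simp
next
  fix X Y Z f assume *: "X \<in> Obj Mod_A" "Y \<in> Obj Mod_A" "Z \<in> Obj Mod_A" and f: "f \<in> mor Mod_A X Y"
  then obtain x R y S z T where X: "X = (x, under R)" "Y = (y, under S)" "Z = (z, under T)" "modl x R"
      "modl y S" "modl z T"
    by (metis MC_ObjE)
  have fC: "f \<in> mor C x y" using f X by (auto simp: MC_Hom)
  have "g \<cdot> f \<in> mor Mod_A X Z" if "g \<in> mor Mod_A Y Z" for g
  proof -
    have "modhom x R z T (mk_arr y g z \<bullet> mk_arr x f y)"
      using X f that by (intro modhom_cmp[of x R y S]) (auto simp: MC_mor)
    moreover have "mk_arr y g z \<bullet> mk_arr x f y = mk_arr x (g \<cdot> f) z" using X f that by (auto simp: MC_Hom)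
    ultimately show ?thesis using X by (simp add: MC_mor)
  qed
  moreover have "(\<lambda>g. g \<cdot> f) \<in> module_hom K (Hom C y z) (Hom C x z)"
    using comp_linear_left[of x y z f] X fC by simp
  ultimately show "(\<lambda>g. g \<cdot>\<^bsub>Mod_A\<^esub> f) \<in> module_hom K (Hom Mod_A Y Z) (Hom Mod_A X Z)"
    unfolding module_hom_def X by (auto simp: MC_Hom)
next
  fix X Y Z g assume *: "X \<in> Obj Mod_A" "Y \<in> Obj Mod_A" "Z \<in> Obj Mod_A" and g: "g \<in> mor Mod_A Y Z"
  then obtain x R y S z T where X: "X = (x, under R)" "Y = (y, under S)" "Z = (z, under T)" "modl x R"
      "modl y S" "modl z T"
    by (metis MC_ObjE)
  have gC: "g \<in> mor C y z" using g X by (auto simp: MC_Hom)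
  have "g \<cdot> f \<in> mor Mod_A X Z" if "f \<in> mor Mod_A X Y" for f
  proof -
    have "modhom x R z T (mk_arr y g z \<bullet> mk_arr x f y)"
      using X g that by (intro modhom_cmp[of x R y S]) (auto simp: MC_mor)
    moreover have "mk_arr y g z \<bullet> mk_arr x f y = mk_arr x (g \<cdot> f) z" using X g that by (auto simp: MC_Hom)
    ultimately show ?thesis using X by (simp add: MC_mor)
  qed
  moreover have "(\<lambda>f. g \<cdot> f) \<in> module_hom K (Hom C x y) (Hom C x z)"
    using comp_linear_right[of x y z g] X gC by simp
  ultimately show "(\<lambda>f. g \<cdot>\<^bsub>Mod_A\<^esub> f) \<in> module_hom K (Hom Mod_A X Y) (Hom Mod_A X Z)"
    unfolding module_hom_def X by (auto simp: MC_Hom)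
qed

section \<open>Splittings, biproducts and regularity in the module category\<close>

interpretation Mod_A: linear_category K Mod_A by (rule MC_linear_category)

text \<open>Module maps are morphisms of \<open>C\<close>, so one becomes an arrow of
  \<open>Mod_A\<close> by relabelling its ends. Computations stay in \<open>C\<close> and are
  carried over by the rules for \<open>lift\<close>.\<close>

definition lift :: "'o \<Rightarrow> ('o, 'm) arrow \<Rightarrow> 'o \<Rightarrow> ('o, 'm) arrow \<Rightarrow> ('o, 'm) arrow \<Rightarrow> ('o \<times> 'm, 'm) arrow"
  where "lift x R y S F = mk_arr (x, under R) (under F) (y, under S)"

lemma in_hom_lift:
  assumes "modl x R" "modl y S" "modhom x R y S F"
  shows "in_hom Mod_A (lift x R y S F) (x, under R) (y, under S)"
  using assms by (simp add: lift_def MC_ObjI MC_mor mk_und[OF modhomD(4)])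

lemma in_hom_ModE:
  assumes "in_hom Mod_A G (x, under R) (y, under S)" "modl x R" "modl y S"
  obtains F where "modhom x R y S F" "G = lift x R y S F"
proof -
  have "under G \<in> mor Mod_A (x, under R) (y, under S)" using assms by (blast dest: in_homD(6))
  then have "modhom x R y S (mk_arr x (under G) y)" using assms by (simp add: MC_mor)
  moreover have "G = lift x R y S (mk_arr x (under G) y)" using mk_und[OF assms(1)] by (simp add: lift_def)
  ultimately show thesis by (rule that)
qed

lemma cmp_lift:
  assumes "modl x R" "modl y S" "modl z T" "modhom x R y S F" "modhom y S z T G"
  shows "comp_arr Mod_A (lift y S z T G) (lift x R y S F) = lift x R z T (G \<bullet> F)"
proof -
  have "arr Mod_A (lift x R y S F)" "arr Mod_A (lift y S z T G)"
    using in_hom_lift[OF assms(1,2,4)] in_hom_lift[OF assms(2,3,5)] by (auto simp: in_hom_def)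
  then have "comp_arr Mod_A (lift y S z T G) (lift x R y S F)
      = mk_arr (x, under R) (under G \<cdot> under F) (z, under T)"
    by (simp add: comp_arr_def[of Mod_A]) (simp add: lift_def)
  also have "\<dots> = lift x R z T (G \<bullet> F)" using modhomD[OF assms(4)] modhomD[OF assms(5)]
      by (simp add: lift_def)
  finally show ?thesis .
qed

lemma lift_ident: "lift x R x R (ident C x) = ident Mod_A (x, under R)"
  by (simp add: lift_def ident_def)

lemma lift_zer: "lift x R y S (zero_arr C x y) = zero_arr Mod_A (x, under R) (y, under S)"
  by (simp add: lift_def zero_arr_def MC_Hom)

lemma lift_inject: "modhom x R y S F \<Longrightarrow> modhom x R y S G \<Longrightarrow> lift x R y S F = lift x R y S G \<longleftrightarrow> F = G"
  using arr_eqI[of C F G] by (auto simp: lift_def dest: modhomD)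

lemma lift_add:
  assumes "modl x R" "modl y S" "modhom x R y S F" "modhom x R y S G"
  shows "add_arr Mod_A (lift x R y S F) (lift x R y S G) = lift x R y S (F \<boxplus> G)"
proof -
  have "arr Mod_A (lift x R y S F)" "arr Mod_A (lift x R y S G)"
    using in_hom_lift[OF assms(1,2,3)] in_hom_lift[OF assms(1,2,4)] by (auto simp: in_hom_def)
  then have "add_arr Mod_A (lift x R y S F) (lift x R y S G)
      = mk_arr (x, under R) (under F \<oplus>\<^bsub>Hom C x y\<^esub> under G) (y, under S)"
    by (simp add: add_arr_def[of Mod_A]) (simp add: lift_def MC_Hom)
  also have "\<dots> = lift x R y S (F \<boxplus> G)" using modhomD[OF assms(3)] modhomD[OF assms(4)]
      by (simp add: lift_def)
  finally show ?thesis .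
qed

lemma modhom_add:
  assumes "modl x R" "modl y S" "modhom x R y S F" "modhom x R y S G"
  shows "modhom x R y S (F \<boxplus> G)"
  using assms modhomD[OF assms(3)] modhomD[OF assms(4)]
  by (simp add: modhom_def in_hom_def cmp_add_left cmp_add_right tns_add_left)

lemma tns_neg_left:
  assumes "arr C F" "arr C G"
  shows "neg_arr C F \<boxtimes> G = neg_arr C (F \<boxtimes> G)"
proof (rule eq_of_add_neg_eq_zer)
  show "neg_arr C F \<boxtimes> G \<boxplus> neg_arr C (neg_arr C (F \<boxtimes> G)) = zero_arr C (source F \<otimes>\<^sub>o source G) (target F \<otimes>\<^sub>o
      target G)"
    using assms tns_add_left[of G "neg_arr C F" F] by simp
qed (use assms in auto)

lemma modhom_neg:
  assumes "modl x R" "modl y S" "modhom x R y S F"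
  shows "modhom x R y S (neg_arr C F)"
  using assms modhomD[OF assms(3)]
  by (simp add: modhom_def in_hom_def tns_neg_left)

definition modules_regular :: bool
  where "modules_regular \<longleftrightarrow> (\<forall>x R y S F. modl x R \<longrightarrow> modl y S \<longrightarrow> modhom x R y S F \<longrightarrow>
    (\<exists>G. modhom y S x R G \<and> F \<bullet> G \<bullet> F = F))"

lemma regular_category_MC: "regular_category Mod_A \<longleftrightarrow> modules_regular"
proof
  assume reg: "regular_category Mod_A"
  show modules_regular unfolding modules_regular_def
  proof (intro allI impI)
    fix x R y S F assume *: "modl x R" "modl y S" "modhom x R y S F"
    obtain G where G: "in_hom Mod_A G (y, under S) (x, under R)"
      "comp_arr Mod_A (lift x R y S F) (comp_arr Mod_A G (lift x R y S F)) = lift x R y S F"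
      using Mod_A.regularE[OF reg in_hom_lift[OF *]] .
    obtain H where H: "modhom y S x R H" "G = lift y S x R H" using in_hom_ModE[OF G(1) *(2,1)] .
    have HF: "modhom x R x R (H \<bullet> F)" using * H by (blast intro: modhom_cmp)
    have FHF: "modhom x R y S (F \<bullet> H \<bullet> F)" using * HF by (blast intro: modhom_cmp)
    have "lift x R y S (F \<bullet> H \<bullet> F) = lift x R y S F"
      using G(2) unfolding H(2) cmp_lift[OF *(1,2,1,3) H(1)] cmp_lift[OF *(1,1,2) HF *(3)] .
    then show "\<exists>G. modhom y S x R G \<and> F \<bullet> G \<bullet> F = F" using H(1) lift_inject[OF FHF *(3)] by blast
  qed
next
  assume reg: modules_regular
  show "regular_category Mod_A" unfolding regular_category_def
  proof (intro allI impI)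
    fix F' assume "arr Mod_A F'"
    then have F': "in_hom Mod_A F' (source F') (target F')" by (simp add: in_hom_def)
    obtain x R where x: "source F' = (x, under R)" "modl x R" using MC_ObjE[OF in_homD(4)[OF F']] .
    obtain y S where y: "target F' = (y, under S)" "modl y S" using MC_ObjE[OF in_homD(5)[OF F']] .
    obtain F where F: "modhom x R y S F" "F' = lift x R y S F"
      using in_hom_ModE[OF _ x(2) y(2)] F' unfolding x(1) y(1) by blast
    obtain G where G: "modhom y S x R G" "F \<bullet> G \<bullet> F = F" using reg x(2) y(2) F(1)
        unfolding modules_regular_def by blast
    have GF: "modhom x R x R (G \<bullet> F)" using x y F G by (blast intro: modhom_cmp)
    have "comp_arr Mod_A F' (comp_arr Mod_A (lift y S x R G) F') = F'"
      unfolding F(2) cmp_lift[OF x(2) y(2) x(2) F(1) G(1)] cmp_lift[OF x(2) x(2) y(2) GF F(1)] G(2) ..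
    then show "\<exists>G. in_hom Mod_A G (target F') (source F') \<and> comp_arr Mod_A F' (comp_arr Mod_A G F') = F'"
      using in_hom_lift[OF y(2) x(2) G(1)] x y by auto
  qed
qed

text \<open>By \<open>stable\<close> the action sends \<open>k \<otimes> A\<close> back into
  \<open>k\<close>, and \<open>J\<close> intertwines the restricted action with \<open>R\<close>,
  from which the module axioms descend. \<open>P\<close> is a retraction in \<open>C\<close> only,
  so this covers right ideals cut out by an idempotent of \<open>C\<close>.\<close>

lemma modl_retract:
  assumes R: "modl x R" and J: "in_hom C J k x" and P: "in_hom C P x k" and PJ: "P \<bullet> J = ident C k"
    and stable: "R \<bullet> (J \<boxtimes> idA) = J \<bullet> P \<bullet> R \<bullet> (J \<boxtimes> idA)"
  shows "modl k (P \<bullet> R \<bullet> (J \<boxtimes> idA))" "modhom k (P \<bullet> R \<bullet> (J \<boxtimes> idA)) x R J"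
proof -
  let ?Q = "P \<bullet> R \<bullet> (J \<boxtimes> idA)"
  have [simp]: "arr C J" "source J = k" "target J = x" "arr C P" "source P = x" "target P = k" "k \<in> Obj C"
      "x \<in> Obj C"
    using J P by (auto dest: in_homD)
  note [simp] = modlD[OF R]
  have Q: "in_hom C ?Q (k \<otimes>\<^sub>o A) k" by (simp add: in_hom_def)
  have JQ: "J \<bullet> ?Q = R \<bullet> (J \<boxtimes> idA)" using stable by simp
  have assoc: "R \<bullet> (R \<boxtimes> idA) = R \<bullet> (ident C x \<boxtimes> Mu) \<bullet> alp C x A A" using R by (simp add: modl_def)
  have "?Q \<bullet> (?Q \<boxtimes> idA) = P \<bullet> R \<bullet> ((J \<bullet> ?Q) \<boxtimes> idA)" by simp
  also have "\<dots> = P \<bullet> R \<bullet> (R \<boxtimes> idA) \<bullet> ((J \<boxtimes> idA) \<boxtimes> idA)" unfolding JQ by simp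
  also have "\<dots> = P \<bullet> R \<bullet> (ident C x \<boxtimes> Mu) \<bullet> alp C x A A \<bullet> ((J \<boxtimes> idA) \<boxtimes> idA)"
    using cmp_eq_assoc[OF assoc] by (simp del: merge)
  also have "\<dots> = ?Q \<bullet> (ident C k \<boxtimes> Mu) \<bullet> alp C k A A"
    using alp_natural[of J idA idA] by simp
  finally have a: "?Q \<bullet> (?Q \<boxtimes> idA) = ?Q \<bullet> (ident C k \<boxtimes> Mu) \<bullet> alp C k A A" .
  have "?Q \<bullet> (ident C k \<boxtimes> Unt) = P \<bullet> R \<bullet> (ident C x \<boxtimes> Unt) \<bullet> (J \<boxtimes> ident C \<I>)" by simp
  also have "\<dots> = P \<bullet> run C x \<bullet> (J \<boxtimes> ident C \<I>)"
    using cmp_eq_assoc[of R "ident C x \<boxtimes> Unt" "run C x"] R by (simp add: modl_def del: merge)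
  also have "\<dots> = run C k" using run_natural[of J] cmp_eq_assoc[OF PJ] by simp
  finally show "modl k ?Q" using Q a unfolding modl_def by simp
  show "modhom k ?Q x R J" using JQ J by (simp add: modhom_def)
qed

lemma split_idempotents_MC:
  assumes "split_idempotents C"
  shows "split_idempotents Mod_A"
  unfolding split_idempotents_def
proof (intro allI impI)
  fix E' X assume E': "in_hom Mod_A E' X X" "comp_arr Mod_A E' E' = E'"
  obtain x R where x: "X = (x, under R)" "modl x R" using MC_ObjE[OF in_homD(4)[OF E'(1)]] .
  obtain E where E: "modhom x R x R E" "E' = lift x R x R E"
    using in_hom_ModE[OF _ x(2) x(2)] E' unfolding x(1) by blast
  have EE: "modhom x R x R (E \<bullet> E)" using E x by (blast intro: modhom_cmp)
  have "E \<bullet> E = E" using E'(2) unfolding E(2) cmp_lift[OF x(2,2,2) E(1,1)] lift_inject[OF EE E(1)] .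
  then obtain k P J where k: "in_hom C P x k" "in_hom C J k x" "J \<bullet> P = E" "P \<bullet> J = ident C k"
    using split_idempotentsE[OF assms] modhomD(4)[OF E(1)] by metis
  note [simp] = in_homD(1-5)[OF k(1)] in_homD(1-5)[OF k(2)] modlD[OF x(2)]
  \<comment> \<open>The module map \<open>E = J P\<close> commutes with the action and fixes
    \<open>J\<close>, which is the stability required for restricting the action.\<close>
  have EJ: "R \<bullet> (J \<boxtimes> idA) = J \<bullet> P \<bullet> R \<bullet> (J \<boxtimes> idA)"
  proof -
    have "J \<bullet> P \<bullet> R \<bullet> (J \<boxtimes> idA) = (E \<bullet> R) \<bullet> (J \<boxtimes> idA)" unfolding k(3)[symmetric] by simp
    also have "\<dots> = R \<bullet> ((J \<bullet> P \<bullet> J) \<boxtimes> idA)" unfolding modhomD(5)[OF E(1)] unfolding k(3)[symmetric] by simp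
    also have "\<dots> = R \<bullet> (J \<boxtimes> idA)" using k(4) by simp
    finally show ?thesis by simp
  qed
  let ?Q = "P \<bullet> R \<bullet> (J \<boxtimes> idA)"
  note Q = modl_retract[OF x(2) k(2,1,4) EJ]
  have "P \<bullet> R = P \<bullet> (J \<bullet> P) \<bullet> R" using cmp_eq_assoc[OF k(4), of "P \<bullet> R"] by simp
  also have "\<dots> = ?Q \<bullet> (P \<boxtimes> idA)" unfolding k(3) modhomD(5)[OF E(1)] unfolding k(3)[symmetric] by simp
  finally have P: "modhom x R k ?Q P" using k(1) by (simp add: modhom_def)
  have "comp_arr Mod_A (lift k ?Q x R J) (lift x R k ?Q P) = E'"
    unfolding cmp_lift[OF x(2) Q(1) x(2) P Q(2)] E(2) k(3) ..
  moreover have "comp_arr Mod_A (lift x R k ?Q P) (lift k ?Q x R J) = ident Mod_A (k, under ?Q)"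
    unfolding cmp_lift[OF Q(1) x(2) Q(1) Q(2) P] k(4) lift_ident ..
  ultimately show "\<exists>k P J. in_hom Mod_A P X k \<and> in_hom Mod_A J k X \<and> comp_arr Mod_A J P = E'
      \<and> comp_arr Mod_A P J = ident Mod_A k"
    using in_hom_lift[OF x(2) Q(1) P] in_hom_lift[OF Q(1) x(2) Q(2)] unfolding x(1) by blast
qed

text \<open>Parallel arrows into a zero object coincide, so the zero action satisfies the module
  axioms.\<close>

lemma zero_object_MC:
  assumes z: "zero_object C z"
  shows "\<exists>z. zero_object Mod_A z"
proof -
  have zO [simp]: "z \<in> Obj C" using z by (simp add: zero_object_def)
  have id: "ident C z = zero_arr C z z" using z by (simp add: zero_object_iff)
  have eq: "F = zero_arr C (source F) z" if "arr C F" "target F = z" for F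
    using that cmp_ident(2)[of F z] unfolding id by simp
  let ?R = "zero_arr C (z \<otimes>\<^sub>o A) z"
  have R: "modl z ?R" unfolding modl_def
    using eq[of "run C z"] by (simp add: in_hom_def)
  have "ident Mod_A (z, under ?R) = zero_arr Mod_A (z, under ?R) (z, under ?R)"
    unfolding lift_ident[symmetric] lift_zer[symmetric] id ..
  then show ?thesis using Mod_A.zero_object_iff[OF MC_ObjI[OF R]] by blast
qed

lemma biproduct_MC:
  assumes ab: "abelian_category C" and X: "X \<in> Obj Mod_A" and Y: "Y \<in> Obj Mod_A"
  shows "\<exists>x \<iota> \<pi>. is_biproduct Mod_A x 2 (\<lambda>j. if j = 0 then X else Y) \<iota> \<pi>"
proof -
  obtain x R where x: "X = (x, under R)" "modl x R" using X by (rule MC_ObjE)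
  obtain y S where y: "Y = (y, under S)" "modl y S" using Y by (rule MC_ObjE)
  obtain z J0 J1 P0 P1 where J: "in_hom C J0 x z" "in_hom C J1 y z" "in_hom C P0 z x" "in_hom C P1 z y"
    and PJ: "P0 \<bullet> J0 = ident C x" "P1 \<bullet> J1 = ident C y" "P0 \<bullet> J1 = zero_arr C y x" "P1 \<bullet> J0
        = zero_arr C x y"
    and sum: "J0 \<bullet> P0 \<boxplus> J1 \<bullet> P1 = ident C z"
    using biprod_2E[OF ab modlD(1)[OF x(2)] modlD(1)[OF y(2)]] .
  note [simp] = in_homD(1-5)[OF J(1)] in_homD(1-5)[OF J(2)] in_homD(1-3)[OF J(3)] in_homD(1-3)[OF J(4)]
    modlD[OF x(2)] modlD[OF y(2)] PJ cmp_eq_assoc[OF PJ(1)] cmp_eq_assoc[OF PJ(2)] cmp_eq_assoc[OF PJ(3)]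
        cmp_eq_assoc[OF PJ(4)]
  \<comment> \<open>Block-diagonal action; the module axioms are verified blockwise after the
    inclusions have absorbed \<open>T\<close> through \<open>TJ0\<close> and
    \<open>TJ1\<close>.\<close>
  define T where "T = J0 \<bullet> R \<bullet> (P0 \<boxtimes> idA) \<boxplus> J1 \<bullet> S \<bullet> (P1 \<boxtimes> idA)"
  have T [simp]: "arr C T" "source T = z \<otimes>\<^sub>o A" "target T = z" by (simp_all add: T_def)
  have TJ0: "T \<bullet> (J0 \<boxtimes> idA) = J0 \<bullet> R" by (simp add: T_def cmp_add_left)
  have TJ1: "T \<bullet> (J1 \<boxtimes> idA) = J1 \<bullet> S" by (simp add: T_def cmp_add_left)
  have Rax: "R \<bullet> (R \<boxtimes> idA) = R \<bullet> (ident C x \<boxtimes> Mu) \<bullet> alp C x A A" "R \<bullet> (ident C x \<boxtimes> Unt) = run C x"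
    using x(2) by (auto simp: modl_def)
  have Sax: "S \<bullet> (S \<boxtimes> idA) = S \<bullet> (ident C y \<boxtimes> Mu) \<bullet> alp C y A A" "S \<bullet> (ident C y \<boxtimes> Unt) = run C y"
    using y(2) by (auto simp: modl_def)
  have "T \<bullet> (T \<boxtimes> idA) = T \<bullet> (J0 \<boxtimes> idA) \<bullet> ((R \<bullet> (P0 \<boxtimes> idA)) \<boxtimes> idA) \<boxplus> T \<bullet> (J1 \<boxtimes> idA) \<bullet> ((S
      \<bullet> (P1 \<boxtimes> idA)) \<boxtimes> idA)"
  proof -
    have "T \<boxtimes> idA = (J0 \<bullet> R \<bullet> (P0 \<boxtimes> idA)) \<boxtimes> idA \<boxplus> (J1 \<bullet> S \<bullet> (P1 \<boxtimes> idA)) \<boxtimes> idA"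
      by (simp add: T_def tns_add_left)
    then show ?thesis by (simp add: cmp_add_right)
  qed
  also have "\<dots> = J0 \<bullet> R \<bullet> (R \<boxtimes> idA) \<bullet> ((P0 \<boxtimes> idA) \<boxtimes> idA) \<boxplus> J1 \<bullet> S \<bullet> (S \<boxtimes> idA) \<bullet> ((P1 \<boxtimes> idA) \<boxtimes> idA)"
    unfolding cmp_eq_assoc[OF TJ0] cmp_eq_assoc[OF TJ1] by simp
  also have "\<dots> = J0 \<bullet> R \<bullet> (ident C x \<boxtimes> Mu) \<bullet> alp C x A A \<bullet> ((P0 \<boxtimes> idA) \<boxtimes> idA) \<boxplus>
      J1 \<bullet> S \<bullet> (ident C y \<boxtimes> Mu) \<bullet> alp C y A A \<bullet> ((P1 \<boxtimes> idA) \<boxtimes> idA)"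
    using cmp_eq_assoc[OF Rax(1)] cmp_eq_assoc[OF Sax(1)] by (simp del: merge)
  also have "\<dots> = T \<bullet> (ident C z \<boxtimes> Mu) \<bullet> alp C z A A"
    using alp_natural[of P0 idA idA] alp_natural[of P1 idA idA] by (simp add: T_def cmp_add_left)
  finally have assoc: "T \<bullet> (T \<boxtimes> idA) = T \<bullet> (ident C z \<boxtimes> Mu) \<bullet> alp C z A A" .
  have "T \<bullet> (ident C z \<boxtimes> Unt) = J0 \<bullet> R \<bullet> (ident C x \<boxtimes> Unt) \<bullet> (P0 \<boxtimes> ident C \<I>) \<boxplus> J1 \<bullet> S \<bullet> (ident C y \<boxtimes> Unt)
      \<bullet> (P1 \<boxtimes> ident C \<I>)"
    by (simp add: T_def cmp_add_left)
  also have "\<dots> = J0 \<bullet> run C x \<bullet> (P0 \<boxtimes> ident C \<I>) \<boxplus> J1 \<bullet> run C y \<bullet> (P1 \<boxtimes> ident C \<I>)"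
    using cmp_eq_assoc[OF Rax(2)] cmp_eq_assoc[OF Sax(2)] by (simp del: merge)
  also have "\<dots> = (J0 \<bullet> P0 \<boxplus> J1 \<bullet> P1) \<bullet> run C z"
    using run_natural[of P0] run_natural[of P1] by (simp add: cmp_add_left)
  also have "\<dots> = run C z" unfolding sum by simp
  finally have Tm: "modl z T" using assoc by (simp add: modl_def in_hom_def)
  have h: "modhom x R z T J0" "modhom y S z T J1" using TJ0 TJ1 J by (auto simp: modhom_def)
  have g: "modhom z T x R P0" "modhom z T y S P1" using J by (auto simp: modhom_def T_def cmp_add_right)
  show ?thesis unfolding x(1) y(1)
  proof (rule Mod_A.biprod_2I)
    show "in_hom Mod_A (lift x R z T J0) (x, under R) (z, under T)"
        "in_hom Mod_A (lift y S z T J1) (y, under S) (z, under T)"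
      "in_hom Mod_A (lift z T x R P0) (z, under T) (x, under R)"
          "in_hom Mod_A (lift z T y S P1) (z, under T) (y, under S)"
      using x y Tm h g by (auto intro: in_hom_lift)
    show "comp_arr Mod_A (lift z T x R P0) (lift x R z T J0) = ident Mod_A (x, under R)"
      "comp_arr Mod_A (lift z T y S P1) (lift y S z T J1) = ident Mod_A (y, under S)"
      "comp_arr Mod_A (lift z T x R P0) (lift y S z T J1) = zero_arr Mod_A (y, under S) (x, under R)"
      "comp_arr Mod_A (lift z T y S P1) (lift x R z T J0) = zero_arr Mod_A (x, under R) (y, under S)"
      using x y Tm h g by (simp_all add: cmp_lift PJ lift_ident lift_zer)
    have "modhom z T z T (J0 \<bullet> P0)" "modhom z T z T (J1 \<bullet> P1)" using x y Tm h g
        by (blast intro: modhom_cmp)+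
    then show "add_arr Mod_A (comp_arr Mod_A (lift x R z T J0) (lift z T x R P0)) (comp_arr Mod_A (lift y S
        z T J1) (lift z T y S P1)) = ident Mod_A (z, under T)"
      using x y Tm h g by (simp add: cmp_lift lift_add sum lift_ident)
  qed
qed

text \<open>Zero object, biproducts and split idempotents lift from the base to modules, so only
  regularity has to be decided.\<close>

lemma semisimple_MC:
  assumes "semisimple_category C"
  shows "semisimple_category Mod_A \<longleftrightarrow> modules_regular"
proof
  assume "semisimple_category Mod_A"
  then show modules_regular using Mod_A.semisimple_imp_regular regular_category_MC by blast
next
  assume modules_regular
  have ab: "abelian_category C" using assms by (simp add: semisimple_category_def)
  then obtain z where z: "zero_object C z" unfolding abelian_category_def by blast
  show "semisimple_category Mod_A"
  proof (rule Mod_A.regular_imp_semisimple)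
    show "regular_category Mod_A" using \<open>modules_regular\<close> regular_category_MC by blast
    show "split_idempotents Mod_A" using semisimple_imp_split_idempotents[OF assms]
        by (rule split_idempotents_MC)
    show "\<exists>z. zero_object Mod_A z" using z by (rule zero_object_MC)
  qed (rule biproduct_MC[OF ab])
qed

section \<open>Free modules and their maps in Kleisli form\<close>

definition act :: "'o \<Rightarrow> ('o, 'm) arrow" where "act x = (ident C x \<boxtimes> Mu) \<bullet> alp C x A A"
definition eta :: "'o \<Rightarrow> ('o, 'm) arrow" where "eta x = (ident C x \<boxtimes> Unt) \<bullet> runi C x"
text \<open>Kleisli extension for the monad \<open>- \<otimes> A\<close>, whose multiplication and
  unit are \<open>act\<close> and \<open>eta\<close>: the module map between free modules that
  restricts to \<open>F\<close> along \<open>eta\<close>.\<close>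

definition ext :: "'o \<Rightarrow> ('o, 'm) arrow \<Rightarrow> ('o, 'm) arrow" where "ext y F = act y \<bullet> (F \<boxtimes> idA)"

lemma act_sel [simp]: "x \<in> Obj C \<Longrightarrow> arr C (act x)" "x \<in> Obj C \<Longrightarrow> source (act x) = (x \<otimes>\<^sub>o A) \<otimes>\<^sub>o A" "x \<in> Obj C
    \<Longrightarrow> target (act x) = x \<otimes>\<^sub>o A"
  by (simp_all add: act_def)

lemma eta_sel [simp]: "x \<in> Obj C \<Longrightarrow> arr C (eta x)" "x \<in> Obj C \<Longrightarrow> source (eta x) = x" "x \<in> Obj C
    \<Longrightarrow> target (eta x) = x \<otimes>\<^sub>o A"
  by (simp_all add: eta_def)

lemma modl_assoc: "modl x R \<Longrightarrow> R \<bullet> (R \<boxtimes> idA) = R \<bullet> act x"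
  by (simp add: modl_def act_def)

lemma modl_eta: "modl x R \<Longrightarrow> R \<bullet> eta x = ident C x"
  using cmp_eq_assoc[of R "ident C x \<boxtimes> Unt" "run C x"] by (simp add: modl_def eta_def)

lemma act_natural: "arr C F \<Longrightarrow> act (target F) \<bullet> ((F \<boxtimes> idA) \<boxtimes> idA) = (F \<boxtimes> idA) \<bullet> act (source F)"
  using alp_natural[of F idA idA] by (simp add: act_def)

lemma eta_natural: "arr C F \<Longrightarrow> eta (target F) \<bullet> F = (F \<boxtimes> idA) \<bullet> eta (source F)"
  by (simp add: eta_def runi_natural)

text \<open>Associativity is that of \<open>Mu\<close> carried through the pentagon; the unit law is
  that of \<open>Mu\<close> combined with \<open>run_tensor\<close>.\<close>

lemma modl_act:
  assumes [simp]: "x \<in> Obj C"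
  shows "modl (x \<otimes>\<^sub>o A) (act x)"
proof -
  let ?x = "ident C x"
  have "act x \<bullet> (act x \<boxtimes> idA) = (?x \<boxtimes> Mu) \<bullet> alp C x A A \<bullet> ((?x \<boxtimes> Mu) \<boxtimes> idA) \<bullet> (alp C x A A \<boxtimes> idA)"
    by (simp add: act_def)
  also have "\<dots> = (?x \<boxtimes> Mu) \<bullet> (?x \<boxtimes> (Mu \<boxtimes> idA)) \<bullet> alp C x (A \<otimes>\<^sub>o A) A \<bullet> (alp C x A A \<boxtimes> idA)"
    using cmp_eq_assoc[OF alp_natural[of ?x Mu idA]] by (simp del: merge)
  also have "\<dots> = (?x \<boxtimes> Mu) \<bullet> (?x \<boxtimes> (idA \<boxtimes> Mu)) \<bullet> (?x \<boxtimes> alp C A A A) \<bullet> alp C x (A \<otimes>\<^sub>o A) A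
      \<bullet> (alp C x A A \<boxtimes> idA)"
    using Mu_assoc by simp
  also have "\<dots> = (?x \<boxtimes> Mu) \<bullet> (?x \<boxtimes> (idA \<boxtimes> Mu)) \<bullet> alp C x A (A \<otimes>\<^sub>o A) \<bullet> alp C (x \<otimes>\<^sub>o A) A A"
    by (subst pentagon_arr) simp_all
  also have "\<dots> = (?x \<boxtimes> Mu) \<bullet> alp C x A A \<bullet> (ident C (x \<otimes>\<^sub>o A) \<boxtimes> Mu) \<bullet> alp C (x \<otimes>\<^sub>o A) A A"
    using cmp_eq_assoc[OF alp_natural[of ?x idA Mu]] by (simp del: merge)
  finally have 1: "act x \<bullet> (act x \<boxtimes> idA) = act x \<bullet> (ident C (x \<otimes>\<^sub>o A) \<boxtimes> Mu) \<bullet> alp C (x \<otimes>\<^sub>o A) A A"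
    by (simp add: act_def)
  have "act x \<bullet> (ident C (x \<otimes>\<^sub>o A) \<boxtimes> Unt) = (?x \<boxtimes> Mu) \<bullet> (?x \<boxtimes> (idA \<boxtimes> Unt)) \<bullet> alp C x A \<I>"
    using alp_natural[of ?x idA Unt] by (simp add: act_def del: merge)
  also have "\<dots> = run C (x \<otimes>\<^sub>o A)" by (simp add: Mu_right_unit run_tensor)
  finally have 2: "act x \<bullet> (ident C (x \<otimes>\<^sub>o A) \<boxtimes> Unt) = run C (x \<otimes>\<^sub>o A)" .
  show ?thesis unfolding modl_def by (intro conjI 1 2) (simp_all add: in_hom_def)
qed

lemma act_eta_tns:
  assumes [simp]: "x \<in> Obj C"
  shows "act x \<bullet> (eta x \<boxtimes> idA) = ident C (x \<otimes>\<^sub>o A)"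
proof -
  let ?x = "ident C x"
  have "act x \<bullet> (eta x \<boxtimes> idA) = (?x \<boxtimes> Mu) \<bullet> alp C x A A \<bullet> ((?x \<boxtimes> Unt) \<boxtimes> idA) \<bullet> (runi C x \<boxtimes> idA)"
    by (simp add: act_def eta_def)
  also have "\<dots> = (?x \<boxtimes> Mu) \<bullet> (?x \<boxtimes> (Unt \<boxtimes> idA)) \<bullet> alp C x \<I> A \<bullet> (runi C x \<boxtimes> idA)"
    using cmp_eq_assoc[OF alp_natural[of ?x Unt idA]] by (simp del: merge)
  also have "\<dots> = (?x \<boxtimes> lun C A) \<bullet> alp C x \<I> A \<bullet> (runi C x \<boxtimes> idA)"
    by (simp add: Mu_left_unit)
  also have "\<dots> = ident C (x \<otimes>\<^sub>o A)"
    using cmp_eq_assoc[OF triangle_arr[of x A]] by simp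
  finally show ?thesis .
qed

lemma ext_sel [simp]:
  assumes "in_hom C F x (y \<otimes>\<^sub>o A)" "y \<in> Obj C"
  shows "arr C (ext y F)" "source (ext y F) = x \<otimes>\<^sub>o A" "target (ext y F) = y \<otimes>\<^sub>o A"
  using assms by (simp_all add: ext_def in_hom_def)

text \<open>Half of the universal property of the free module on \<open>x\<close>;
  \<open>extend_eta\<close> and \<open>modhom_free_eq\<close> show that extension and restriction
  along \<open>eta\<close> are mutually inverse.\<close>

lemma modhom_extend:
  assumes S: "modl y S" and F: "in_hom C F x y"
  shows "modhom (x \<otimes>\<^sub>o A) (act x) y S (S \<bullet> (F \<boxtimes> idA))"
proof -
  note [simp] = modlD[OF S] in_homD(1-5)[OF F]
  have "(S \<bullet> (F \<boxtimes> idA)) \<bullet> act x = S \<bullet> act y \<bullet> ((F \<boxtimes> idA) \<boxtimes> idA)"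
    using act_natural[of F] by simp
  also have "\<dots> = S \<bullet> (S \<boxtimes> idA) \<bullet> ((F \<boxtimes> idA) \<boxtimes> idA)"
    using cmp_eq_assoc[OF modl_assoc[OF S]] by (simp del: merge)
  also have "\<dots> = S \<bullet> ((S \<bullet> (F \<boxtimes> idA)) \<boxtimes> idA)" by simp
  finally show ?thesis by (simp add: modhom_def in_hom_def)
qed

lemma extend_eta:
  assumes S: "modl y S" and F: "in_hom C F x y"
  shows "(S \<bullet> (F \<boxtimes> idA)) \<bullet> eta x = F"
proof -
  note [simp] = modlD[OF S] in_homD(1-5)[OF F]
  have "(S \<bullet> (F \<boxtimes> idA)) \<bullet> eta x = S \<bullet> eta y \<bullet> F" using eta_natural[of F] by simp
  also have "\<dots> = F" using cmp_eq_assoc[OF modl_eta[OF S]] by simp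
  finally show ?thesis .
qed

lemma modhom_free_eq:
  assumes S: "modl y S" and x: "x \<in> Obj C" and F: "modhom (x \<otimes>\<^sub>o A) (act x) y S F"
  shows "S \<bullet> ((F \<bullet> eta x) \<boxtimes> idA) = F"
proof -
  note [simp] = modlD[OF S] modhomD(1-3)[OF F] x
  have "S \<bullet> ((F \<bullet> eta x) \<boxtimes> idA) = S \<bullet> (F \<boxtimes> idA) \<bullet> (eta x \<boxtimes> idA)" by simp
  also have "\<dots> = F \<bullet> act x \<bullet> (eta x \<boxtimes> idA)"
    using cmp_eq_assoc[OF modhomD(5)[OF F], of "eta x \<boxtimes> idA"] by (simp del: merge)
  also have "\<dots> = F" by (simp add: act_eta_tns)
  finally show ?thesis .
qed

lemma modhom_ext: "in_hom C F x (y \<otimes>\<^sub>o A) \<Longrightarrow> y \<in> Obj C \<Longrightarrow> modhom (x \<otimes>\<^sub>o A) (act x) (y \<otimes>\<^sub>o A) (act y) (ext y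
    F)"
  unfolding ext_def by (rule modhom_extend[OF modl_act])

lemma ext_eta: "in_hom C F x (y \<otimes>\<^sub>o A) \<Longrightarrow> y \<in> Obj C \<Longrightarrow> ext y F \<bullet> eta x = F"
  unfolding ext_def by (rule extend_eta[OF modl_act])

lemma ext_modhom: "x \<in> Obj C \<Longrightarrow> y \<in> Obj C \<Longrightarrow> modhom (x \<otimes>\<^sub>o A) (act x) (y \<otimes>\<^sub>o A) (act y) F \<Longrightarrow> ext y (F \<bullet> eta x)
    = F"
  unfolding ext_def by (rule modhom_free_eq[OF modl_act])

text \<open>The right-hand side is a module map out of a free module, hence is the extension of its
  own restriction along \<open>eta\<close>.\<close>

lemma ext_ext:
  assumes F: "in_hom C F x (y \<otimes>\<^sub>o A)" and G: "in_hom C G y (z \<otimes>\<^sub>o A)" and yz: "y \<in> Obj C" "z \<in> Obj C"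
  shows "ext z (ext z G \<bullet> F) = ext z G \<bullet> ext y F"
proof -
  have x: "x \<in> Obj C" using F by (auto dest: in_homD)
  have "modhom (x \<otimes>\<^sub>o A) (act x) (z \<otimes>\<^sub>o A) (act z) (ext z G \<bullet> ext y F)"
    using modhom_cmp[OF modl_act modl_act modl_act modhom_ext[OF F] modhom_ext[OF G]] x yz by simp
  from ext_modhom[OF x yz(2) this] show ?thesis using ext_eta[OF F yz(1)] by simp
qed

text \<open>Regularity \<open>f g f = f\<close> for maps of free modules, restricted along
  \<open>eta x\<close>. In this form it involves arrows of \<open>C\<close> alone, ready to be
  carried across the adjunction.\<close>

definition kleisli_regular :: bool
  where "kleisli_regular \<longleftrightarrow> (\<forall>x\<in>Obj C. \<forall>y\<in>Obj C. \<forall>F. in_hom C F x (y \<otimes>\<^sub>o A) \<longrightarrow>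
    (\<exists>G. in_hom C G y (x \<otimes>\<^sub>o A) \<and> ext y F \<bullet> ext x G \<bullet> F = F))"

lemma modregular_imp_klregular:
  assumes modules_regular
  shows kleisli_regular
  unfolding kleisli_regular_def
proof (intro ballI allI impI)
  fix x y F assume xy: "x \<in> Obj C" "y \<in> Obj C" and F: "in_hom C F x (y \<otimes>\<^sub>o A)"
  obtain G where G: "modhom (y \<otimes>\<^sub>o A) (act y) (x \<otimes>\<^sub>o A) (act x) G" "ext y F \<bullet> G \<bullet> ext y F = ext y F"
    using assms modl_act[OF xy(1)] modl_act[OF xy(2)] modhom_ext[OF F xy(2)] unfolding modules_regular_def
        by blast
  note Gd = modhomD(1-3)[OF G(1)]
  have "ext y F \<bullet> G \<bullet> F = (ext y F \<bullet> G \<bullet> ext y F) \<bullet> eta x" using ext_eta[OF F xy(2)] by simp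
  also have "\<dots> = F" unfolding G(2) by (rule ext_eta[OF F xy(2)])
  finally have "ext y F \<bullet> ext x (G \<bullet> eta y) \<bullet> F = F" using ext_modhom[OF xy(2,1) G(1)] by simp
  moreover have "in_hom C (G \<bullet> eta y) y (x \<otimes>\<^sub>o A)" using Gd xy by (simp add: in_hom_def)
  ultimately show "\<exists>G. in_hom C G y (x \<otimes>\<^sub>o A) \<and> ext y F \<bullet> ext x G \<bullet> F = F" by blast
qed

lemma klregular_free:
  assumes kleisli_regular and xy: "x \<in> Obj C" "y \<in> Obj C"
      and F: "modhom (x \<otimes>\<^sub>o A) (act x) (y \<otimes>\<^sub>o A) (act y) F"
  obtains G where "modhom (y \<otimes>\<^sub>o A) (act y) (x \<otimes>\<^sub>o A) (act x) G" "F \<bullet> G \<bullet> F = F"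
proof -
  note Fd = modhomD(1-3)[OF F]
  have Fe: "in_hom C (F \<bullet> eta x) x (y \<otimes>\<^sub>o A)" using Fd xy by (simp add: in_hom_def)
  obtain G where G: "in_hom C G y (x \<otimes>\<^sub>o A)" "ext y (F \<bullet> eta x) \<bullet> ext x G \<bullet> F \<bullet> eta x = F \<bullet> eta x"
    using assms(1) xy Fe unfolding kleisli_regular_def by blast
  have GF: "in_hom C (ext x G \<bullet> F \<bullet> eta x) x (x \<otimes>\<^sub>o A)" using Fe ext_sel[OF G(1) xy(1)]
      by (simp add: in_hom_def)
  have "F = ext y (F \<bullet> eta x)" using ext_modhom[OF xy F] by simp
  also have "\<dots> = ext y (ext y (F \<bullet> eta x) \<bullet> ext x G \<bullet> F \<bullet> eta x)" unfolding G(2) ..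
  also have "\<dots> = F \<bullet> ext x G \<bullet> F"
    by (simp only: ext_ext[OF GF Fe xy] ext_ext[OF Fe G(1) xy(2,1)]) (simp only: ext_modhom[OF xy F])
  finally have "F \<bullet> ext x G \<bullet> F = F" by simp
  then show thesis using that modhom_ext[OF G(1) xy(1)] by blast
qed

text \<open>A module \<open>x\<close> is the coequalizer of two maps from \<open>(x \<otimes> A) \<otimes> A\<close> to \<open>x \<otimes> A\<close>; their difference
  is regular, so the coequalizer splits.\<close>

lemma free_retract:
  assumes kl: kleisli_regular and R: "modl x R"
  obtains S where "modhom x R (x \<otimes>\<^sub>o A) (act x) S" "R \<bullet> S = ident C x"
proof -
  note [simp] = modlD[OF R]
  let ?y = "x \<otimes>\<^sub>o A"
  let ?V = "R \<boxtimes> idA"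
  have my: "modl ?y (act x)" and mz: "modl (?y \<otimes>\<^sub>o A) (act ?y)" by (simp_all add: modl_act)
  have V: "modhom (?y \<otimes>\<^sub>o A) (act ?y) ?y (act x) ?V"
    using act_natural[of R] by (simp add: modhom_def in_hom_def)
  have U: "modhom (?y \<otimes>\<^sub>o A) (act ?y) ?y (act x) (act x)"
    using modl_assoc[OF my] by (simp add: modhom_def in_hom_def)
  \<comment> \<open>Difference of the two parallel maps \<open>act x\<close> and \<open>?V\<close>,
    which \<open>R\<close> coequalizes.\<close>
  define Q where "Q = act x \<boxplus> neg_arr C ?V"
  have Q: "modhom (?y \<otimes>\<^sub>o A) (act ?y) ?y (act x) Q"
    unfolding Q_def by (intro modhom_add modhom_neg my mz U V)
  obtain G where G: "modhom ?y (act x) (?y \<otimes>\<^sub>o A) (act ?y) G" "Q \<bullet> G \<bullet> Q = Q"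
    using klregular_free[OF kl _ _ Q] by auto
  note [simp] = modhomD(1-3)[OF Q] modhomD(1-3)[OF G(1)]
  \<comment> \<open>Module idempotent killing \<open>Q\<close>, hence equalizing the two maps from
    the left; it turns out to be \<open>S \<bullet> R\<close>.\<close>
  define P where "P = ident C ?y \<boxplus> neg_arr C (Q \<bullet> G)"
  have P: "modhom ?y (act x) ?y (act x) P"
    unfolding P_def by (intro modhom_add modhom_neg modhom_ident modhom_cmp[OF my mz my] my G(1) Q)
  note [simp] = modhomD(1-3)[OF P]
  have PQ: "P \<bullet> Q = zero_arr C (?y \<otimes>\<^sub>o A) ?y" by (simp add: P_def cmp_add_left G(2))
  have "P \<bullet> act x \<boxplus> neg_arr C (P \<bullet> ?V) = zero_arr C (?y \<otimes>\<^sub>o A) ?y"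
    using PQ by (simp add: Q_def cmp_add_right)
  then have PU: "P \<bullet> act x = P \<bullet> ?V" by (rule eq_of_add_neg_eq_zer) simp_all
  have RQ: "R \<bullet> Q = zero_arr C (?y \<otimes>\<^sub>o A) x"
    by (simp add: Q_def cmp_add_right modl_assoc[OF R])
  have RP: "R \<bullet> P = R" using cmp_eq_assoc[OF RQ, of G] by (simp add: P_def cmp_add_right)
  \<comment> \<open>\<open>eta x\<close> is a section of \<open>R\<close> in \<open>C\<close> but
    not a module map; composing with \<open>P\<close> corrects this without spoiling
    \<open>R \<bullet> S\<close>, because \<open>R \<bullet> P = R\<close>.\<close>
  define S where "S = P \<bullet> eta x"
  have S [simp]: "arr C S" "source S = x" "target S = ?y" by (simp_all add: S_def)
  have RS: "R \<bullet> S = ident C x" using cmp_eq_assoc[OF RP] by (simp add: S_def modl_eta[OF R])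
  have SR: "S \<bullet> R = P"
  proof -
    have "S \<bullet> R = P \<bullet> ?V \<bullet> eta ?y" using eta_natural[of R] by (simp add: S_def)
    also have "\<dots> = P \<bullet> act x \<bullet> eta ?y" using cmp_eq_assoc[OF PU] by simp
    also have "\<dots> = P" by (simp add: modl_eta[OF my])
    finally show ?thesis .
  qed
  \<comment> \<open>Checked after precomposing with \<open>?V\<close>, which has the right inverse
    \<open>eta x \<boxtimes> idA\<close>; there it becomes the module property of
    \<open>P\<close>.\<close>
  have "S \<bullet> R = act x \<bullet> (S \<boxtimes> idA)"
  proof (rule cancel_right[of _ ?V _ "eta x \<boxtimes> idA" ?y])
    have "(S \<bullet> R) \<bullet> ?V = act x \<bullet> (P \<boxtimes> idA)" unfolding SR PU[symmetric] by (rule modhomD(5)[OF P])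
    then show "(S \<bullet> R) \<bullet> ?V = (act x \<bullet> (S \<boxtimes> idA)) \<bullet> ?V" by (simp add: SR)
    show "?V \<bullet> (eta x \<boxtimes> idA) = ident C ?y" by (simp add: modl_eta[OF R])
  qed simp_all
  then have "modhom x R ?y (act x) S" by (simp add: modhom_def in_hom_def)
  then show thesis using RS by (rule that)
qed

text \<open>A module map \<open>F\<close> is inflated to the map \<open>T F R\<close> of free
  modules. If \<open>G\<close> is a quasi-inverse of that, then \<open>R G T\<close> is one of
  \<open>F\<close>, because \<open>S T\<close> and \<open>R W\<close> are identities.\<close>

lemma klregular_imp_modregular:
  assumes kleisli_regular
  shows modules_regular
  unfolding modules_regular_def
proof (intro allI impI)
  fix x R y S F assume R: "modl x R" and S: "modl y S" and F: "modhom x R y S F"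
  have xy: "x \<in> Obj C" "y \<in> Obj C" using R S by auto
  have fx: "modl (x \<otimes>\<^sub>o A) (act x)" "modl (y \<otimes>\<^sub>o A) (act y)" using xy by (simp_all add: modl_act)
  obtain T where T: "modhom y S (y \<otimes>\<^sub>o A) (act y) T" "S \<bullet> T = ident C y"
    using free_retract[OF assms S] .
  obtain W where W: "modhom x R (x \<otimes>\<^sub>o A) (act x) W" "R \<bullet> W = ident C x"
    using free_retract[OF assms R] .
  have Rh: "modhom (x \<otimes>\<^sub>o A) (act x) x R R" and Sh: "modhom (y \<otimes>\<^sub>o A) (act y) y S S"
    using R S modl_assoc by (auto simp: modhom_def in_hom_def)
  have TF: "modhom x R (y \<otimes>\<^sub>o A) (act y) (T \<bullet> F)" using modhom_cmp[OF R S fx(2) F T(1)] .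
  have TFR: "modhom (x \<otimes>\<^sub>o A) (act x) (y \<otimes>\<^sub>o A) (act y) ((T \<bullet> F) \<bullet> R)"
      using modhom_cmp[OF fx(1) R fx(2) Rh TF] .
  obtain G where G: "modhom (y \<otimes>\<^sub>o A) (act y) (x \<otimes>\<^sub>o A) (act x) G" "((T \<bullet> F) \<bullet> R) \<bullet> G \<bullet> (T \<bullet> F) \<bullet> R = (T
      \<bullet> F) \<bullet> R"
    using klregular_free[OF assms xy TFR] .
  note [simp] = modlD[OF R] modlD[OF S] modhomD(1-3)[OF F] modhomD(1-3)[OF T(1)] modhomD(1-3)[OF W(1)]
      modhomD(1-3)[OF G(1)]
  have GT: "modhom y S (x \<otimes>\<^sub>o A) (act x) (G \<bullet> T)" using modhom_cmp[OF S fx(2) fx(1) T(1) G(1)] .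
  have RGT: "modhom y S x R (R \<bullet> G \<bullet> T)" using modhom_cmp[OF S fx(1) R GT Rh] .
  have "S \<bullet> (((T \<bullet> F) \<bullet> R) \<bullet> G \<bullet> (T \<bullet> F) \<bullet> R) \<bullet> W = S \<bullet> ((T \<bullet> F) \<bullet> R) \<bullet> W" unfolding G(2) ..
  then have "F \<bullet> (R \<bullet> G \<bullet> T) \<bullet> F = F"
    using cmp_eq_assoc[OF T(2)] W(2) by simp
  then show "\<exists>G. modhom y S x R G \<and> F \<bullet> G \<bullet> F = F" using RGT by blast
qed

theorem semisimple_algebra_iff:
  assumes "semisimple_category C"
  shows "semisimple_algebra C A m i \<longleftrightarrow> kleisli_regular"
  using semisimple_MC[OF assms] algebra modregular_imp_klregular klregular_imp_modregular
  unfolding semisimple_algebra_def by blast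

end

section \<open>The algebra structure on the image of the right adjoint\<close>

definition fmap :: "('o, 'm, 'k, 'y) linear_cat_scheme \<Rightarrow> ('o, 'm, 'p, 'n, 'w) functor_data_scheme \<Rightarrow> ('o, 'm)
    arrow \<Rightarrow> ('p, 'n) arrow"
  where "fmap C F X = (if arr C X then mk_arr (on_obj F (source X)) (on_mor F (under X)) (on_obj F (target
      X)) else None)"

context linear_functor begin

declare on_obj_closed [simp]

lemma fmap_mod_hom: "\<lbrakk>a \<in> Obj C; b \<in> Obj C\<rbrakk> \<Longrightarrow> mod_hom K (Hom C a b) (Hom D (on_obj F a) (on_obj F b))
    (on_mor F)"
  by (simp add: mod_hom_def mod_hom_axioms_def src.hom_module tgt.hom_module on_mor_linear)

lemma on_mor_mor: "\<lbrakk>a \<in> Obj C; b \<in> Obj C; f \<in> mor C a b\<rbrakk> \<Longrightarrow> on_mor F f \<in> mor D (on_obj F a) (on_obj F b)"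
  using module_hom_closed[OF on_mor_linear[of a b]] by auto

lemma arr_fmap [simp]: "arr D (fmap C F X) \<longleftrightarrow> arr C X"
  using on_mor_mor[of "source X" "target X" "under X"] arr_und[of C X] by (auto simp: fmap_def)

lemma fmap_sel [simp]:
  "arr C X \<Longrightarrow> source (fmap C F X) = on_obj F (source X)"
  "arr C X \<Longrightarrow> target (fmap C F X) = on_obj F (target X)"
  "arr C X \<Longrightarrow> under (fmap C F X) = on_mor F (under X)"
  by (simp_all add: fmap_def)

lemma fmap_ident [simp]: "a \<in> Obj C \<Longrightarrow> fmap C F (ident C a) = ident D (on_obj F a)"
  by (intro arr_eqI[of D]) (simp_all add: on_mor_id)

lemma fmap_cmp:
  assumes "arr C X" "arr C Y" "target X = source Y"
  shows "fmap C F (Y \<bullet>\<^bsub>C\<^esub> X) = fmap C F Y \<bullet>\<^bsub>D\<^esub> fmap C F X"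
  using assms on_mor_comp[of "source X" "target X" "target Y" "under X"
      "under Y"] arr_und[of C X] arr_und[of C Y]
  by (intro arr_eqI[of D]) simp_all

end

locale monoidal_adjunction = tensor_functor K C D F + linear_adjunction K C D F G \<eta> \<epsilon>
  for K :: "('k, 'z) ring_scheme" and C :: "('o, 'm, 'k, 'y) tensor_cat_scheme"
    and D :: "('p, 'n, 'k, 'x) tensor_cat_scheme" (structure)
    and F :: "('o, 'm, 'p, 'n, 'w) tensor_functor_data_scheme"
    and G :: "('p, 'n, 'o, 'm, 'v) functor_data_scheme" and \<eta> :: "'o \<Rightarrow> 'm" and \<epsilon> :: "'p \<Rightarrow> 'n"
begin

section \<open>Duals and transposition under a strong monoidal functor\<close>

abbreviation Fo where "Fo \<equiv> on_obj F"
abbreviation Go where "Go \<equiv> on_obj G"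
abbreviation Fm where "Fm \<equiv> fmap C F"
abbreviation Gm where "Gm \<equiv> fmap D G"

definition J :: "'o \<Rightarrow> 'o \<Rightarrow> ('p, 'n) arrow" where "J a b = mk_arr (Fo a \<otimes>\<^sub>o Fo b) (tens_iso F a b) (Fo (a
    \<otimes>\<^sub>o\<^bsub>C\<^esub> b))"
definition u :: "('p, 'n) arrow" where "u = mk_arr \<I> (unit_iso F) (Fo \<I>\<^bsub>C\<^esub>)"
abbreviation "Ji a b \<equiv> inv_arr D (J a b)"
abbreviation "ui \<equiv> inv_arr D u"

lemma J_sel [simp]:
  "source (J a b) = Fo a \<otimes>\<^sub>o Fo b" "target (J a b) = Fo (a \<otimes>\<^sub>o\<^bsub>C\<^esub> b)" "under (J a b) = tens_iso F a b"
  "source (Ji a b) = Fo (a \<otimes>\<^sub>o\<^bsub>C\<^esub> b)" "target (Ji a b) = Fo a \<otimes>\<^sub>o Fo b"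
  "source u = \<I>" "target u = Fo \<I>\<^bsub>C\<^esub>" "under u = unit_iso F" "source ui = Fo \<I>\<^bsub>C\<^esub>" "target ui = \<I>"
  by (simp_all add: J_def u_def inv_arr_def)

lemma J_inv [simp]:
  assumes "a \<in> Obj C" "b \<in> Obj C"
  shows "arr D (J a b)" "arr D (Ji a b)" "Ji a b \<bullet> J a b = ident D (Fo a \<otimes>\<^sub>o Fo b)" "J a b \<bullet> Ji a b
      = ident D (Fo (a \<otimes>\<^sub>o\<^bsub>C\<^esub> b))"
  using tgt.inv_arr[OF tens_iso_iso[OF assms]] assms by (auto simp: J_def in_hom_def)

lemma u_inv [simp]: "arr D u" "arr D ui" "ui \<bullet> u = ident D \<I>" "u \<bullet> ui = ident D (Fo \<I>\<^bsub>C\<^esub>)"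
  using tgt.inv_arr[OF unit_iso_iso] by (auto simp: u_def in_hom_def)

lemma J_inv_assoc [simp]:
  "\<lbrakk>a \<in> Obj C; b \<in> Obj C; arr D X; target X = Fo a \<otimes>\<^sub>o Fo b\<rbrakk> \<Longrightarrow> Ji a b \<bullet> J a b \<bullet> X = X"
  "\<lbrakk>a \<in> Obj C; b \<in> Obj C; arr D X; target X = Fo (a \<otimes>\<^sub>o\<^bsub>C\<^esub> b)\<rbrakk> \<Longrightarrow> J a b \<bullet> Ji a b \<bullet> X = X"
  "\<lbrakk>arr D X; target X = \<I>\<rbrakk> \<Longrightarrow> ui \<bullet> u \<bullet> X = X"
  "\<lbrakk>arr D X; target X = Fo \<I>\<^bsub>C\<^esub>\<rbrakk> \<Longrightarrow> u \<bullet> ui \<bullet> X = X"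
  by (simp_all add: tgt.cmp_eq_assoc[OF J_inv(3)] tgt.cmp_eq_assoc[OF J_inv(4)] tgt.cmp_eq_assoc[OF
      u_inv(3)] tgt.cmp_eq_assoc[OF u_inv(4)])

lemma J_natural:
  assumes "arr C X" "arr C Y"
  shows "Fm (X \<boxtimes>\<^bsub>C\<^esub> Y) \<bullet> J (source X) (source Y) = J (target X) (target Y) \<bullet> (Fm X \<boxtimes> Fm Y)"
  using assms tens_iso_natural[of "source X" "source Y" "target X" "target Y" "under X"
      "under Y"] arr_und[of C X] arr_und[of C Y]
  by (intro arr_eqI[of D]) simp_all

lemma Ji_natural:
  assumes "arr C X" "arr C Y"
  shows "Ji (target X) (target Y) \<bullet> Fm (X \<boxtimes>\<^bsub>C\<^esub> Y) = (Fm X \<boxtimes> Fm Y) \<bullet> Ji (source X) (source Y)"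
proof -
  have "Ji (target X) (target Y) \<bullet> Fm (X \<boxtimes>\<^bsub>C\<^esub> Y) = Ji (target X) (target Y) \<bullet> (Fm (X \<boxtimes>\<^bsub>C\<^esub> Y)
      \<bullet> J (source X) (source Y)) \<bullet> Ji (source X) (source Y)"
    using assms by simp
  also have "\<dots> = (Fm X \<boxtimes> Fm Y) \<bullet> Ji (source X) (source Y)" unfolding J_natural[OF assms] using assms by simp
  finally show ?thesis .
qed

lemma J_assoc:
  assumes "a \<in> Obj C" "b \<in> Obj C" "c \<in> Obj C"
  shows "Fm (alp C a b c) \<bullet> J (a \<otimes>\<^sub>o\<^bsub>C\<^esub> b) c \<bullet> (J a b \<boxtimes> ident D (Fo c))
    = J a (b \<otimes>\<^sub>o\<^bsub>C\<^esub> c) \<bullet> (ident D (Fo a) \<boxtimes> J b c) \<bullet> alp D (Fo a) (Fo b) (Fo c)"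
proof -
  have "(Fm (alp C a b c) \<bullet> J (a \<otimes>\<^sub>o\<^bsub>C\<^esub> b) c) \<bullet> (J a b \<boxtimes> ident D (Fo c))
    = (J a (b \<otimes>\<^sub>o\<^bsub>C\<^esub> c) \<bullet> (ident D (Fo a) \<boxtimes> J b c)) \<bullet> alp D (Fo a) (Fo b) (Fo c)"
    using tens_iso_assoc[OF assms] assms by (intro arr_eqI[of D]) (simp_all del: tgt.cmp_assoc)
  then show ?thesis by simp
qed

lemma Ji_assoc:
  assumes [simp]: "a \<in> Obj C" "b \<in> Obj C" "c \<in> Obj C"
  shows "(ident D (Fo a) \<boxtimes> Ji b c) \<bullet> Ji a (b \<otimes>\<^sub>o\<^bsub>C\<^esub> c) \<bullet> Fm (alp C a b c)
    = alp D (Fo a) (Fo b) (Fo c) \<bullet> (Ji a b \<boxtimes> ident D (Fo c)) \<bullet> Ji (a \<otimes>\<^sub>o\<^bsub>C\<^esub> b) c"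
proof -
  have "(ident D (Fo a) \<boxtimes> Ji b c) \<bullet> Ji a (b \<otimes>\<^sub>o\<^bsub>C\<^esub> c) \<bullet> Fm (alp C a b c)
    = (ident D (Fo a) \<boxtimes> Ji b c) \<bullet> Ji a (b \<otimes>\<^sub>o\<^bsub>C\<^esub> c) \<bullet> (Fm (alp C a b c) \<bullet> J (a \<otimes>\<^sub>o\<^bsub>C\<^esub> b) c
        \<bullet> (J a b \<boxtimes> ident D (Fo c)))
      \<bullet> (Ji a b \<boxtimes> ident D (Fo c)) \<bullet> Ji (a \<otimes>\<^sub>o\<^bsub>C\<^esub> b) c"
    by simp
  also have "\<dots> = alp D (Fo a) (Fo b) (Fo c) \<bullet> (Ji a b \<boxtimes> ident D (Fo c)) \<bullet> Ji (a \<otimes>\<^sub>o\<^bsub>C\<^esub> b) c"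
    unfolding J_assoc[OF assms] by simp
  finally show ?thesis .
qed

lemma Fm_alpi_J:
  assumes [simp]: "a \<in> Obj C" "b \<in> Obj C" "c \<in> Obj C"
  shows "Fm (alpi C a b c) \<bullet> J a (b \<otimes>\<^sub>o\<^bsub>C\<^esub> c)
    = J (a \<otimes>\<^sub>o\<^bsub>C\<^esub> b) c \<bullet> (J a b \<boxtimes> ident D (Fo c)) \<bullet> alpi D (Fo a) (Fo b) (Fo c) \<bullet> (ident D (Fo a) \<boxtimes> Ji b c)"
proof -
  have inv: "Fm (alpi C a b c) \<bullet> Fm (alp C a b c) = ident D (Fo ((a \<otimes>\<^sub>o\<^bsub>C\<^esub> b) \<otimes>\<^sub>o\<^bsub>C\<^esub> c))"
    by (subst fmap_cmp[symmetric]) simp_all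
  have "Fm (alpi C a b c) \<bullet> J a (b \<otimes>\<^sub>o\<^bsub>C\<^esub> c)
    = Fm (alpi C a b c) \<bullet> (J a (b \<otimes>\<^sub>o\<^bsub>C\<^esub> c) \<bullet> (ident D (Fo a) \<boxtimes> J b c) \<bullet> alp D (Fo a) (Fo b) (Fo c)) \<bullet>
       alpi D (Fo a) (Fo b) (Fo c) \<bullet> (ident D (Fo a) \<boxtimes> Ji b c)"
    by simp
  also have "\<dots> = J (a \<otimes>\<^sub>o\<^bsub>C\<^esub> b) c \<bullet> (J a b \<boxtimes> ident D (Fo c)) \<bullet> alpi D (Fo a) (Fo b) (Fo c)
      \<bullet> (ident D (Fo a) \<boxtimes> Ji b c)"
    unfolding J_assoc[symmetric, OF assms] using tgt.cmp_eq_assoc[OF inv] by simp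
  finally show ?thesis .
qed

lemma Fm_lun:
  assumes [simp]: "a \<in> Obj C"
  shows "Fm (lun C a) \<bullet> J \<I>\<^bsub>C\<^esub> a = lun D (Fo a) \<bullet> (ui \<boxtimes> ident D (Fo a))"
proof -
  have "(Fm (lun C a) \<bullet> J \<I>\<^bsub>C\<^esub> a) \<bullet> (u \<boxtimes> ident D (Fo a)) = lun D (Fo a)"
    using unit_iso_left[of a] by (intro arr_eqI[of D]) (simp_all del: tgt.cmp_assoc)
  from tgt.cmp_eq_assoc[OF this, of "ui \<boxtimes> ident D (Fo a)"] show ?thesis by simp
qed

lemma Fm_run:
  assumes [simp]: "a \<in> Obj C"
  shows "Fm (run C a) \<bullet> J a \<I>\<^bsub>C\<^esub> = run D (Fo a) \<bullet> (ident D (Fo a) \<boxtimes> ui)"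
proof -
  have "(Fm (run C a) \<bullet> J a \<I>\<^bsub>C\<^esub>) \<bullet> (ident D (Fo a) \<boxtimes> u) = run D (Fo a)"
    using unit_iso_right[of a] by (intro arr_eqI[of D]) (simp_all del: tgt.cmp_assoc)
  from tgt.cmp_eq_assoc[OF this, of "ident D (Fo a) \<boxtimes> ui"] show ?thesis by simp
qed

lemma Fm_run_Ji:
  assumes [simp]: "a \<in> Obj C"
  shows "run D (Fo a) \<bullet> (ident D (Fo a) \<boxtimes> ui) \<bullet> Ji a \<I>\<^bsub>C\<^esub> = Fm (run C a)"
  using tgt.cmp_eq_assoc[OF Fm_run[OF assms], of "Ji a \<I>\<^bsub>C\<^esub>"] by simp

lemma Fm_lun_u:
  assumes [simp]: "a \<in> Obj C"
  shows "Fm (lun C a) \<bullet> J \<I>\<^bsub>C\<^esub> a \<bullet> (u \<boxtimes> ident D (Fo a)) = lun D (Fo a)"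
  using tgt.cmp_eq_assoc[OF Fm_lun[OF assms], of "u \<boxtimes> ident D (Fo a)"] by simp

text \<open>A strong monoidal functor preserves duals: with \<open>cv\<close> and \<open>ev\<close>
  conjugated by the coherence isomorphisms, \<open>Ji_assoc\<close> and naturality gather the whole
  zig-zag under \<open>Fm\<close>, and the unit coherences absorb \<open>u\<close> and
  \<open>ui\<close>.\<close>

lemma zigzag_image:
  assumes z: "src.zigzag_obj a d cv ev"
  shows "tgt.zigzag_obj (Fo a) (Fo d) (Ji a d \<bullet> Fm cv \<bullet> u) (ui \<bullet> Fm ev \<bullet> J d a)"
proof -
  have [simp]: "a \<in> Obj C" "d \<in> Obj C" and cv: "in_hom C cv \<I>\<^bsub>C\<^esub> (a \<otimes>\<^sub>o\<^bsub>C\<^esub> d)"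
      and ev: "in_hom C ev (d \<otimes>\<^sub>o\<^bsub>C\<^esub> a) \<I>\<^bsub>C\<^esub>"
    and z1: "run C a \<bullet>\<^bsub>C\<^esub> (ident C a \<boxtimes>\<^bsub>C\<^esub> ev) \<bullet>\<^bsub>C\<^esub> alp C a d a \<bullet>\<^bsub>C\<^esub> (cv \<boxtimes>\<^bsub>C\<^esub> ident C a) = lun C a"
    using z by (auto simp: src.zigzag_obj_def)
  note [simp] = in_homD(1-3)[OF cv] in_homD(1-3)[OF ev]
  let ?a = "ident D (Fo a)"
  have "run D (Fo a) \<bullet> (?a \<boxtimes> (ui \<bullet> Fm ev \<bullet> J d a)) \<bullet> alp D (Fo a) (Fo d) (Fo a) \<bullet> ((Ji a d \<bullet> Fm cv
      \<bullet> u) \<boxtimes> ?a)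
    = run D (Fo a) \<bullet> (?a \<boxtimes> ui) \<bullet> (?a \<boxtimes> Fm ev) \<bullet> (?a \<boxtimes> J d a) \<bullet> (alp D (Fo a) (Fo d) (Fo a) \<bullet> (Ji a d \<boxtimes> ?a)
        \<bullet> Ji (a \<otimes>\<^sub>o\<^bsub>C\<^esub> d) a)
      \<bullet> J (a \<otimes>\<^sub>o\<^bsub>C\<^esub> d) a \<bullet> (Fm cv \<boxtimes> ?a) \<bullet> (u \<boxtimes> ?a)"
    by simp
  also have "\<dots> = run D (Fo a) \<bullet> (?a \<boxtimes> ui) \<bullet> (?a \<boxtimes> Fm ev) \<bullet> Ji a (d \<otimes>\<^sub>o\<^bsub>C\<^esub> a) \<bullet> Fm (alp C a d a)
      \<bullet> J (a \<otimes>\<^sub>o\<^bsub>C\<^esub> d) a \<bullet> (Fm cv \<boxtimes> ?a) \<bullet> (u \<boxtimes> ?a)"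
    unfolding Ji_assoc[symmetric, OF \<open>a \<in> Obj C\<close> \<open>d \<in> Obj C\<close> \<open>a \<in> Obj C\<close>] by simp
  also have "\<dots> = run D (Fo a) \<bullet> (?a \<boxtimes> ui) \<bullet> (Ji a \<I>\<^bsub>C\<^esub> \<bullet> Fm (ident C a \<boxtimes>\<^bsub>C\<^esub> ev)) \<bullet> Fm (alp C a d a)
      \<bullet> (Fm (cv \<boxtimes>\<^bsub>C\<^esub> ident C a) \<bullet> J \<I>\<^bsub>C\<^esub> a) \<bullet> (u \<boxtimes> ?a)"
    using Ji_natural[of "ident C a" ev] J_natural[of cv "ident C a"] by (simp del: tgt.merge)
  also have "\<dots> = Fm (run C a) \<bullet> Fm (ident C a \<boxtimes>\<^bsub>C\<^esub> ev) \<bullet> Fm (alp C a d a) \<bullet> Fm (cv \<boxtimes>\<^bsub>C\<^esub> ident C a)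
      \<bullet> J \<I>\<^bsub>C\<^esub> a \<bullet> (u \<boxtimes> ?a)"
    using tgt.cmp_eq_assoc[OF Fm_run_Ji[OF \<open>a \<in> Obj C\<close>]] by (simp del: tgt.merge)
  also have "\<dots> = Fm (run C a \<bullet>\<^bsub>C\<^esub> (ident C a \<boxtimes>\<^bsub>C\<^esub> ev) \<bullet>\<^bsub>C\<^esub> alp C a d a \<bullet>\<^bsub>C\<^esub> (cv \<boxtimes>\<^bsub>C\<^esub> ident C a)) \<bullet> J \<I>\<^bsub>C\<^esub> a
      \<bullet> (u \<boxtimes> ?a)"
    by (simp add: fmap_cmp)
  also have "\<dots> = lun D (Fo a)" unfolding z1 by (simp add: Fm_lun_u)
  finally show ?thesis by (simp add: tgt.zigzag_obj_def in_hom_def)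
qed

text \<open>Transposition is built from tensor structure and \<open>ev\<close> alone, so
  \<open>Fm\<close> carries it to transposition along the image pairing, up to coherence.\<close>

lemma hat_image:
  assumes z: "src.zigzag_obj a d cv ev" and X: "in_hom C X c (a \<otimes>\<^sub>o\<^bsub>C\<^esub> y)" and [simp]: "y \<in> Obj C"
  shows "tgt.hat (Fo a) (Fo d) (ui \<bullet> Fm ev \<bullet> J d a) (Fo y) (Ji a y \<bullet> Fm X) = Fm (src.hat a d ev y X)
      \<bullet> J d c"
proof -
  have [simp]: "a \<in> Obj C" "d \<in> Obj C" and ev: "in_hom C ev (d \<otimes>\<^sub>o\<^bsub>C\<^esub> a) \<I>\<^bsub>C\<^esub>"
    using z by (auto simp: src.zigzag_obj_def)
  note [simp] = in_homD(1-4)[OF X] in_homD(1-3)[OF ev]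
  let ?d = "ident D (Fo d)" and ?y = "ident D (Fo y)"
  have "Fm (src.hat a d ev y X) \<bullet> J d c = Fm (lun C y) \<bullet> Fm (ev \<boxtimes>\<^bsub>C\<^esub> ident C y) \<bullet> Fm (alpi C d a y)
      \<bullet> Fm (ident C d \<boxtimes>\<^bsub>C\<^esub> X) \<bullet> J d c"
    by (simp add: src.hat_def fmap_cmp)
  also have "\<dots> = Fm (lun C y) \<bullet> Fm (ev \<boxtimes>\<^bsub>C\<^esub> ident C y) \<bullet> (Fm (alpi C d a y) \<bullet> J d (a \<otimes>\<^sub>o\<^bsub>C\<^esub> y))
      \<bullet> (?d \<boxtimes> Fm X)"
    using J_natural[of "ident C d" X] by simp
  also have "\<dots> = Fm (lun C y) \<bullet> (Fm (ev \<boxtimes>\<^bsub>C\<^esub> ident C y) \<bullet> J (d \<otimes>\<^sub>o\<^bsub>C\<^esub> a) y) \<bullet> (J d a \<boxtimes> ?y)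
      \<bullet> alpi D (Fo d) (Fo a) (Fo y) \<bullet> (?d \<boxtimes> Ji a y) \<bullet> (?d \<boxtimes> Fm X)"
    by (simp add: Fm_alpi_J)
  also have "\<dots> = (Fm (lun C y) \<bullet> J \<I>\<^bsub>C\<^esub> y) \<bullet> (Fm ev \<boxtimes> ?y) \<bullet> (J d a \<boxtimes> ?y) \<bullet> alpi D (Fo d) (Fo a) (Fo y)
      \<bullet> (?d \<boxtimes> Ji a y) \<bullet> (?d \<boxtimes> Fm X)"
    using J_natural[of ev "ident C y"] by simp
  also have "\<dots> = tgt.hat (Fo a) (Fo d) (ui \<bullet> Fm ev \<bullet> J d a) (Fo y) (Ji a y \<bullet> Fm X)"
    by (simp add: Fm_lun tgt.hat_def)
  finally show ?thesis by simp
qed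

section \<open>The adjunction as a bijection on arrows\<close>

definition counit :: "'p \<Rightarrow> ('p, 'n) arrow" where "counit x = mk_arr (Fo (Go x)) (\<epsilon> x) x"
definition unit :: "'o \<Rightarrow> ('o, 'm) arrow" where "unit c = mk_arr c (\<eta> c) (Go (Fo c))"

lemma counit_sel [simp]: "source (counit x) = Fo (Go x)" "target (counit x) = x" "under (counit x) = \<epsilon> x"
  "source (unit c) = c" "target (unit c) = Go (Fo c)" "under (unit c) = \<eta> c"
  by (simp_all add: counit_def unit_def)

lemma counit_arr [simp]: "x \<in> Obj D \<Longrightarrow> arr D (counit x)" "c \<in> Obj C \<Longrightarrow> arr C (unit c)"
  by (simp_all add: counit_def unit_def unit_mor counit_mor)

lemma counit_nat: "arr D X \<Longrightarrow> counit (target X) \<bullet> Fm (Gm X) = X \<bullet> counit (source X)"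
  using counit_natural[of "source X" "target X" "under X"] arr_und[of D X] by (intro arr_eqI[of D]) simp_all

lemma unit_nat: "arr C X \<Longrightarrow> unit (target X) \<bullet>\<^bsub>C\<^esub> X = Gm (Fm X) \<bullet>\<^bsub>C\<^esub> unit (source X)"
  using unit_natural[of "source X" "target X" "under X"] arr_und[of C X] by (intro arr_eqI[of C]) simp_all

lemma triangle_F: "c \<in> Obj C \<Longrightarrow> counit (Fo c) \<bullet> Fm (unit c) = ident D (Fo c)"
  using triangle_left[of c] by (intro arr_eqI[of D]) simp_all

lemma triangle_G: "x \<in> Obj D \<Longrightarrow> Gm (counit x) \<bullet>\<^bsub>C\<^esub> unit (Go x) = ident C (Go x)"
  using triangle_right[of x] by (intro arr_eqI[of C]) simp_all

text \<open>\<open>X\<close> is recovered from its adjunct \<open>counit x \<bullet> Fm X\<close> by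
  applying \<open>Gm\<close> and precomposing with \<open>unit\<close>, by the triangle
  identity.\<close>

lemma transpose_inj:
  assumes "in_hom C X c (Go x)" "in_hom C Y c (Go x)" "x \<in> Obj D" "counit x \<bullet> Fm X = counit x \<bullet> Fm Y"
  shows "X = Y"
proof -
  have *: "X = Gm (counit x \<bullet> Fm X) \<bullet>\<^bsub>C\<^esub> unit c" if "in_hom C X c (Go x)" for X
    using in_homD(1-4)[OF that] assms(3) unit_nat[of X] src.cmp_eq_assoc[OF triangle_G[OF assms(3)], of X]
    by (simp add: right.fmap_cmp)
  show ?thesis using *[OF assms(1)] *[OF assms(2)] assms(4) by simp
qed

lemma transpose_surj:
  assumes "in_hom D X (Fo c) x" "c \<in> Obj C"
  obtains Y where "in_hom C Y c (Go x)" "counit x \<bullet> Fm Y = X"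
proof (rule that)
  note * = in_homD(1-5)[OF assms(1)] assms(2)
  show "in_hom C (Gm X \<bullet>\<^bsub>C\<^esub> unit c) c (Go x)" using * by (simp add: in_hom_def)
  have "counit x \<bullet> Fm (Gm X \<bullet>\<^bsub>C\<^esub> unit c) = (counit x \<bullet> Fm (Gm X)) \<bullet> Fm (unit c)" using *
      by (simp add: fmap_cmp)
  also have "\<dots> = X" using counit_nat[of X] * triangle_F[of c] by simp
  finally show "counit x \<bullet> Fm (Gm X \<bullet>\<^bsub>C\<^esub> unit c) = X" .
qed

text \<open>The defining equation prescribes the adjunct of \<open>adj_mu\<close>; existence and
  uniqueness behind the \<open>THE\<close> are surjectivity and injectivity of passing to adjuncts.
  The coherence isomorphism is moved to the right-hand side as \<open>Ji\<close>.\<close>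

lemma adj_mu:
  assumes x [simp]: "x \<in> Obj D" and y [simp]: "y \<in> Obj D"
  defines "Mx \<equiv> mk_arr (Go x \<otimes>\<^sub>o\<^bsub>C\<^esub> Go y) (adj_mu C D F G \<epsilon> x y) (Go (x \<otimes>\<^sub>o y))"
  shows "arr C Mx" "counit (x \<otimes>\<^sub>o y) \<bullet> Fm Mx = (counit x \<boxtimes> counit y) \<bullet> Ji (Go x) (Go y)"
proof -
  let ?c = "Go x \<otimes>\<^sub>o\<^bsub>C\<^esub> Go y" and ?z = "x \<otimes>\<^sub>o y"
  let ?E = "(counit x \<boxtimes> counit y) \<bullet> Ji (Go x) (Go y)"
  have "in_hom D ?E (Fo ?c) ?z" by (simp add: in_hom_def)
  then obtain Y where Y: "in_hom C Y ?c (Go ?z)" "counit ?z \<bullet> Fm Y = ?E"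
    using transpose_surj[of ?E ?c ?z] by auto
  have eq: "(\<mu> \<in> mor C ?c (Go ?z) \<and> \<epsilon> ?z \<cdot> on_mor F \<mu> \<cdot> tens_iso F (Go x) (Go y) = \<epsilon> x \<otimes>\<^sub>m \<epsilon> y)
    \<longleftrightarrow> in_hom C (mk_arr ?c \<mu> (Go ?z)) ?c (Go ?z) \<and> counit ?z \<bullet> Fm (mk_arr ?c \<mu> (Go ?z)) = ?E" for \<mu>
  proof (cases "\<mu> \<in> mor C ?c (Go ?z)")
    case True
    let ?N = "mk_arr ?c \<mu> (Go ?z)"
    have N: "arr C ?N" using True by simp
    have "counit ?z \<bullet> Fm ?N = ?E \<longleftrightarrow> (counit ?z \<bullet> Fm ?N) \<bullet> J (Go x) (Go y) = counit x \<boxtimes> counit y"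
    proof
      assume "counit ?z \<bullet> Fm ?N = ?E"
      then show "(counit ?z \<bullet> Fm ?N) \<bullet> J (Go x) (Go y) = counit x \<boxtimes> counit y" by simp
    next
      assume "(counit ?z \<bullet> Fm ?N) \<bullet> J (Go x) (Go y) = counit x \<boxtimes> counit y"
      from tgt.cmp_eq_assoc[OF this, of "Ji (Go x) (Go y)"]
      show "counit ?z \<bullet> Fm ?N = ?E" using N by simp
    qed
    also have "\<dots> \<longleftrightarrow> \<epsilon> ?z \<cdot> on_mor F \<mu> \<cdot> tens_iso F (Go x) (Go y) = \<epsilon> x \<otimes>\<^sub>m \<epsilon> y"
      using N by (subst arr_eq_iff[of D]) (simp_all del: tgt.cmp_assoc)
    finally show ?thesis using True by simp
  qed simp
  have "adj_mu C D F G \<epsilon> x y = under Y" unfolding adj_mu_def eq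
  proof (rule the_equality)
    show "in_hom C (mk_arr ?c (under Y) (Go ?z)) ?c (Go ?z) \<and> counit ?z \<bullet> Fm (mk_arr ?c (under Y) (Go ?z))
        = ?E"
      unfolding mk_und[OF Y(1)] using Y by simp
  next
    fix \<mu> assume "in_hom C (mk_arr ?c \<mu> (Go ?z)) ?c (Go ?z) \<and> counit ?z \<bullet> Fm (mk_arr ?c \<mu> (Go ?z)) = ?E"
    then have "mk_arr ?c \<mu> (Go ?z) = Y" using Y by (intro transpose_inj[of _ ?c ?z]) simp_all
    then show "\<mu> = under Y" by auto
  qed
  then have "Mx = Y" using mk_und[OF Y(1)] by (simp add: Mx_def)
  then show "arr C Mx" "counit (x \<otimes>\<^sub>o y) \<bullet> Fm Mx = ?E" using Y by (auto simp: in_hom_def)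
qed

end

lemma (in tensor_category) algebra_objectI:
  assumes M: "in_hom C M (A \<otimes>\<^sub>o A) A" and U: "in_hom C U \<I> A"
    and assoc: "M \<bullet> (M \<boxtimes> ident C A) = M \<bullet> (ident C A \<boxtimes> M) \<bullet> alp C A A A"
    and unit: "M \<bullet> (U \<boxtimes> ident C A) = lun C A" "M \<bullet> (ident C A \<boxtimes> U) = run C A"
  shows "algebra_object C A (under M) (under U)"
proof -
  note [simp] = in_homD[OF M] in_homD[OF U]
  have "M \<bullet> (M \<boxtimes> ident C A) = (M \<bullet> (ident C A \<boxtimes> M)) \<bullet> alp C A A A" using assoc by simp
  then show ?thesis unfolding algebra_object_def
    using unit by (simp add: arr_eq_iff[of C] del: cmp_assoc)
qed

locale adjoint_algebra = monoidal_adjunction K C D F G \<eta> \<epsilon> + alg: algebra_in K D A m i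
  for K :: "('k, 'z) ring_scheme" and C :: "('o, 'm, 'k, 'y) tensor_cat_scheme"
    and D :: "('p, 'n, 'k, 'x) tensor_cat_scheme" (structure)
    and F :: "('o, 'm, 'p, 'n, 'w) tensor_functor_data_scheme"
    and G :: "('p, 'n, 'o, 'm, 'v) functor_data_scheme" and \<eta> :: "'o \<Rightarrow> 'm" and \<epsilon> :: "'p \<Rightarrow> 'n"
    and A :: 'p and m i :: 'n
begin

section \<open>The algebra structure on \<open>T\<close> and its free modules\<close>

abbreviation T where "T \<equiv> Go A"
abbreviation tm where "tm \<equiv> adj_mult C D F G \<epsilon> A m"
abbreviation ti where "ti \<equiv> adj_unit C D F G \<eta> i"
abbreviation e where "e \<equiv> counit A"

definition TM :: "('o, 'm) arrow" where "TM = mk_arr (T \<otimes>\<^sub>o\<^bsub>C\<^esub> T) tm T"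
definition TU :: "('o, 'm) arrow" where "TU = mk_arr \<I>\<^bsub>C\<^esub> ti T"

text \<open>By naturality of the counit, \<open>e\<close> is multiplicative up to coherence. Later
  computations with the multiplication of \<open>T\<close> go through this equation instead of
  \<open>adj_mu\<close>.\<close>

lemma TM: "arr C TM" "e \<bullet> Fm TM = alg.Mu \<bullet> (e \<boxtimes> e) \<bullet> Ji T T"
proof -
  let ?N = "mk_arr (T \<otimes>\<^sub>o\<^bsub>C\<^esub> T) (adj_mu C D F G \<epsilon> A A) (Go (A \<otimes>\<^sub>o A))"
  note N = adj_mu[OF alg.algebra_obj alg.algebra_obj]
  have TM_eq: "TM = Gm alg.Mu \<bullet>\<^bsub>C\<^esub> ?N"
    using mk_und[of C "Gm alg.Mu \<bullet>\<^bsub>C\<^esub> ?N" "T \<otimes>\<^sub>o\<^bsub>C\<^esub> T" T] N(1) by (simp add: in_hom_def TM_def adj_mult_def)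
  then show "arr C TM" using N(1) by simp
  have "e \<bullet> Fm TM = (counit (target alg.Mu) \<bullet> Fm (Gm alg.Mu)) \<bullet> Fm ?N"
    unfolding TM_eq using N(1) by (simp add: fmap_cmp)
  also have "\<dots> = alg.Mu \<bullet> counit (A \<otimes>\<^sub>o A) \<bullet> Fm ?N" by (subst counit_nat) simp_all
  also have "\<dots> = alg.Mu \<bullet> (e \<boxtimes> e) \<bullet> Ji T T" unfolding N(2) by simp
  finally show "e \<bullet> Fm TM = alg.Mu \<bullet> (e \<boxtimes> e) \<bullet> Ji T T" .
qed

lemma TU: "arr C TU" "e \<bullet> Fm TU = alg.Unt \<bullet> ui"
proof -
  let ?U = "alg.Unt \<bullet> ui"
  have "under ui = inv_mor D \<I> (Fo \<I>\<^bsub>C\<^esub>) (unit_iso F)" by (simp add: inv_arr_def)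
  then have TU_eq: "TU = Gm ?U \<bullet>\<^bsub>C\<^esub> unit \<I>\<^bsub>C\<^esub>"
    using mk_und[of C "Gm ?U \<bullet>\<^bsub>C\<^esub> unit \<I>\<^bsub>C\<^esub>" "\<I>\<^bsub>C\<^esub>" T] by (simp add: in_hom_def TU_def adj_unit_def)
  then show "arr C TU" by simp
  have "e \<bullet> Fm TU = (counit (target ?U) \<bullet> Fm (Gm ?U)) \<bullet> Fm (unit \<I>\<^bsub>C\<^esub>)"
    unfolding TU_eq by (simp add: fmap_cmp)
  also have "\<dots> = ?U" by (subst counit_nat) (simp_all add: triangle_F)
  finally show "e \<bullet> Fm TU = ?U" .
qed

lemma TM_sel [simp]: "arr C TM" "source TM = T \<otimes>\<^sub>o\<^bsub>C\<^esub> T" "target TM = T" "under TM = tm"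
  "arr C TU" "source TU = \<I>\<^bsub>C\<^esub>" "target TU = T" "under TU = ti"
  using TM(1) TU(1) by (simp_all add: TM_def TU_def)

text \<open>Adjuncts are compared: on either side the adjunct is the threefold product of
  \<open>e\<close> in \<open>A\<close>, bracketed differently, and \<open>Ji_assoc\<close> matches
  the associators of the two categories.\<close>

lemma T_assoc: "TM \<bullet>\<^bsub>C\<^esub> (TM \<boxtimes>\<^bsub>C\<^esub> ident C T) = TM \<bullet>\<^bsub>C\<^esub> (ident C T \<boxtimes>\<^bsub>C\<^esub> TM) \<bullet>\<^bsub>C\<^esub> alp C T T T"
proof (rule transpose_inj[of _ "(T \<otimes>\<^sub>o\<^bsub>C\<^esub> T) \<otimes>\<^sub>o\<^bsub>C\<^esub> T" A])
  let ?FT = "ident D (Fo T)"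
  have "e \<bullet> Fm (TM \<bullet>\<^bsub>C\<^esub> (TM \<boxtimes>\<^bsub>C\<^esub> ident C T)) = (e \<bullet> Fm TM) \<bullet> Fm (TM \<boxtimes>\<^bsub>C\<^esub> ident C T)" by (simp add: fmap_cmp)
  also have "\<dots> = alg.Mu \<bullet> (e \<boxtimes> e) \<bullet> Ji T T \<bullet> Fm (TM \<boxtimes>\<^bsub>C\<^esub> ident C T)" unfolding TM(2) by simp
  also have "\<dots> = alg.Mu \<bullet> ((e \<bullet> Fm TM) \<boxtimes> e) \<bullet> Ji (T \<otimes>\<^sub>o\<^bsub>C\<^esub> T) T" using Ji_natural[of TM "ident C T"] by simp
  also have "\<dots> = (alg.Mu \<bullet> (alg.Mu \<boxtimes> alg.idA)) \<bullet> ((e \<boxtimes> e) \<boxtimes> e) \<bullet> (Ji T T \<boxtimes> ?FT) \<bullet> Ji (T \<otimes>\<^sub>o\<^bsub>C\<^esub> T) T"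
      unfolding TM(2) by simp
  also have "\<dots> = alg.Mu \<bullet> (alg.idA \<boxtimes> alg.Mu) \<bullet> (alp D A A A \<bullet> ((e \<boxtimes> e) \<boxtimes> e)) \<bullet> (Ji T T \<boxtimes> ?FT)
      \<bullet> Ji (T \<otimes>\<^sub>o\<^bsub>C\<^esub> T) T"
    unfolding alg.Mu_assoc by simp
  also have "\<dots> = alg.Mu \<bullet> (alg.idA \<boxtimes> alg.Mu) \<bullet> (e \<boxtimes> (e \<boxtimes> e)) \<bullet> alp D (Fo T) (Fo T) (Fo T) \<bullet> (Ji T T \<boxtimes> ?FT)
      \<bullet> Ji (T \<otimes>\<^sub>o\<^bsub>C\<^esub> T) T"
    using tgt.alp_natural[of e e e] by simp
  also have "\<dots> = alg.Mu \<bullet> (alg.idA \<boxtimes> alg.Mu) \<bullet> (e \<boxtimes> (e \<boxtimes> e)) \<bullet> (?FT \<boxtimes> Ji T T) \<bullet> Ji T (T \<otimes>\<^sub>o\<^bsub>C\<^esub> T)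
      \<bullet> Fm (alp C T T T)"
    by (subst Ji_assoc[symmetric]) simp_all
  also have "\<dots> = alg.Mu \<bullet> (e \<boxtimes> (e \<bullet> Fm TM)) \<bullet> Ji T (T \<otimes>\<^sub>o\<^bsub>C\<^esub> T) \<bullet> Fm (alp C T T T)" unfolding TM(2) by simp
  also have "\<dots> = alg.Mu \<bullet> (e \<boxtimes> e) \<bullet> ((?FT \<boxtimes> Fm TM) \<bullet> Ji T (T \<otimes>\<^sub>o\<^bsub>C\<^esub> T)) \<bullet> Fm (alp C T T T)" by simp
  also have "\<dots> = (alg.Mu \<bullet> (e \<boxtimes> e) \<bullet> Ji T T) \<bullet> Fm (ident C T \<boxtimes>\<^bsub>C\<^esub> TM) \<bullet> Fm (alp C T T T)"
    using tgt.cmp_eq_assoc[OF Ji_natural[of "ident C T" TM]] by simp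
  also have "\<dots> = e \<bullet> Fm (TM \<bullet>\<^bsub>C\<^esub> (ident C T \<boxtimes>\<^bsub>C\<^esub> TM) \<bullet>\<^bsub>C\<^esub> alp C T T T)" unfolding TM(2)[symmetric]
      by (simp add: fmap_cmp)
  finally show "e \<bullet> Fm (TM \<bullet>\<^bsub>C\<^esub> (TM \<boxtimes>\<^bsub>C\<^esub> ident C T)) = e \<bullet> Fm (TM \<bullet>\<^bsub>C\<^esub> (ident C T \<boxtimes>\<^bsub>C\<^esub> TM)
      \<bullet>\<^bsub>C\<^esub> alp C T T T)" .
qed (simp_all add: in_hom_def)

lemma T_unit_left: "TM \<bullet>\<^bsub>C\<^esub> (TU \<boxtimes>\<^bsub>C\<^esub> ident C T) = lun C T"
proof (rule transpose_inj[of _ "\<I>\<^bsub>C\<^esub> \<otimes>\<^sub>o\<^bsub>C\<^esub> T" A])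
  let ?FT = "ident D (Fo T)"
  have "e \<bullet> Fm (TM \<bullet>\<^bsub>C\<^esub> (TU \<boxtimes>\<^bsub>C\<^esub> ident C T)) = (e \<bullet> Fm TM) \<bullet> Fm (TU \<boxtimes>\<^bsub>C\<^esub> ident C T)" by (simp add: fmap_cmp)
  also have "\<dots> = alg.Mu \<bullet> (e \<boxtimes> e) \<bullet> Ji T T \<bullet> Fm (TU \<boxtimes>\<^bsub>C\<^esub> ident C T)" unfolding TM(2) by simp
  also have "\<dots> = alg.Mu \<bullet> ((e \<bullet> Fm TU) \<boxtimes> e) \<bullet> Ji \<I>\<^bsub>C\<^esub> T" using Ji_natural[of TU "ident C T"] by simp
  also have "\<dots> = (alg.Mu \<bullet> (alg.Unt \<boxtimes> alg.idA)) \<bullet> (ident D \<I> \<boxtimes> e) \<bullet> (ui \<boxtimes> ?FT) \<bullet> Ji \<I>\<^bsub>C\<^esub> T" unfolding TU(2)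
      by simp
  also have "\<dots> = e \<bullet> (lun D (Fo T) \<bullet> (ui \<boxtimes> ?FT)) \<bullet> Ji \<I>\<^bsub>C\<^esub> T"
    unfolding alg.Mu_left_unit using tgt.cmp_eq_assoc[OF tgt.lun_natural[of e]] by (simp del: tgt.merge)
  also have "\<dots> = e \<bullet> Fm (lun C T)" by (subst Fm_lun[symmetric]) simp_all
  finally show "e \<bullet> Fm (TM \<bullet>\<^bsub>C\<^esub> (TU \<boxtimes>\<^bsub>C\<^esub> ident C T)) = e \<bullet> Fm (lun C T)" .
qed (simp_all add: in_hom_def)

lemma T_unit_right: "TM \<bullet>\<^bsub>C\<^esub> (ident C T \<boxtimes>\<^bsub>C\<^esub> TU) = run C T"
proof (rule transpose_inj[of _ "T \<otimes>\<^sub>o\<^bsub>C\<^esub> \<I>\<^bsub>C\<^esub>" A])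
  let ?FT = "ident D (Fo T)"
  have "e \<bullet> Fm (TM \<bullet>\<^bsub>C\<^esub> (ident C T \<boxtimes>\<^bsub>C\<^esub> TU)) = (e \<bullet> Fm TM) \<bullet> Fm (ident C T \<boxtimes>\<^bsub>C\<^esub> TU)" by (simp add: fmap_cmp)
  also have "\<dots> = alg.Mu \<bullet> (e \<boxtimes> e) \<bullet> Ji T T \<bullet> Fm (ident C T \<boxtimes>\<^bsub>C\<^esub> TU)" unfolding TM(2) by simp
  also have "\<dots> = alg.Mu \<bullet> (e \<boxtimes> (e \<bullet> Fm TU)) \<bullet> Ji T \<I>\<^bsub>C\<^esub>" using Ji_natural[of "ident C T" TU] by simp
  also have "\<dots> = (alg.Mu \<bullet> (alg.idA \<boxtimes> alg.Unt)) \<bullet> (e \<boxtimes> ident D \<I>) \<bullet> (?FT \<boxtimes> ui) \<bullet> Ji T \<I>\<^bsub>C\<^esub>" unfolding TU(2)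
      by simp
  also have "\<dots> = e \<bullet> (run D (Fo T) \<bullet> (?FT \<boxtimes> ui)) \<bullet> Ji T \<I>\<^bsub>C\<^esub>"
    unfolding alg.Mu_right_unit using tgt.cmp_eq_assoc[OF tgt.run_natural[of e]] by (simp del: tgt.merge)
  also have "\<dots> = e \<bullet> Fm (run C T)" by (subst Fm_run[symmetric]) simp_all
  finally show "e \<bullet> Fm (TM \<bullet>\<^bsub>C\<^esub> (ident C T \<boxtimes>\<^bsub>C\<^esub> TU)) = e \<bullet> Fm (run C T)" .
qed (simp_all add: in_hom_def)

lemma T_algebra: "algebra_object C T tm ti"
  using src.algebra_objectI[of TM T TU] T_assoc T_unit_left T_unit_right by (simp add: in_hom_def)

sublocale Talg: algebra_in K C T tm ti
  by unfold_locales (rule T_algebra)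

lemma Talg_Mu: "Talg.Mu = TM" "Talg.Unt = TU"
  by (simp_all add: Talg.Mu_def Talg.Unt_def TM_def TU_def)

text \<open>On morphisms \<open>c \<rightarrow> d \<otimes> T\<close>, regarded as module maps \<open>c \<otimes> T \<rightarrow> d \<otimes> T\<close> between free modules, \<open>H\<close> is
  the comparison functor to free \<open>A\<close>-modules.\<close>

definition H :: "'o \<Rightarrow> ('o, 'm) arrow \<Rightarrow> ('p, 'n) arrow"
  where "H d X = (ident D (Fo d) \<boxtimes> e) \<bullet> Ji d T \<bullet> Fm X"

lemma H_in_hom: "in_hom C X c (d \<otimes>\<^sub>o\<^bsub>C\<^esub> T) \<Longrightarrow> d \<in> Obj C \<Longrightarrow> in_hom D (H d X) (Fo c) (Fo d \<otimes>\<^sub>o A)"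
  by (simp add: H_def in_hom_def)

text \<open>Functoriality of the comparison: multiplicativity of \<open>e\<close> converts the
  product in \<open>T\<close> into that of \<open>A\<close>, and naturality and associativity of
  \<open>Ji\<close> do the rest.\<close>

lemma H_ext:
  assumes X: "in_hom C X c (d \<otimes>\<^sub>o\<^bsub>C\<^esub> T)" and Y: "in_hom C Y d (z \<otimes>\<^sub>o\<^bsub>C\<^esub> T)" and z [simp]: "z \<in> Obj C"
  shows "H z (Talg.ext z Y \<bullet>\<^bsub>C\<^esub> X) = alg.ext (Fo z) (H z Y) \<bullet> H d X"
proof -
  note [simp] = in_homD(1-5)[OF X] in_homD(1-5)[OF Y]
  let ?z = "ident D (Fo z)" and ?FT = "ident D (Fo T)" and ?TT = "T \<otimes>\<^sub>o\<^bsub>C\<^esub> T"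
  have "H z (Talg.ext z Y \<bullet>\<^bsub>C\<^esub> X) = (?z \<boxtimes> e) \<bullet> (Ji z T \<bullet> Fm (ident C z \<boxtimes>\<^bsub>C\<^esub> TM)) \<bullet> Fm (alp C z T T)
      \<bullet> Fm (Y \<boxtimes>\<^bsub>C\<^esub> ident C T) \<bullet> Fm X"
    by (simp add: H_def Talg.ext_def Talg.act_def Talg_Mu fmap_cmp)
  also have "\<dots> = (?z \<boxtimes> (e \<bullet> Fm TM)) \<bullet> Ji z ?TT \<bullet> Fm (alp C z T T) \<bullet> Fm (Y \<boxtimes>\<^bsub>C\<^esub> ident C T) \<bullet> Fm X"
    using Ji_natural[of "ident C z" TM] by simp
  also have "\<dots> = (?z \<boxtimes> alg.Mu) \<bullet> (?z \<boxtimes> (e \<boxtimes> e)) \<bullet> ((?z \<boxtimes> Ji T T) \<bullet> Ji z ?TT \<bullet> Fm (alp C z T T))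
      \<bullet> Fm (Y \<boxtimes>\<^bsub>C\<^esub> ident C T) \<bullet> Fm X"
    unfolding TM(2) by simp
  also have "\<dots> = (?z \<boxtimes> alg.Mu) \<bullet> (?z \<boxtimes> (e \<boxtimes> e)) \<bullet> alp D (Fo z) (Fo T) (Fo T) \<bullet> (Ji z T \<boxtimes> ?FT)
      \<bullet> (Ji (z \<otimes>\<^sub>o\<^bsub>C\<^esub> T) T \<bullet> Fm (Y \<boxtimes>\<^bsub>C\<^esub> ident C T)) \<bullet> Fm X"
    by (subst Ji_assoc) simp_all
  also have "\<dots> = (?z \<boxtimes> alg.Mu) \<bullet> ((?z \<boxtimes> (e \<boxtimes> e)) \<bullet> alp D (Fo z) (Fo T) (Fo T)) \<bullet> (Ji z T \<boxtimes> ?FT)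
      \<bullet> (Fm Y \<boxtimes> ?FT) \<bullet> Ji d T \<bullet> Fm X"
    using Ji_natural[of Y "ident C T"] by simp
  also have "\<dots> = (?z \<boxtimes> alg.Mu) \<bullet> alp D (Fo z) A A \<bullet> ((?z \<boxtimes> e) \<boxtimes> e) \<bullet> (Ji z T \<boxtimes> ?FT) \<bullet> (Fm Y \<boxtimes> ?FT) \<bullet> Ji d T
      \<bullet> Fm X"
    using tgt.cmp_eq_assoc[OF tgt.alp_natural[of ?z e e]] by (simp del: tgt.merge)
  also have "\<dots> = alg.ext (Fo z) (H z Y) \<bullet> H d X"
    by (simp add: H_def alg.ext_def alg.act_def)
  finally show ?thesis .
qed

text \<open>The link to the adjunction: after transposing away the factor \<open>d\<close> on both
  sides, \<open>H\<close> becomes passage to the adjunct for the target \<open>T\<close>, up to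
  \<open>J\<close>.\<close>

lemma hat_H:
  assumes z: "src.zigzag_obj d d' cv ev" and X: "in_hom C X c (d \<otimes>\<^sub>o\<^bsub>C\<^esub> T)"
  shows "tgt.hat (Fo d) (Fo d') (ui \<bullet> Fm ev \<bullet> J d' d) A (H d X) = e \<bullet> Fm (src.hat d d' ev T X) \<bullet> J d' c"
proof -
  let ?ev = "ui \<bullet> Fm ev \<bullet> J d' d" and ?d = "ident D (Fo d')"
  have [simp]: "d \<in> Obj C" "d' \<in> Obj C" and ev: "in_hom C ev (d' \<otimes>\<^sub>o\<^bsub>C\<^esub> d) \<I>\<^bsub>C\<^esub>"
    using z by (auto simp: src.zigzag_obj_def)
  note [simp] = in_homD(1-5)[OF X] in_homD(1-3)[OF ev]
  have [simp]: "arr D ?ev" "source ?ev = Fo d' \<otimes>\<^sub>o Fo d" "target ?ev = \<I>" by simp_all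
  have "tgt.hat (Fo d) (Fo d') ?ev A (H d X)
    = lun D A \<bullet> (?ev \<boxtimes> alg.idA) \<bullet> alpi D (Fo d') (Fo d) A \<bullet> (?d \<boxtimes> (ident D (Fo d) \<boxtimes> e)) \<bullet> (?d \<boxtimes> (Ji d T
        \<bullet> Fm X))"
    by (simp add: tgt.hat_def H_def)
  also have "\<dots> = lun D A \<bullet> (?ev \<boxtimes> alg.idA) \<bullet> ((?d \<boxtimes> ident D (Fo d)) \<boxtimes> e) \<bullet> alpi D (Fo d') (Fo d) (Fo T)
      \<bullet> (?d \<boxtimes> (Ji d T \<bullet> Fm X))"
    using tgt.cmp_eq_assoc[OF tgt.alpi_natural[of ?d "ident D (Fo d)" e]]
        by (simp del: tgt.merge tgt.tns_ident)
  also have "\<dots> = (lun D A \<bullet> (ident D \<I> \<boxtimes> e)) \<bullet> (?ev \<boxtimes> ident D (Fo T)) \<bullet> alpi D (Fo d') (Fo d) (Fo T)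
      \<bullet> (?d \<boxtimes> (Ji d T \<bullet> Fm X))"
    by simp
  also have "\<dots> = e \<bullet> tgt.hat (Fo d) (Fo d') ?ev (Fo T) (Ji d T \<bullet> Fm X)"
    using tgt.lun_natural[of e] by (simp add: tgt.hat_def)
  finally show ?thesis unfolding hat_image[OF z X right.on_obj_closed[OF alg.algebra_obj]] .
qed

text \<open>By \<open>hat_H\<close>, equal images give equal adjuncts of the transposes; the
  adjunction and then \<open>unhat_hat\<close> undo the two passages.\<close>

lemma H_inj:
  assumes z: "src.zigzag_obj d d' cv ev" and X: "in_hom C X c (d \<otimes>\<^sub>o\<^bsub>C\<^esub> T)"
      and Y: "in_hom C Y c (d \<otimes>\<^sub>o\<^bsub>C\<^esub> T)" and eq: "H d X = H d Y"
  shows "X = Y"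
proof -
  have dc: "d \<in> Obj C" "d' \<in> Obj C" "c \<in> Obj C" using z X by (auto simp: src.zigzag_obj_def dest: in_homD)
  note hX = src.hat_in_hom[OF z X] and hY = src.hat_in_hom[OF z Y]
  have "(e \<bullet> Fm (src.hat d d' ev T X)) \<bullet> J d' c = (e \<bullet> Fm (src.hat d d' ev T Y)) \<bullet> J d' c"
    using hat_H[OF z X] hat_H[OF z Y] eq by simp
  then have "e \<bullet> Fm (src.hat d d' ev T X) = e \<bullet> Fm (src.hat d d' ev T Y)"
    by (rule tgt.cancel_right[of _ "J d' c" _ "Ji d' c" "Fo (d' \<otimes>\<^sub>o\<^bsub>C\<^esub> c)"])
      (use hX hY dc in \<open>simp_all add: in_hom_def\<close>)
  then have "src.hat d d' ev T X = src.hat d d' ev T Y"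
    using transpose_inj[OF hX hY] by simp
  moreover have "T \<in> Obj C" by simp
  ultimately show ?thesis using src.unhat_hat[OF z X] src.unhat_hat[OF z Y] by metis
qed

text \<open>The preimage is found by running \<open>hat_H\<close> backwards: transpose
  \<open>Y\<close> along the image of the dual, take the adjunct, transpose back in
  \<open>C\<close>. Injectivity of \<open>hat\<close> for the image pairing finishes the
  proof.\<close>

lemma H_surj:
  assumes z: "src.zigzag_obj d d' cv ev" "src.zigzag_dual d d' cv ev" and c: "c \<in> Obj C"
    and Y: "in_hom D Y (Fo c) (Fo d \<otimes>\<^sub>o A)"
  obtains X where "in_hom C X c (d \<otimes>\<^sub>o\<^bsub>C\<^esub> T)" "H d X = Y"
proof -
  have [simp]: "d \<in> Obj C" "d' \<in> Obj C" "c \<in> Obj C" using z c by (auto simp: src.zigzag_obj_def)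
  let ?ev = "ui \<bullet> Fm ev \<bullet> J d' d"
  let ?h = "tgt.hat (Fo d) (Fo d') ?ev A"
  note z' = zigzag_image[OF z(1)]
  note hY = tgt.hat_in_hom[OF z' Y alg.algebra_obj]
  have "in_hom D (?h Y \<bullet> Ji d' c) (Fo (d' \<otimes>\<^sub>o\<^bsub>C\<^esub> c)) A" using hY by (simp add: in_hom_def)
  then obtain W where W: "in_hom C W (d' \<otimes>\<^sub>o\<^bsub>C\<^esub> c) T" "e \<bullet> Fm W = ?h Y \<bullet> Ji d' c"
    by (rule transpose_surj) simp
  let ?X = "src.unhat d d' cv c W"
  note X = src.unhat_in_hom[OF z(1) W(1) c]
  have "?h (H d ?X) = e \<bullet> Fm W \<bullet> J d' c"
    unfolding hat_H[OF z(1) X] src.hat_unhat[OF z W(1) c] ..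
  also have "\<dots> = ?h Y" using tgt.cmp_eq_assoc[OF W(2), of "J d' c"] hY by (simp add: in_hom_def)
  finally have "?h (H d ?X) = ?h Y" .
  then have "H d ?X = Y"
    using tgt.unhat_hat[OF z' Y] tgt.unhat_hat[OF z' H_in_hom[OF X]] by (metis alg.algebra_obj \<open>d \<in> Obj C\<close>)
  then show thesis using that X by blast
qed

lemma klregular_transfer:
  assumes dual: "\<And>a. a \<in> Obj C \<Longrightarrow> \<exists>d. is_dual C a d" and kl: alg.kleisli_regular
  shows Talg.kleisli_regular
  unfolding Talg.kleisli_regular_def
proof (intro ballI allI impI)
  fix x y X assume xy: "x \<in> Obj C" "y \<in> Obj C" and X: "in_hom C X x (y \<otimes>\<^sub>o\<^bsub>C\<^esub> T)"
  obtain dx cx ex where zx: "src.zigzag_obj x dx cx ex" "src.zigzag_dual x dx cx ex"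
    using dual[OF xy(1)] src.is_dualE[OF _ xy(1)] by metis
  obtain dy cy ey where zy: "src.zigzag_obj y dy cy ey" "src.zigzag_dual y dy cy ey"
    using dual[OF xy(2)] src.is_dualE[OF _ xy(2)] by metis
  \<comment> \<open>A quasi-inverse of the image of \<open>X\<close> is pulled back by fullness of
    the comparison functor, and the equation by faithfulness.\<close>
  obtain W where W: "in_hom D W (Fo y) (Fo x \<otimes>\<^sub>o A)" "alg.ext (Fo y) (H y X) \<bullet> alg.ext (Fo x) W \<bullet> H y X
      = H y X"
    using kl xy H_in_hom[OF X xy(2)] unfolding alg.kleisli_regular_def by (meson on_obj_closed)
  obtain Y where Y: "in_hom C Y y (x \<otimes>\<^sub>o\<^bsub>C\<^esub> T)" "H x Y = W" using H_surj[OF zx xy(2) W(1)] .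
  have YX: "in_hom C (Talg.ext x Y \<bullet>\<^bsub>C\<^esub> X) x (x \<otimes>\<^sub>o\<^bsub>C\<^esub> T)"
    using X Talg.ext_sel[OF Y(1) xy(1)] by (simp add: in_hom_def)
  have XYX: "in_hom C (Talg.ext y X \<bullet>\<^bsub>C\<^esub> Talg.ext x Y \<bullet>\<^bsub>C\<^esub> X) x (y \<otimes>\<^sub>o\<^bsub>C\<^esub> T)"
    using YX Talg.ext_sel[OF X xy(2)] X Talg.ext_sel[OF Y(1) xy(1)] by (simp add: in_hom_def)
  have "H y (Talg.ext y X \<bullet>\<^bsub>C\<^esub> Talg.ext x Y \<bullet>\<^bsub>C\<^esub> X) = H y X"
    unfolding H_ext[OF YX X xy(2)] H_ext[OF X Y(1) xy(1)] Y(2) by (rule W(2))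
  then have "Talg.ext y X \<bullet>\<^bsub>C\<^esub> Talg.ext x Y \<bullet>\<^bsub>C\<^esub> X = X" by (rule H_inj[OF zy(1) XYX X])
  then show "\<exists>Y. in_hom C Y y (x \<otimes>\<^sub>o\<^bsub>C\<^esub> T) \<and> Talg.ext y X \<bullet>\<^bsub>C\<^esub> Talg.ext x Y \<bullet>\<^bsub>C\<^esub> X = X"
    using Y(1) by blast
qed

text \<open>The adjunction bijection for the unit object, followed by precomposition with the
  isomorphism \<open>u\<close>, is linear.\<close>

lemma connected_transfer: "vectorspace.dim K (Hom C \<I>\<^bsub>C\<^esub> T) = vectorspace.dim K (Hom D \<I> A)"
proof -
  have FT: "Fo T \<in> Obj D" "Fo \<I>\<^bsub>C\<^esub> \<in> Obj D" by simp_all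
  interpret V: vectorspace K "Hom C \<I>\<^bsub>C\<^esub> T" by (rule src.hom_vectorspace) simp_all
  interpret W: vectorspace K "Hom D \<I> A" by (rule tgt.hom_vectorspace) simp_all
  interpret m1: mod_hom K "Hom C \<I>\<^bsub>C\<^esub> T" "Hom D (Fo \<I>\<^bsub>C\<^esub>) (Fo T)" "on_mor F" by (rule fmap_mod_hom) simp_all
  interpret m2: mod_hom K "Hom D (Fo \<I>\<^bsub>C\<^esub>) (Fo T)" "Hom D (Fo \<I>\<^bsub>C\<^esub>) A" "\<lambda>f. \<epsilon> A \<cdot> f"
    by (rule tgt.hom_mod_hom) (simp_all add: counit_mor)
  have umor: "unit_iso F \<in> mor D \<I> (Fo \<I>\<^bsub>C\<^esub>)" using arr_und[of D u] by simp
  interpret m3: mod_hom K "Hom D (Fo \<I>\<^bsub>C\<^esub>) A" "Hom D \<I> A" "\<lambda>f. f \<cdot> unit_iso F"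
    by (rule tgt.hom_mod_hom) (simp_all add: umor)
  let ?L = "\<lambda>f. (\<epsilon> A \<cdot> on_mor F f) \<cdot> unit_iso F"
  have "?L \<in> module_hom K (Hom C \<I>\<^bsub>C\<^esub> T) (Hom D \<I> A)" unfolding module_hom_def by auto
  then interpret L: linear_map K "Hom C \<I>\<^bsub>C\<^esub> T" "Hom D \<I> A" ?L by unfold_locales
  have L: "mk_arr \<I> (?L f) A = (e \<bullet> Fm (mk_arr \<I>\<^bsub>C\<^esub> f T)) \<bullet> u" if "f \<in> mor C \<I>\<^bsub>C\<^esub> T" for f
    using that umor by (intro arr_eqI[of D]) (simp_all del: tgt.cmp_assoc add: fmap_def)
  show ?thesis
  proof (rule L.dim_eq)
    show "V.fin_dim" by (rule src.hom_fin_dim) simp_all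
    show "inj_on ?L (mor C \<I>\<^bsub>C\<^esub> T)"
    proof (rule inj_onI)
      fix f g assume f: "f \<in> mor C \<I>\<^bsub>C\<^esub> T" and g: "g \<in> mor C \<I>\<^bsub>C\<^esub> T" and "?L f = ?L g"
      then have "(e \<bullet> Fm (mk_arr \<I>\<^bsub>C\<^esub> f T)) \<bullet> u = (e \<bullet> Fm (mk_arr \<I>\<^bsub>C\<^esub> g T)) \<bullet> u"
          unfolding L[OF f, symmetric] L[OF g, symmetric] by (simp only:)
      then have "e \<bullet> Fm (mk_arr \<I>\<^bsub>C\<^esub> f T) = e \<bullet> Fm (mk_arr \<I>\<^bsub>C\<^esub> g T)"
        by (rule tgt.cancel_right[of _ u _ ui "Fo \<I>\<^bsub>C\<^esub>"]) (use f g in simp_all)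
      then have "mk_arr \<I>\<^bsub>C\<^esub> f T = mk_arr \<I>\<^bsub>C\<^esub> g T" using f g by (intro transpose_inj[of _ "\<I>\<^bsub>C\<^esub>"
          A]) simp_all
      then show "f = g" by simp
    qed
    show "?L ` mor C \<I>\<^bsub>C\<^esub> T = mor D \<I> A"
    proof
      show "mor D \<I> A \<subseteq> ?L ` mor C \<I>\<^bsub>C\<^esub> T"
      proof
        fix h assume h: "h \<in> mor D \<I> A"
        then have "in_hom D (mk_arr \<I> h A \<bullet> ui) (Fo \<I>\<^bsub>C\<^esub>) A" by (simp add: in_hom_def)
        then obtain Y where Y: "in_hom C Y \<I>\<^bsub>C\<^esub> T" "e \<bullet> Fm Y = mk_arr \<I> h A \<bullet> ui"
          by (rule transpose_surj) simp
        have "mk_arr \<I> (?L (under Y)) A = (e \<bullet> Fm Y) \<bullet> u" using L[OF in_homD(6)[OF Y(1)]] mk_und[OF Y(1)]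
            by simp
        also have "\<dots> = mk_arr \<I> h A" unfolding Y(2) using h by simp
        finally show "h \<in> ?L ` mor C \<I>\<^bsub>C\<^esub> T" using in_homD(6)[OF Y(1)]
            by (intro image_eqI[of _ _ "under Y"]) simp_all
      qed
    qed auto
  qed
qed

end

section \<open>Connected semisimple algebras are Frobenius\<close>

context algebra_in begin

lemma Mu_assoc_alpi: "Mu \<bullet> (idA \<boxtimes> Mu) = Mu \<bullet> (Mu \<boxtimes> idA) \<bullet> alpi C A A A"
  using cmp_eq_assoc[OF Mu_assoc, of "alpi C A A A"] by simp

text \<open>Invariance \<open>k (a, b c) = k (a b, c)\<close> of the pairing
  \<open>k = E Mu\<close>, that is associativity of \<open>Mu\<close>, in transposed form:
  multiplying the first output leg of \<open>X\<close> from the left can be done at the paired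
  argument instead.\<close>

lemma hat_mult:
  assumes E: "in_hom C E A \<I>" and X: "in_hom C X x (A \<otimes>\<^sub>o Y)" and [simp]: "Y \<in> Obj C"
  shows "hat A A (E \<bullet> Mu) Y ((Mu \<boxtimes> ident C Y) \<bullet> alpi C A A Y \<bullet> (idA \<boxtimes> X))
    = hat A A (E \<bullet> Mu) Y X \<bullet> (Mu \<boxtimes> ident C x) \<bullet> alpi C A A x"
proof -
  note [simp] = in_homD(1-5)[OF E] in_homD(1-5)[OF X]
  let ?Y = "ident C Y" and ?AA = "A \<otimes>\<^sub>o A" and ?k = "E \<bullet> Mu"
  have "hat A A ?k Y ((Mu \<boxtimes> ?Y) \<bullet> alpi C A A Y \<bullet> (idA \<boxtimes> X))
    = lun C Y \<bullet> (?k \<boxtimes> ?Y) \<bullet> (alpi C A A Y \<bullet> (idA \<boxtimes> (Mu \<boxtimes> ?Y))) \<bullet> (idA \<boxtimes> alpi C A A Y) \<bullet> (idA \<boxtimes> (idA \<boxtimes> X))"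
    by (simp add: hat_def)
  also have "\<dots> = lun C Y \<bullet> (?k \<boxtimes> ?Y) \<bullet> ((idA \<boxtimes> Mu) \<boxtimes> ?Y) \<bullet> alpi C A ?AA Y \<bullet> (idA \<boxtimes> alpi C A A Y)
      \<bullet> (idA \<boxtimes> (idA \<boxtimes> X))"
    using cmp_eq_assoc[OF alpi_natural[of idA Mu ?Y]] by (simp del: merge tns_ident)
  also have "\<dots> = lun C Y \<bullet> ((E \<bullet> Mu \<bullet> (idA \<boxtimes> Mu)) \<boxtimes> ?Y) \<bullet> alpi C A ?AA Y \<bullet> (idA \<boxtimes> alpi C A A Y)
      \<bullet> (idA \<boxtimes> (idA \<boxtimes> X))"
    by simp
  also have "\<dots> = lun C Y \<bullet> (?k \<boxtimes> ?Y) \<bullet> ((Mu \<boxtimes> idA) \<boxtimes> ?Y) \<bullet> ((alpi C A A A \<boxtimes> ?Y) \<bullet> alpi C A ?AA Y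
      \<bullet> (idA \<boxtimes> alpi C A A Y)) \<bullet> (idA \<boxtimes> (idA \<boxtimes> X))"
    unfolding Mu_assoc_alpi by simp
  also have "\<dots> = lun C Y \<bullet> (?k \<boxtimes> ?Y) \<bullet> (((Mu \<boxtimes> idA) \<boxtimes> ?Y) \<bullet> alpi C ?AA A Y) \<bullet> alpi C A A (A \<otimes>\<^sub>o Y)
      \<bullet> (idA \<boxtimes> (idA \<boxtimes> X))"
    by (subst pentagon_alpi) simp_all
  also have "\<dots> = lun C Y \<bullet> (?k \<boxtimes> ?Y) \<bullet> alpi C A A Y \<bullet> (Mu \<boxtimes> (idA \<boxtimes> ?Y)) \<bullet> ((idA \<boxtimes> idA) \<boxtimes> X) \<bullet> alpi C A A x"
    using cmp_eq_assoc[OF alpi_natural[of Mu idA ?Y]] alpi_natural[of idA idA X]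
        by (simp del: merge tns_ident)
  also have "\<dots> = hat A A ?k Y X \<bullet> (Mu \<boxtimes> ident C x) \<bullet> alpi C A A x" by (simp add: hat_def)
  finally show ?thesis .
qed

lemma frobenius_algebraI:
  assumes E: "in_hom C E A \<I>" and D: "in_hom C D A (A \<otimes>\<^sub>o A)"
    and coassoc: "alp C A A A \<bullet> (D \<boxtimes> idA) \<bullet> D = (idA \<boxtimes> D) \<bullet> D"
    and counit: "lun C A \<bullet> (E \<boxtimes> idA) \<bullet> D = idA" "run C A \<bullet> (idA \<boxtimes> E) \<bullet> D = idA"
    and frob: "(Mu \<boxtimes> idA) \<bullet> alpi C A A A \<bullet> (idA \<boxtimes> D) = D \<bullet> Mu" "D \<bullet> Mu = (idA \<boxtimes> Mu) \<bullet> alp C A A A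
        \<bullet> (D \<boxtimes> idA)"
  shows "frobenius_algebra C A m i"
proof -
  note [simp] = in_homD(1-3,6)[OF E] in_homD(1-3,6)[OF D]
  have "(alp C A A A \<bullet> (D \<boxtimes> idA)) \<bullet> D = (idA \<boxtimes> D) \<bullet> D"
    "(lun C A \<bullet> (E \<boxtimes> idA)) \<bullet> D = idA" "(run C A \<bullet> (idA \<boxtimes> E)) \<bullet> D = idA"
    "((Mu \<boxtimes> idA) \<bullet> alpi C A A A) \<bullet> (idA \<boxtimes> D) = D \<bullet> Mu" "D \<bullet> Mu = ((idA \<boxtimes> Mu) \<bullet> alp C A A A) \<bullet> (D \<boxtimes> idA)"
    using coassoc counit frob by simp_all
  from this[THEN arg_cong[of _ _ under]]
  have "coalgebra_object C A (under D) (under E) \<and>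
    (m \<otimes>\<^sub>m Id C A) \<cdot> associator_inv C A A A \<cdot> (Id C A \<otimes>\<^sub>m under D) = under D \<cdot> m \<and>
    under D \<cdot> m = (Id C A \<otimes>\<^sub>m m) \<cdot> associator C A A A \<cdot> (under D \<otimes>\<^sub>m Id C A)"
    unfolding coalgebra_object_def by (simp del: cmp_assoc merge)
  then show ?thesis unfolding frobenius_algebra_def frobenius_structure_def using algebra by blast
qed

text \<open>The Frobenius axioms are checked after pairing the first tensor factor by \<open>E \<bullet> Mu\<close>, where they
  reduce to the algebra axioms.\<close>

lemma frobenius_of_pairing:
  assumes E: "in_hom C E A \<I>"
    and inj: "\<And>X X' x Y. \<lbrakk>in_hom C X x (A \<otimes>\<^sub>o Y); in_hom C X' x (A \<otimes>\<^sub>o Y); Y \<in> Obj C;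
      hat A A (E \<bullet> Mu) Y X = hat A A (E \<bullet> Mu) Y X'\<rbrakk> \<Longrightarrow> X = X'"
    and D: "in_hom C D A (A \<otimes>\<^sub>o A)" and hat_D: "hat A A (E \<bullet> Mu) A D = Mu"
  shows "frobenius_algebra C A m i"
proof -
  note [simp] = in_homD(1-3)[OF E] in_homD(1-3)[OF D]
  let ?AA = "A \<otimes>\<^sub>o A" and ?k = "E \<bullet> Mu"
  have k: "in_hom C ?k ?AA \<I>" by (simp add: in_hom_def)
  have Mu: "in_hom C Mu ?AA A" by (simp add: in_hom_def)
  \<comment> \<open>Transposed, the sides are the two bracketings of a threefold product, since
    \<open>D\<close> transposes to \<open>Mu\<close>.\<close>
  have frob1: "(Mu \<boxtimes> idA) \<bullet> alpi C A A A \<bullet> (idA \<boxtimes> D) = D \<bullet> Mu"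
  proof (rule inj[of _ ?AA A])
    show "hat A A ?k A ((Mu \<boxtimes> idA) \<bullet> alpi C A A A \<bullet> (idA \<boxtimes> D)) = hat A A ?k A (D \<bullet> Mu)"
      using hat_mult[OF E D] hat_cmp[OF k D Mu] by (simp add: hat_D Mu_assoc_alpi)
  qed (simp_all add: in_hom_def)
  have alpD: "in_hom C (alp C A A A \<bullet> (D \<boxtimes> idA)) ?AA (A \<otimes>\<^sub>o ?AA)" by (simp add: in_hom_def)
  have hat_alpD: "hat A A ?k ?AA (alp C A A A \<bullet> (D \<boxtimes> idA)) = (Mu \<boxtimes> idA) \<bullet> alpi C A A A"
    using hat_tns[OF k D, of A] by (simp add: hat_D)
  \<comment> \<open>Again associativity of \<open>Mu\<close>: the right-hand side transposes to
    \<open>Mu\<close> after \<open>hat_alpD\<close>.\<close>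
  have frob2: "D \<bullet> Mu = (idA \<boxtimes> Mu) \<bullet> alp C A A A \<bullet> (D \<boxtimes> idA)"
  proof (rule inj[of _ ?AA A])
    show "hat A A ?k A (D \<bullet> Mu) = hat A A ?k A ((idA \<boxtimes> Mu) \<bullet> alp C A A A \<bullet> (D \<boxtimes> idA))"
      using hat_whisker[OF k alpD Mu] hat_cmp[OF k D Mu] by (simp add: hat_D hat_alpD Mu_assoc_alpi)
  qed (simp_all add: in_hom_def)
  \<comment> \<open>Both sides transpose to \<open>D \<bullet> Mu\<close>, one of them by
    \<open>frob1\<close>.\<close>
  have coassoc: "alp C A A A \<bullet> (D \<boxtimes> idA) \<bullet> D = (idA \<boxtimes> D) \<bullet> D"
  proof (rule inj[of _ A ?AA])
    have "hat A A ?k ?AA ((alp C A A A \<bullet> (D \<boxtimes> idA)) \<bullet> D) = ((Mu \<boxtimes> idA) \<bullet> alpi C A A A) \<bullet> (idA \<boxtimes> D)"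
      using hat_cmp[OF k alpD D] by (simp add: hat_alpD)
    also have "\<dots> = D \<bullet> Mu" using frob1 by simp
    also have "\<dots> = hat A A ?k ?AA ((idA \<boxtimes> D) \<bullet> D)" using hat_whisker[OF k D D] by (simp add: hat_D)
    finally show "hat A A ?k ?AA (alp C A A A \<bullet> (D \<boxtimes> idA) \<bullet> D) = hat A A ?k ?AA ((idA \<boxtimes> D) \<bullet> D)" by simp
  qed (simp_all add: in_hom_def)
  \<comment> \<open>Both sides transpose to the pairing itself, the right one by
    \<open>pairing_unit\<close>.\<close>
  have "(idA \<boxtimes> E) \<bullet> D = runi C A"
  proof (rule inj[of _ A \<I>])
    have "hat A A ?k \<I> ((idA \<boxtimes> E) \<bullet> D) = ?k" using hat_whisker[OF k D E] by (simp add: hat_D)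
    also have "\<dots> = hat A A ?k \<I> (runi C A)" using pairing_unit[OF k] by (simp add: hat_def)
    finally show "hat A A ?k \<I> ((idA \<boxtimes> E) \<bullet> D) = hat A A ?k \<I> (runi C A)" .
  qed (simp_all add: in_hom_def)
  then have counit_right: "run C A \<bullet> (idA \<boxtimes> E) \<bullet> D = idA" by simp
  \<comment> \<open>\<open>E\<close> is the pairing with the unit in its first slot, so the left
    counit law is the transpose \<open>Mu\<close> of \<open>D\<close> evaluated at
    \<open>Unt\<close>, hence the unit law.\<close>
  have "(lun C A \<bullet> (E \<boxtimes> idA) \<bullet> D) \<bullet> lun C A = lun C A \<bullet> (E \<boxtimes> idA) \<bullet> lun C ?AA \<bullet> (ident C \<I> \<boxtimes> D)"
    using lun_natural[of D] by simp
  also have "\<dots> = lun C A \<bullet> (E \<boxtimes> idA) \<bullet> (lun C ?AA \<bullet> alp C \<I> A A) \<bullet> alpi C \<I> A A \<bullet> (ident C \<I> \<boxtimes> D)" by simp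
  also have "\<dots> = lun C A \<bullet> (E \<boxtimes> idA) \<bullet> ((Mu \<bullet> (Unt \<boxtimes> idA)) \<boxtimes> idA) \<bullet> alpi C \<I> A A \<bullet> (ident C \<I> \<boxtimes> D)"
    unfolding lun_tensor[OF algebra_obj algebra_obj] Mu_left_unit ..
  also have "\<dots> = lun C A \<bullet> (?k \<boxtimes> idA) \<bullet> (((Unt \<boxtimes> idA) \<boxtimes> idA) \<bullet> alpi C \<I> A A) \<bullet> (ident C \<I> \<boxtimes> D)" by simp
  also have "\<dots> = lun C A \<bullet> (?k \<boxtimes> idA) \<bullet> alpi C A A A \<bullet> (Unt \<boxtimes> (idA \<boxtimes> idA)) \<bullet> (ident C \<I> \<boxtimes> D)"
    using cmp_eq_assoc[OF alpi_natural[of Unt idA idA]] by (simp del: merge tns_ident)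
  also have "\<dots> = hat A A ?k A D \<bullet> (Unt \<boxtimes> idA)" by (simp add: hat_def)
  also have "\<dots> = idA \<bullet> lun C A" unfolding hat_D by (simp add: Mu_left_unit)
  finally have "lun C A \<bullet> (E \<boxtimes> idA) \<bullet> D = idA"
    by (rule cancel_right[of _ "lun C A" _ "luni C A" A]) simp_all
  then show ?thesis by (rule frobenius_algebraI[OF E D coassoc _ counit_right frob1 frob2])
qed

text \<open>The pairing \<open>E \<bullet> Mu\<close> is nondegenerate: the isomorphism
  \<open>f\<close> identifies transposition along it with transposition along \<open>ev\<close>,
  which is bijective.\<close>

lemma frobenius_of_dual_iso:
  assumes z: "zigzag_obj A d cv ev" "zigzag_dual A d cv ev" and E: "in_hom C E A \<I>"
    and f: "in_hom C f A d" "ev \<bullet> (f \<boxtimes> idA) = E \<bullet> Mu" and g: "in_hom C g d A" "g \<bullet> f = idA" "f \<bullet> g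
        = ident C d"
  shows "frobenius_algebra C A m i"
proof -
  have dO [simp]: "d \<in> Obj C" and ev: "in_hom C ev (d \<otimes>\<^sub>o A) \<I>" using z by (auto simp: zigzag_obj_def)
  note [simp] = in_homD(1-3)[OF E] in_homD(1-3)[OF f(1)] in_homD(1-3)[OF g(1)] in_homD(1-3)[OF ev]
  let ?k = "E \<bullet> Mu"
  have hat_eq: "hat A A ?k Y X = hat A d ev Y X \<bullet> (f \<boxtimes> ident C x)" if X: "in_hom C X x (A \<otimes>\<^sub>o Y)"
      and [simp]: "Y \<in> Obj C" for X x Y
  proof -
    note [simp] = in_homD(1-5)[OF X]
    have "hat A A ?k Y X = lun C Y \<bullet> (ev \<boxtimes> ident C Y) \<bullet> (((f \<boxtimes> idA) \<boxtimes> ident C Y) \<bullet> alpi C A A Y)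
        \<bullet> (idA \<boxtimes> X)"
      unfolding f(2)[symmetric] by (simp add: hat_def)
    also have "\<dots> = lun C Y \<bullet> (ev \<boxtimes> ident C Y) \<bullet> alpi C d A Y \<bullet> (f \<boxtimes> (idA \<boxtimes> ident C Y)) \<bullet> (idA \<boxtimes> X)"
      using cmp_eq_assoc[OF alpi_natural[of f idA "ident C Y"]] by (simp del: merge tns_ident)
    also have "\<dots> = hat A d ev Y X \<bullet> (f \<boxtimes> ident C x)" by (simp add: hat_def)
    finally show ?thesis .
  qed
  have Mg: "in_hom C (Mu \<bullet> (g \<boxtimes> idA)) (d \<otimes>\<^sub>o A) A" by (simp add: in_hom_def)
  \<comment> \<open>The copairing side: \<open>Mu\<close> is transferred to \<open>d\<close> by
    \<open>g\<close> and transposed back, so that its transpose along \<open>?k\<close> is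
    \<open>Mu\<close>.\<close>
  let ?D = "unhat A d cv A (Mu \<bullet> (g \<boxtimes> idA))"
  have D: "in_hom C ?D A (A \<otimes>\<^sub>o A)" using unhat_in_hom[OF z(1) Mg] by simp
  have hat_D: "hat A A ?k A ?D = Mu"
    unfolding hat_eq[OF D algebra_obj] hat_unhat[OF z Mg algebra_obj] using g(2) by simp
  show ?thesis
  proof (rule frobenius_of_pairing[OF E _ D hat_D])
    fix X X' x Y assume X: "in_hom C X x (A \<otimes>\<^sub>o Y)" "in_hom C X' x (A \<otimes>\<^sub>o Y)" and Y: "Y \<in> Obj C"
      and eq: "hat A A ?k Y X = hat A A ?k Y X'"
    note h = hat_in_hom[OF z(1) X(1) Y] hat_in_hom[OF z(1) X(2) Y]
    have x: "x \<in> Obj C" using X by (auto dest: in_homD)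
    have "hat A d ev Y X = hat A d ev Y X'"
      using eq unfolding hat_eq[OF X(1) Y] hat_eq[OF X(2) Y]
      by (rule cancel_right[of _ "f \<boxtimes> ident C x" _ "g \<boxtimes> ident C x" "d \<otimes>\<^sub>o x"])
        (use h x g(3) in \<open>simp_all add: in_hom_def\<close>)
    then show "X = X'" using unhat_hat[OF z(1) X(1) Y] unhat_hat[OF z(1) X(2) Y] by metis
  qed
qed

lemma modl_regular: "modl A Mu"
  by (simp add: modl_def in_hom_def Mu_assoc Mu_right_unit)

text \<open>If the unit vanished, so would the identity of \<open>A\<close> by the unit law, and the
  hom-space would have dimension 0.\<close>

lemma Unt_nonzero:
  assumes "vectorspace.dim K (Hom C \<I> A) = 1"
  shows "Unt \<noteq> zero_arr C \<I> A"
proof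
  assume Unt: "Unt = zero_arr C \<I> A"
  interpret V: vectorspace K "Hom C \<I> A" by (rule hom_vectorspace) simp_all
  have idA: "idA = zero_arr C A A"
  proof -
    have "idA = (Mu \<bullet> (Unt \<boxtimes> idA)) \<bullet> luni C A" unfolding Mu_left_unit by simp
    then show ?thesis unfolding Unt by simp
  qed
  have "f = \<zero>\<^bsub>Hom C \<I> A\<^esub>" if "f \<in> mor C \<I> A" for f
  proof -
    have "mk_arr \<I> f A = idA \<bullet> mk_arr \<I> f A" using that by simp
    also have "\<dots> = zero_arr C \<I> A" unfolding idA using that by simp
    finally show ?thesis by (simp add: zero_arr_def)
  qed
  then have "mor C \<I> A = {\<zero>\<^bsub>Hom C \<I> A\<^esub>}" by auto
  then show False using V.dim_trivial assms by simp
qed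

lemma connected_imp_scl:
  assumes "vectorspace.dim K (Hom C \<I> A) = 1" and X: "in_hom C X \<I> A"
  obtains c where "c \<in> carrier K" "X = smult_arr C c Unt"
proof -
  interpret V: vectorspace K "Hom C \<I> A" by (rule hom_vectorspace) simp_all
  have Unt: "in_hom C Unt \<I> A" by (simp add: in_hom_def)
  have "i \<noteq> \<zero>\<^bsub>Hom C \<I> A\<^esub>" using Unt_nonzero[OF assms(1)] by (auto simp: Unt_def zero_arr_def)
  then obtain c where c: "c \<in> carrier K" "under X = c \<odot>\<^bsub>Hom C \<I> A\<^esub> i"
    using V.dim_1_imp_smult[OF hom_fin_dim assms(1) _ _ in_homD(6)[OF X]] algebra_mor by auto
  have "X = smult_arr C c Unt" using c mk_und[OF X] by (simp add: smult_arr_def)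
  then show thesis using that c(1) by blast
qed

text \<open>The algebra is simple as a right module over itself, its endomorphisms being scalars; so the
  kernel of \<open>f\<close>, which is a right ideal on which \<open>E\<close> vanishes, is zero.\<close>

lemma connected_pairing_left_inverse:
  assumes ss: "semisimple_category C" and mod: modules_regular and dim: "vectorspace.dim K (Hom C \<I> A) = 1"
    and z: "zigzag_obj A d cv ev" "zigzag_dual A d cv ev" and E: "in_hom C E A \<I>" and EU: "E
        \<bullet> Unt \<noteq> zero_arr C \<I> \<I>"
    and f: "in_hom C f A d" "ev \<bullet> (f \<boxtimes> idA) = E \<bullet> Mu"
  obtains g where "in_hom C g d A" "g \<bullet> f = idA"
proof -
  have [simp]: "d \<in> Obj C" and ev: "in_hom C ev (d \<otimes>\<^sub>o A) \<I>" using z by (auto simp: zigzag_obj_def)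
  obtain g where g: "in_hom C g d A" "f \<bullet> g \<bullet> f = f"
    using regularE[OF semisimple_imp_regular[OF ss] f(1)] .
  note [simp] = in_homD(1-3)[OF E] in_homD(1-3)[OF f(1)] in_homD(1-3)[OF g(1)] in_homD(1-3)[OF ev]
  have gf: "in_hom C (g \<bullet> f) A A" "(g \<bullet> f) \<bullet> g \<bullet> f = g \<bullet> f" using g by (auto simp: in_hom_def)
  \<comment> \<open>Projector onto the kernel of \<open>f\<close>; splitting it yields the inclusion
    \<open>J\<close> of that kernel.\<close>
  let ?p = "idA \<boxplus> neg_arr C (g \<bullet> f)"
  have p: "in_hom C ?p A A" by (simp add: in_hom_def)
  obtain k P J where k: "in_hom C P A k" "in_hom C J k A" "J \<bullet> P = ?p" "P \<bullet> J = ident C k"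
    using split_idempotentsE[OF semisimple_imp_split_idempotents[OF ss] p ident_add_neg_idem[OF gf]] .
  note [simp] = in_homD(1-3)[OF k(1)] in_homD(1-4)[OF k(2)]
  have "f \<bullet> J = f \<bullet> (J \<bullet> P) \<bullet> J" using k(4) by simp
  also have "\<dots> = zero_arr C k d" unfolding k(3) using cmp_eq_assoc[OF g(2), of J]
      by (simp add: cmp_add_left cmp_add_right)
  finally have fJ: "f \<bullet> J = zero_arr C k d" .
  have kJ: "E \<bullet> Mu \<bullet> (J \<boxtimes> idA) = zero_arr C (k \<otimes>\<^sub>o A) \<I>"
  proof -
    have "E \<bullet> Mu \<bullet> (J \<boxtimes> idA) = ev \<bullet> ((f \<bullet> J) \<boxtimes> idA)" using cmp_eq_assoc[OF f(2), of "J \<boxtimes> idA"] by simp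
    then show ?thesis unfolding fJ by simp
  qed
  \<comment> \<open>The kernel is a right ideal: by \<open>pairing_inj\<close> it suffices to pair
    with a further element, and invariance moves the product to the second slot, where the pairing
    vanishes on \<open>J\<close> by \<open>kJ\<close>.\<close>
  have "f \<bullet> Mu \<bullet> (J \<boxtimes> idA) = zero_arr C (k \<otimes>\<^sub>o A) d"
  proof (rule pairing_inj[OF z])
    have "ev \<bullet> ((f \<bullet> Mu \<bullet> (J \<boxtimes> idA)) \<boxtimes> idA) = E \<bullet> (Mu \<bullet> (Mu \<boxtimes> idA)) \<bullet> ((J \<boxtimes> idA) \<boxtimes> idA)"
      using cmp_eq_assoc[OF f(2), of "(Mu \<bullet> (J \<boxtimes> idA)) \<boxtimes> idA"] by simp
    also have "\<dots> = E \<bullet> Mu \<bullet> (idA \<boxtimes> Mu) \<bullet> (J \<boxtimes> (idA \<boxtimes> idA)) \<bullet> alp C k A A"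
      unfolding Mu_assoc using alp_natural[of J idA idA] by (simp del: merge tns_ident)
    also have "\<dots> = (E \<bullet> Mu \<bullet> (J \<boxtimes> idA)) \<bullet> (ident C k \<boxtimes> Mu) \<bullet> alp C k A A" by simp
    also have "\<dots> = ev \<bullet> (zero_arr C (k \<otimes>\<^sub>o A) d \<boxtimes> idA)" unfolding kJ by simp
    finally show "ev \<bullet> ((f \<bullet> Mu \<bullet> (J \<boxtimes> idA)) \<boxtimes> idA) = ev \<bullet> (zero_arr C (k \<otimes>\<^sub>o A) d \<boxtimes> idA)" .
  qed (simp_all add: in_hom_def)
  then have "(J \<bullet> P) \<bullet> Mu \<bullet> (J \<boxtimes> idA) = Mu \<bullet> (J \<boxtimes> idA)" unfolding k(3) by (simp add: cmp_add_left)
  then have stable: "Mu \<bullet> (J \<boxtimes> idA) = J \<bullet> P \<bullet> Mu \<bullet> (J \<boxtimes> idA)" by simp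
  note Q = modl_retract[OF modl_regular k(2,1,4) stable]
  \<comment> \<open>Regularity of module maps makes the right ideal a direct summand as a module;
    \<open>J \<bullet> G\<close> is then a module endomorphism of \<open>A\<close> with values in
    it.\<close>
  obtain G where G: "modhom A Mu k (P \<bullet> Mu \<bullet> (J \<boxtimes> idA)) G" "J \<bullet> G \<bullet> J = J"
    using mod Q modl_regular unfolding modules_regular_def by blast
  have h: "modhom A Mu A Mu (J \<bullet> G)" using modhom_cmp[OF modl_regular Q(1) modl_regular G(1) Q(2)] .
  note [simp] = modhomD(1-3)[OF G(1)]
  \<comment> \<open>Pairing an element of the kernel with the unit gives the value of
    \<open>E\<close> on it.\<close>
  have "E \<bullet> J = E \<bullet> Mu \<bullet> (idA \<boxtimes> Unt) \<bullet> runi C A \<bullet> J"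
    using cmp_eq_assoc[OF Mu_right_unit] by (simp del: merge)
  also have "\<dots> = (E \<bullet> Mu \<bullet> (J \<boxtimes> idA)) \<bullet> (ident C k \<boxtimes> Unt) \<bullet> runi C k"
    using runi_natural[of J] by simp
  also have "\<dots> = zero_arr C k \<I>" unfolding kJ by simp
  finally have EJ: "E \<bullet> J = zero_arr C k \<I>" .
  have "in_hom C (J \<bullet> G \<bullet> Unt) \<I> A" by (simp add: in_hom_def)
  \<comment> \<open>By connectedness the endomorphism sends the unit to a multiple of the unit.
    Applying \<open>E\<close>, which kills the kernel but not the unit, shows that the multiple is
    zero.\<close>
  then obtain c where c: "c \<in> carrier K" "J \<bullet> G \<bullet> Unt = smult_arr C c Unt"
    by (rule connected_imp_scl[OF dim])
  have "smult_arr C c (E \<bullet> Unt) = E \<bullet> smult_arr C c Unt" using c(1) by (simp add: cmp_scl)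
  also have "\<dots> = zero_arr C \<I> \<I>" unfolding c(2)[symmetric] using cmp_eq_assoc[OF EJ, of "G \<bullet> Unt"] by simp
  finally have "smult_arr C c (E \<bullet> Unt) = zero_arr C \<I> \<I>" .
  then have "smult_arr C c Unt = zero_arr C \<I> A"
    using scl_eq_zer[OF c(1), of "E \<bullet> Unt" \<I> \<I> Unt] EU by (simp add: in_hom_def)
  then have hU: "(J \<bullet> G) \<bullet> Unt = zero_arr C \<I> A" using c(2) by simp
  \<comment> \<open>A module endomorphism of \<open>A\<close> is determined by its value at the
    unit.\<close>
  have "J \<bullet> G = (J \<bullet> G) \<bullet> (Mu \<bullet> (Unt \<boxtimes> idA)) \<bullet> luni C A" unfolding Mu_left_unit by simp
  also have "\<dots> = Mu \<bullet> (((J \<bullet> G) \<bullet> Unt) \<boxtimes> idA) \<bullet> luni C A"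
    using cmp_eq_assoc[OF modhomD(5)[OF h], of "(Unt \<boxtimes> idA) \<bullet> luni C A"] by simp
  also have "\<dots> = zero_arr C A A" unfolding hU by simp
  finally have JG: "J \<bullet> G = zero_arr C A A" .
  have "J = zero_arr C k A" using G(2) cmp_eq_assoc[OF JG, of J] by simp
  then have "?p = zero_arr C A A" unfolding k(3)[symmetric] by simp
  then have "idA = g \<bullet> f" by (rule eq_of_add_neg_eq_zer) simp_all
  then show thesis using that g(1) by simp
qed

text \<open>\<open>X \<mapsto> f X g\<close> embeds End A in End d, and duality embeds End d in End
  A. The composite is an injective endomap of a finite-dimensional space, so it reaches the identity
  of \<open>A\<close>.\<close>

lemma left_inverse_imp_inverse:
  assumes z: "zigzag_obj A d cv ev" "zigzag_dual A d cv ev"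
    and f: "in_hom C f A d" and g: "in_hom C g d A" "g \<bullet> f = idA"
  shows "f \<bullet> g = ident C d"
proof -
  have [simp]: "d \<in> Obj C" and ev: "in_hom C ev (d \<otimes>\<^sub>o A) \<I>" and cv: "in_hom C cv \<I> (A \<otimes>\<^sub>o d)"
    and z1: "run C A \<bullet> (idA \<boxtimes> ev) \<bullet> alp C A d A \<bullet> (cv \<boxtimes> idA) = lun C A"
    using z by (auto simp: zigzag_obj_def)
  note [simp] = in_homD(1-3)[OF f(1)] in_homD(1-3)[OF g(1)] in_homD(1-3)[OF ev] in_homD(1-3)[OF cv]
  \<comment> \<open>The mate of \<open>H\<close> under duality: pair with \<open>ev\<close>, then
    transpose back by \<open>cv\<close>. The zig-zag at \<open>A\<close> makes it send the identity
    to the identity.\<close>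
  define L where "L H = run C A \<bullet> unhat A d cv A (ev \<bullet> (H \<boxtimes> idA))" for H
  have evH: "in_hom C (ev \<bullet> (H \<boxtimes> idA)) (d \<otimes>\<^sub>o A) \<I>" if "in_hom C H d d" for H
    using that by (simp add: in_hom_def)
  have L: "in_hom C (L H) A A" if "in_hom C H d d" for H
    using unhat_in_hom[OF z(1) evH[OF that]] by (simp add: L_def in_hom_def)
  have L_inj: "H = H'" if H: "in_hom C H d d" "in_hom C H' d d" "L H = L H'" for H H'
  proof (rule pairing_inj[OF z H(1,2)])
    note u = unhat_in_hom[OF z(1) evH[OF H(1)] algebra_obj] unhat_in_hom[OF z(1) evH[OF H(2)] algebra_obj]
    have "unhat A d cv A (ev \<bullet> (H \<boxtimes> idA)) = unhat A d cv A (ev \<bullet> (H' \<boxtimes> idA))"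
      using H(3) unfolding L_def
      by (rule cancel_left[of "run C A" _ _ "runi C A" "A \<otimes>\<^sub>o \<I>"]) (use u in \<open>simp_all add: in_hom_def\<close>)
    then show "ev \<bullet> (H \<boxtimes> idA) = ev \<bullet> (H' \<boxtimes> idA)"
      using hat_unhat[OF z evH[OF H(1)] algebra_obj] hat_unhat[OF z evH[OF H(2)] algebra_obj] by metis
  qed
  have L_id: "L (ident C d) = idA"
  proof -
    have "L (ident C d) = (run C A \<bullet> (idA \<boxtimes> ev) \<bullet> alp C A d A \<bullet> (cv \<boxtimes> idA)) \<bullet> luni C A"
      by (simp add: L_def unhat_def)
    then show ?thesis unfolding z1 by simp
  qed
  define N where "N X = L (f \<bullet> X \<bullet> g)" for X
  have fXg: "in_hom C (f \<bullet> X \<bullet> g) d d" if "in_hom C X A A" for X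
    using that by (simp add: in_hom_def)
  obtain X where X: "in_hom C X A A" "N X = idA"
  proof (rule linear_endo_surj[of A A N idA])
    fix X assume "in_hom C X A A"
    then show "in_hom C (N X) A A" unfolding N_def by (intro L fXg)
  next
    fix X Y assume "in_hom C X A A" "in_hom C Y A A"
    then show "N (X \<boxplus> Y) = N X \<boxplus> N Y"
      unfolding N_def L_def unhat_def
      by (simp add: in_hom_def cmp_add_left cmp_add_right tns_add_left tns_add_right)
  next
    fix X c assume "in_hom C X A A" "c \<in> carrier K"
    then show "N (smult_arr C c X) = smult_arr C c (N X)"
      unfolding N_def L_def unhat_def
      by (simp add: in_hom_def cmp_scl tns_scl)
  next
    fix X Y assume XY: "in_hom C X A A" "in_hom C Y A A" "N X = N Y"
    have "f \<bullet> X \<bullet> g = f \<bullet> Y \<bullet> g"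
      using XY(3) unfolding N_def by (rule L_inj[OF fXg[OF XY(1)] fXg[OF XY(2)]])
    then have "g \<bullet> (f \<bullet> X \<bullet> g) \<bullet> f = g \<bullet> (f \<bullet> Y \<bullet> g) \<bullet> f" by (simp only:)
    moreover have "g \<bullet> (f \<bullet> W \<bullet> g) \<bullet> f = W" if "in_hom C W A A" for W
      using in_homD(1-3)[OF that] g(2) cmp_eq_assoc[OF g(2), of W] by simp
    ultimately show "X = Y" using XY(1,2) by metis
  qed (auto simp: in_hom_def)
  have "L (f \<bullet> X \<bullet> g) = L (ident C d)" using X(2) unfolding N_def L_id .
  \<comment> \<open>Injectivity of \<open>L\<close> turns \<open>N X = idA\<close> into an equation
    in End d, exhibiting \<open>X \<bullet> g\<close> as a right inverse of
    \<open>f\<close>.\<close>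
  then have id: "f \<bullet> X \<bullet> g = ident C d" by (rule L_inj[OF fXg[OF X(1)], rotated]) (simp add: in_hom_def)
  have "f \<bullet> g = (f \<bullet> g) \<bullet> f \<bullet> X \<bullet> g" unfolding id by simp
  also have "\<dots> = f \<bullet> X \<bullet> g" using cmp_eq_assoc[OF g(2), of "X \<bullet> g"] in_homD(1-3)[OF X(1)] by simp
  finally show ?thesis using id by simp
qed

theorem connected_semisimple_imp_frobenius:
  assumes ss: "semisimple_category C" and dual: "is_dual C A d"
    and alg: "semisimple_algebra C A m i" and dim: "vectorspace.dim K (Hom C \<I> A) = 1"
  shows "frobenius_algebra C A m i"
proof -
  have mod: modules_regular using alg semisimple_MC[OF ss] unfolding semisimple_algebra_def by blast
  obtain cv ev where z: "zigzag_obj A d cv ev" "zigzag_dual A d cv ev" using is_dualE[OF dual algebra_obj] .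
  have Unt: "in_hom C Unt \<I> A" by (simp add: in_hom_def)
  \<comment> \<open>The functional comes from regularity of the unit; \<open>E \<bullet> Unt\<close>
    cannot vanish, as \<open>Unt E Unt = Unt\<close> is nonzero.\<close>
  obtain E where E: "in_hom C E A \<I>" "Unt \<bullet> E \<bullet> Unt = Unt"
    using regularE[OF semisimple_imp_regular[OF ss] Unt] .
  have EU: "E \<bullet> Unt \<noteq> zero_arr C \<I> \<I>"
    using E(2) Unt_nonzero[OF dim] by auto
  have "in_hom C (E \<bullet> Mu) (A \<otimes>\<^sub>o A) \<I>" using in_homD(1-3)[OF E(1)] by (simp add: in_hom_def)
  then obtain f where f: "in_hom C f A d" "ev \<bullet> (f \<boxtimes> idA) = E \<bullet> Mu"
    by (rule pairing_transpose[OF z(1)]) simp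
  obtain g where g: "in_hom C g d A" "g \<bullet> f = idA"
    using connected_pairing_left_inverse[OF ss mod dim z E(1) EU f] .
  show ?thesis
    by (rule frobenius_of_dual_iso[OF z E(1) f g left_inverse_imp_inverse[OF z f(1) g]])
qed

end

theorem theorem2:
  fixes K :: "('k, 'z) ring_scheme"
    and C :: "('o, 'm, 'k) tensor_cat" and M :: "('p, 'n, 'k) tensor_cat"
    and \<Phi> :: "('o, 'm, 'p, 'n) tensor_functor_data"
    and Tr :: "('p, 'n, 'o, 'm) functor_data"
    and \<eta> :: "'o \<Rightarrow> 'm" and \<epsilon> :: "'p \<Rightarrow> 'n"
    and A :: 'p and m i :: 'n
  assumes "rigid_semisimple_tensor_category K C"
    and "rigid_semisimple_tensor_category K M"
    and "tensor_functor K C M \<Phi>"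
    and "linear_adjunction K C M \<Phi> Tr \<eta> \<epsilon>"
    and "semisimple_algebra M A m i"
  defines "TA \<equiv> on_obj Tr A"
    and "Tm \<equiv> adj_mult C M \<Phi> Tr \<epsilon> A m"
    and "Ti \<equiv> adj_unit C M \<Phi> Tr \<eta> i"
  shows "semisimple_algebra C TA Tm Ti \<and>
    (connected_object K M A \<longrightarrow>
      frobenius_algebra M A m i \<and>
      connected_object K C TA \<and> frobenius_algebra C TA Tm Ti)"
proof -
  interpret C: rigid_semisimple_tensor_category K C by fact
  interpret M: rigid_semisimple_tensor_category K M by fact
  interpret tensor_functor K C M \<Phi> by fact
  interpret linear_adjunction K C M \<Phi> Tr \<eta> \<epsilon> by fact
  have alg: "algebra_object M A m i" using assms(5) by (simp add: semisimple_algebra_def)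
  interpret adjoint_algebra K C M \<Phi> Tr \<eta> \<epsilon> A m i
    by unfold_locales (rule alg)
  \<comment> \<open>Semisimplicity is exchanged for regularity of Kleisli arrows in
    \<open>M\<close>, moved across the adjunction, and exchanged back in \<open>C\<close>.\<close>
  have "alg.kleisli_regular" using alg.semisimple_algebra_iff[OF M.semisimple] assms(5) by blast
  then have ss: "semisimple_algebra C TA Tm Ti"
    unfolding TA_def Tm_def Ti_def
    using klregular_transfer[OF C.has_dual] Talg.semisimple_algebra_iff[OF C.semisimple] by blast
  moreover have "frobenius_algebra M A m i" "connected_object K C TA" "frobenius_algebra C TA Tm Ti"
    if conn: "connected_object K M A"
  proof -
    have dim: "vectorspace.dim K (Hom M \<I>\<^bsub>M\<^esub> A) = 1" using conn by (simp add: connected_object_def)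
    then have dimT: "vectorspace.dim K (Hom C \<I>\<^bsub>C\<^esub> TA) = 1"
      unfolding TA_def using connected_transfer by simp
    obtain d where d: "is_dual M A d" using M.has_dual alg.algebra_obj by blast
    obtain t where t: "is_dual C TA t" using C.has_dual Talg.algebra_obj unfolding TA_def by blast
    show "frobenius_algebra M A m i"
      by (rule alg.connected_semisimple_imp_frobenius[OF M.semisimple d assms(5) dim])
    show "connected_object K C TA" using dimT by (simp add: connected_object_def)
    \<comment> \<open>The criterion is applied a second time, now in \<open>C\<close>:
      \<open>Tr A\<close> is semisimple by \<open>ss\<close> and connected by
      \<open>dimT\<close>.\<close>
    show "frobenius_algebra C TA Tm Ti"
      using Talg.connected_semisimple_imp_frobenius[OF C.semisimple] t ss dimT
      unfolding TA_def Tm_def Ti_def by blast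
  qed
  ultimately show ?thesis by blast
qed

end
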